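(* Let $X_1$ be a Polish space and let $\mathbf M_1\in\mathcal P(\mathcal P(X_1))$ be atomless (i.e. $\mathbf M_1(\{\mu\})=0$ for every $\mu\in\mathcal P(X_1)$) and concentrated on atomless measures (i.e. for $\mathbf M_1$-a.e. $\mu_1$ one has $\mu_1(\{x\})=0$ for every $x\in X_1$). Then: 1. Let $X_2$ be a Polish space and let $c:X_1\times X_2\to[0,+\infty)$ be continuous and bounded. Then for all $\mathbf M_2\in\mathcal P(\mathcal P(X_2))$ it holds $\mathcal C(\mathbf M_1,\mathbf M_2)=\mathcal C_{sM}(\mathbf M_1,\mathbf M_2)$. 2. Let $X_1=X_2=X$ where $(X,d)$ is a complete and separable metric space, and let $p\in[1,+\infty)$. If furthermore $\mathbf M_1,\mathbf M_2\in\mathcal P_p(\mathcal P_p(X))$, then the same holds (with cost $c=d^p$), that is: for all $\varepsilon>0$ there exists a Borel map $T^\varepsilon:X\times\mathcal P(X)\to X$ such that, setting $\mathcal T^\varepsilon(\mu_1):=T^\varepsilon(\cdot,\mu_1)_\sharp\mu_1$, $$\mathcal T^\varepsilon_\sharp\mathbf M_1=\mathbf M_2\quad\text{and}\quad \int_{\mathcal P(X)}\int_X d^p\big(x_1,T^\varepsilon(x_1,\mu_1)\big)\,d\mu_1(x_1)\,d\mathbf M_1(\mu_1)\le \mathcal W_p^p(\mathbf M_1,\mathbf M_2)+\varepsilon .$$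
   Context: For a Polish space $Y$, $\mathcal P(Y)$ is the set of Borel probability measures on $Y$ with the narrow topology (again a Polish space), so $\mathcal P(\mathcal P(Y))$ is defined in the same way. $f_\sharp\mu$ is the push-forward, and $\Gamma(\mu_1,\mu_2)$ is the set of couplings of $\mu_1,\mu_2$ (probability measures on the product with these marginals). For a lower semicontinuous $c:X_1\times X_2\to[0,+\infty]$: $$\mathsf C(\mu_1,\mu_2):=\min_{\pi\in\Gamma(\mu_1,\mu_2)}\int c\,d\pi\quad(\mu_i\in\mathcal P(X_i)),\qquad \mathcal C(\mathbf M_1,\mathbf M_2):=\min_{\Pi\in\Gamma(\mathbf M_1,\mathbf M_2)}\int_{\mathcal P(X_1)\times\mathcal P(X_2)}\mathsf C\,d\Pi\quad(\mathbf M_i\in\mathcal P(\mathcal P(X_i))).$$ The strict Monge cost is $$\mathcal C_{sM}(\mathbf M_1,\mathbf M_2):=\inf\Big\{\int_{\mathcal P(X_1)}\int_{X_1}c(x_1,T(x_1,\mu_1))\,d\mu_1(x_1)\,d\mathbf M_1(\mu_1)\ :\ T:X_1\times\mathcal P(X_1)\to X_2\text{ Borel},\ \mathcal T_\sharp\mathbf M_1=\mathbf M_2\Big\},$$ where $\mathcal T(\mu_1):=T(\cdot,\mu_1)_\sharp\mu_1$ for $\mu_1\in\mathcal P(X_1)$. For a complete separable metric space $(X,d)$: $\mathcal P_p(X)$ is the set of $\mu\in\mathcal P(X)$ with $\int d^p(x,x_0)\,d\mu(x)<+\infty$ for some (hence all) $x_0$, endowed with the $L^p$-Wasserstein distance $W_p$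 (induced by $d$), which makes it a complete separable metric space. $\mathcal P_p(\mathcal P_p(X))$ is the same construction applied to $(\mathcal P_p(X),W_p)$, with Wasserstein distance $\mathcal W_p$. Elements of $\mathcal P_p(\mathcal P_p(X))$ are regarded as elements of $\mathcal P(\mathcal P(X))$ concentrated on $\mathcal P_p(X)$. *)

theory Defs
  imports "HOL-Probability.Probability"
begin

section \<open>Borel probability measures with the narrow topology\<close>

typedef (overloaded) ('a::topological_space) borel_prob =
    "{M :: 'a measure. sets M = sets borel \<and> prob_space M}"
  morphisms to_measure Abs_borel_prob
proof
  show "return borel undefined \<in> {M :: 'a measure. sets M = sets borel \<and> prob_space M}"
    by (simp add: prob_space_return)
qed

text \<open>
  Having the narrow topology as a type class instance makes \<open>borel\<close> available on
  \<open>'a borel_prob\<close>, so that \<open>'a borel_prob borel_prob\<close> is the space of random measures.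
\<close>

instantiation borel_prob :: (topological_space) topological_space
begin

definition open_borel_prob :: "'a borel_prob set \<Rightarrow> bool" where
  "open_borel_prob = generate_topology
     {{\<mu>. (\<integral>x. f x \<partial>to_measure \<mu>) \<in> V} | (f :: 'a \<Rightarrow> real) (V :: real set).
        continuous_on UNIV f \<and> bounded (range f) \<and> open V}"

instance
  by standard (auto simp: open_borel_prob_def
      intro: generate_topology.UNIV generate_topology.Int generate_topology.UN)

end

definition atomless :: "'a::topological_space borel_prob \<Rightarrow> bool" where
  "atomless \<mu> \<longleftrightarrow> (\<forall>x. emeasure (to_measure \<mu>) {x} = 0)"

text \<open>Meaningful only for Borel \<open>f\<close>.\<close>

definition push :: "('a::topological_space \<Rightarrow> 'b::topological_space) \<Rightarrow> 'a borel_prob \<Rightarrow> 'b borel_prob"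
  where "push f \<mu> = Abs_borel_prob (distr (to_measure \<mu>) borel f)"

lemma sets_to_measure [simp, measurable_cong]: "sets (to_measure \<mu>) = sets borel"
  using to_measure[of \<mu>] by simp

lemma prob_space_to_measure: "prob_space (to_measure \<mu>)"
  using to_measure[of \<mu>] by simp

lemma to_measure_push:
  assumes "f \<in> borel_measurable borel"
  shows "to_measure (push f \<mu>) = distr (to_measure \<mu>) borel f"
proof -
  have "f \<in> measurable (to_measure \<mu>) borel"
    using assms by (simp cong: measurable_cong_sets)
  then have "prob_space (distr (to_measure \<mu>) borel f)"
    by (rule prob_space.prob_space_distr[OF prob_space_to_measure])
  then show ?thesis
    by (simp add: push_def Abs_borel_prob_inverse)
qed


section \<open>Transport costs\<close>

definition couplings ::
  "'a::topological_space borel_prob \<Rightarrow> 'b::topological_space borel_prob \<Rightarrow> ('a \<times> 'b) borel_prob set"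
  where "couplings \<mu> \<nu> = {\<pi>. push fst \<pi> = \<mu> \<and> push snd \<pi> = \<nu>}"

text \<open>
  For Polish spaces and lower semicontinuous \<open>c\<close> the infimum is attained.
\<close>

definition transport_cost ::
  "('a::topological_space \<Rightarrow> 'b::topological_space \<Rightarrow> ennreal) \<Rightarrow>
     'a borel_prob \<Rightarrow> 'b borel_prob \<Rightarrow> ennreal"
  where "transport_cost c \<mu> \<nu> =
    (INF \<pi>\<in>couplings \<mu> \<nu>. \<integral>\<^sup>+z. c (fst z) (snd z) \<partial>to_measure \<pi>)"

definition nested_transport_cost ::
  "('a::topological_space \<Rightarrow> 'b::topological_space \<Rightarrow> ennreal) \<Rightarrow>
     'a borel_prob borel_prob \<Rightarrow> 'b borel_prob borel_prob \<Rightarrow> ennreal"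
  where "nested_transport_cost c = transport_cost (transport_cost c)"

definition induced_map ::
  "('a::topological_space \<times> 'a borel_prob \<Rightarrow> 'b::topological_space) \<Rightarrow> 'a borel_prob \<Rightarrow> 'b borel_prob"
  where "induced_map T \<mu> = push (\<lambda>x. T (x, \<mu>)) \<mu>"

definition strict_monge_cost ::
  "('a::topological_space \<Rightarrow> 'b::topological_space \<Rightarrow> ennreal) \<Rightarrow>
     'a borel_prob borel_prob \<Rightarrow> 'b borel_prob borel_prob \<Rightarrow> ennreal"
  where "strict_monge_cost c M\<^sub>1 M\<^sub>2 =
    (INF T\<in>{T \<in> borel_measurable borel. push (induced_map T) M\<^sub>1 = M\<^sub>2}.
       \<integral>\<^sup>+\<mu>. (\<integral>\<^sup>+x. c x (T (x, \<mu>)) \<partial>to_measure \<mu>) \<partial>to_measure M\<^sub>1)"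


section \<open>Wasserstein spaces\<close>

definition epowr :: "ennreal \<Rightarrow> real \<Rightarrow> ennreal" (infixr "epowr" 80) where
  "t epowr p = (if t = \<top> then \<top> else ennreal (enn2real t powr p))"

text \<open>
  The \<open>p\<close>-Wasserstein space and distance over a set \<open>S\<close> with distance \<open>D\<close>. The measures live on
  the ambient topological space and are concentrated on \<open>S\<close>. The distance takes values in
  \<open>[0,\<infinity>]\<close> so that it is meaningful on all probability measures.
\<close>

definition wasserstein_space ::
  "real \<Rightarrow> 'y::topological_space set \<Rightarrow> ('y \<Rightarrow> 'y \<Rightarrow> ennreal) \<Rightarrow> 'y borel_prob set"
  where "wasserstein_space p S D =
    {\<mu>. (AE y in to_measure \<mu>. y \<in> S) \<and>
        (\<exists>y\<^sub>0\<in>S. (\<integral>\<^sup>+y. D y y\<^sub>0 epowr p \<partial>to_measure \<mu>) < \<infinity>)}"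

definition wasserstein ::
  "real \<Rightarrow> ('y::topological_space \<Rightarrow> 'y \<Rightarrow> ennreal) \<Rightarrow> 'y borel_prob \<Rightarrow> 'y borel_prob \<Rightarrow> ennreal"
  where "wasserstein p D \<mu> \<nu> = transport_cost (\<lambda>x y. D x y epowr p) \<mu> \<nu> epowr (1 / p)"

abbreviation edist :: "'a::metric_space \<Rightarrow> 'a \<Rightarrow> ennreal" where
  "edist x y \<equiv> ennreal (dist x y)"

definition Pp :: "real \<Rightarrow> 'a::metric_space borel_prob set" where
  "Pp p = wasserstein_space p UNIV edist"

definition Wp :: "real \<Rightarrow> 'a::metric_space borel_prob \<Rightarrow> 'a borel_prob \<Rightarrow> ennreal" where
  "Wp p = wasserstein p edist"

text \<open>
  The same construction over \<open>(Pp p, Wp p)\<close>. On \<open>Pp p\<close> the Borel sets of \<open>Wp p\<close> are the traces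
  of the narrow Borel sets (for \<open>1 \<le> p\<close> and a Polish ground space), so probability measures on
  \<open>Pp p\<close> are the same as probability measures on \<open>'a borel_prob\<close> concentrated on \<open>Pp p\<close>.
\<close>

definition PpPp :: "real \<Rightarrow> 'a::metric_space borel_prob borel_prob set" where
  "PpPp p = wasserstein_space p (Pp p) (Wp p)"

definition WWp :: "real \<Rightarrow> 'a::metric_space borel_prob borel_prob \<Rightarrow> 'a borel_prob borel_prob \<Rightarrow> ennreal"
  where "WWp p = wasserstein p (Wp p)"

end

theory Submission
  imports Defs
begin

text \<open>
  A measurable code of a Polish space (or of its space of probability measures) by real numbers
  turns an atomless measure into a uniform variable, its rank, and any measure into a sample
  computed from a uniform variable. Composing the two gives exact transport maps that depend
  measurably on both measures.

  To control the cost, the codes are made lexicographic with respect to a finite partition into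
  cells. On the outer level a random coupling \<open>k\<close> with first marginal \<open>M\<^sub>1\<close> yields a map
  \<open>S\<close> with \<open>S\<^sub>\<sharp> M\<^sub>1 = k\<close> such that \<open>\<mu>\<close> and the first marginal of
  \<open>S \<mu>\<close> give nearly the same mass to every cell of \<open>X\<^sub>1\<close>. Sampling from \<open>S \<mu>\<close> at
  the rank of \<open>x\<close> under \<open>\<mu>\<close> and projecting to \<open>X\<^sub>2\<close> then defines \<open>T (x, \<mu>)\<close>, whose
  graph law is close to the mean of \<open>k\<close> on rectangles; so the costs converge as the partition
  is refined.

  A nearly optimal random coupling is selected measurably because couplings of \<open>\<mu>\<close> and \<open>\<nu>\<close>
  are images of copulas under the quantile maps, and one countable dense set of copulas serves
  all pairs \<open>(\<mu>, \<nu>)\<close>. The unbounded cost \<open>d\<^sup>p\<close> is truncated; the excess is bounded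
  by functions of one variable whose integrals depend on the marginals only.
\<close>

section \<open>Countable generation of the narrow topology\<close>

text \<open>The image measures must be exact on both levels, the cost only nearly optimal. Exactness
  is free: a rank has uniform law and a sampler turns the uniform law into the prescribed measure,
  whichever cells order the codes. So only the cost needs control. A coupling of M1 and M2 pairs
  \<mu> with a random \<nu>; replacing each pair by one of its couplings puts both levels into a
  single measure \<open>k\<close>, onto which an atomless M1 can be mapped, at the price that the
  first marginal of \<open>S \<mu>\<close> is no longer \<mu>. Agreement of finitely many cell
  masses repairs this: the graph of \<open>T\<close> then differs from \<open>S \<mu>\<close> only
  in the first coordinate and, up to a small mass, only inside a cell. Convergence on basic
  rectangles already bounds the limiting cost from above, so neither tightness nor a modulus of
  continuity enters. In the selection, limits must pass through quantile maps that are merely Borel,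
  where weak convergence would be lost. Copulas have fixed marginals, and this upgrades convergence
  on basic rectangles to all Borel rectangles, which survives the pull-back.\<close>

primrec list_max :: "('a \<Rightarrow> real) list \<Rightarrow> 'a \<Rightarrow> real" where
  "list_max [] x = 0"
| "list_max (g # gs) x = max (g x) (list_max gs x)"

lemma list_max_nonneg: "0 \<le> list_max gs x"
  by (induction gs) auto

lemma list_max_ge: "g \<in> set gs \<Longrightarrow> g x \<le> list_max gs x"
  by (induction gs) auto

lemma list_max_le: "0 \<le> h x \<Longrightarrow> (\<And>g. g \<in> set gs \<Longrightarrow> g x \<le> h x) \<Longrightarrow> list_max gs x \<le> h x"
  by (induction gs) auto

lemma list_max_measurable:
  "(\<And>g. g \<in> set gs \<Longrightarrow> g \<in> borel_measurable M) \<Longrightarrow> list_max gs \<in> borel_measurable M"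
proof (induction gs)
  case Nil
  then show ?case by (simp add: list_max.simps(1)[abs_def])
next
  case (Cons g gs)
  then have [measurable]: "g \<in> borel_measurable M" "list_max gs \<in> borel_measurable M"
    by auto
  have "list_max (g # gs) = (\<lambda>x. max (g x) (list_max gs x))"
    by auto
  then show ?case by simp
qed

lemma list_max_continuous:
  "(\<And>g. g \<in> set gs \<Longrightarrow> continuous_on UNIV g) \<Longrightarrow> continuous_on UNIV (list_max gs)"
proof (induction gs)
  case Nil
  then show ?case by (simp add: list_max.simps(1)[abs_def])
next
  case (Cons g gs)
  have "list_max (g # gs) = (\<lambda>x. max (g x) (list_max gs x))"
    by auto
  with Cons show ?case by (auto intro!: continuous_on_max)
qed

lemma list_max_bounded:
  "(\<And>g. g \<in> set gs \<Longrightarrow> bounded (range g)) \<Longrightarrow> bounded (range (list_max gs))"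
proof (induction gs)
  case Nil
  then show ?case by simp
next
  case (Cons g gs)
  then obtain a b where a: "\<And>x. \<bar>g x\<bar> \<le> a" and b: "\<And>x. \<bar>list_max gs x\<bar> \<le> b"
    by (force simp: bounded_iff)
  have "\<bar>list_max (g # gs) x\<bar> \<le> max a b" for x
    using a[of x] b[of x] by auto
  then show ?case by (auto simp: bounded_iff)
qed

text \<open>Finite maxima along an enumeration of \<open>G\<close> increase to \<open>h\<close>,
  boundedly, so dominated convergence applies. The empty maximum is 0, which is why
  \<open>sup\<close> only speaks of points with \<open>0 < h x\<close>. Used with bumps for the
  narrow topology and with multiples of indicators for rectangles.\<close>

lemma (in finite_measure) integral_list_max_approx:
  fixes h :: "'a \<Rightarrow> real"
  assumes G: "countable G" "\<And>g. g \<in> G \<Longrightarrow> g \<in> borel_measurable M"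
    and h: "h \<in> borel_measurable M" "\<And>x. 0 \<le> h x" "\<And>x. h x \<le> b"
    and le: "\<And>g x. g \<in> G \<Longrightarrow> g x \<le> h x"
    and sup: "\<And>x s. s < h x \<Longrightarrow> 0 < h x \<Longrightarrow> \<exists>g\<in>G. s < g x"
    and t: "t < (\<integral>x. h x \<partial>M)"
  shows "\<exists>gs. set gs \<subseteq> G \<and> t < (\<integral>x. list_max gs x \<partial>M)"
proof (cases "G = {}")
  case True
  then have "h = (\<lambda>x. 0)"
    using h(2) sup by (fastforce simp: order_le_less)
  then show ?thesis
    using t by (intro exI[of _ "[]"]) auto
next
  case False
  define g where "g = from_nat_into G"
  have gG: "range g = G"
    using False G(1) by (simp add: g_def)
  define l where "l n = map g [0..<n]" for n
  have l: "set (l n) \<subseteq> G" for n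
    using gG by (auto simp: l_def)
  have lh: "list_max (l n) x \<le> h x" for n x
    using l by (intro list_max_le h(2) le) auto
  have lim: "(\<lambda>n. list_max (l n) x) \<longlonglongrightarrow> h x" for x
  proof (rule order_tendstoI)
    fix a assume a: "a < h x"
    show "\<forall>\<^sub>F n in sequentially. a < list_max (l n) x"
    proof (cases "a < 0")
      case True
      then show ?thesis
        using list_max_nonneg[of "l n" x for n]
        by (intro always_eventually) (auto intro: less_le_trans)
    next
      case False
      then obtain i where i: "a < g i x"
        using sup[OF a] a gG by force
      show ?thesis
        using eventually_gt_at_top[of i]
      proof eventually_elim
        case (elim n)
        then have "g i \<in> set (l n)"
          by (auto simp: l_def)
        then show ?case
          using i list_max_ge[of "g i" "l n" x] by auto
      qed
    qed
  next
    fix a assume "h x < a"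
    then show "\<forall>\<^sub>F n in sequentially. list_max (l n) x < a"
      using lh by (intro always_eventually) (auto intro: le_less_trans)
  qed
  have "(\<lambda>n. \<integral>x. list_max (l n) x \<partial>M) \<longlonglongrightarrow> (\<integral>x. h x \<partial>M)"
  proof (rule integral_dominated_convergence)
    show "integrable M (\<lambda>x. b)" by simp
    show "list_max (l n) \<in> borel_measurable M" for n
      using G(2) l by (intro list_max_measurable) auto
    show "AE x in M. norm (list_max (l n) x) \<le> b" for n
      using lh[of n] h(3) list_max_nonneg[of "l n"] by (auto intro: order_trans)
  qed (use h lim in auto)
  then have "\<forall>\<^sub>F n in sequentially. t < (\<integral>x. list_max (l n) x \<partial>M)"
    using t by (rule order_tendstoD)
  then show ?thesis
    using l by (auto simp: eventually_sequentially)
qed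

text \<open>Rational heights and centres in a countable dense set leave a countable family that
  still reaches every nonnegative continuous function from below.\<close>

definition bump :: "'a::metric_space \<Rightarrow> real \<Rightarrow> nat \<Rightarrow> 'a \<Rightarrow> real" where
  "bump a q n x = max 0 (q - real n * dist x a)"

lemma continuous_on_bump: "continuous_on S (bump a q n)"
  unfolding bump_def by (intro continuous_intros)

lemma bounded_bump: "bounded (range (bump a q n))"
proof -
  have "\<bar>bump a q n x\<bar> \<le> \<bar>q\<bar>" for x
  proof -
    have "0 \<le> real n * dist x a" by simp
    then show ?thesis unfolding bump_def by linarith
  qed
  then show ?thesis by (auto simp: bounded_iff)
qed

lemma bump_approx:
  fixes h :: "'a::metric_space \<Rightarrow> real"
  assumes D: "\<And>U :: 'a set. open U \<Longrightarrow> U \<noteq> {} \<Longrightarrow> \<exists>d\<in>D. d \<in> U"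
    and h: "continuous_on UNIV h" "\<And>x. 0 \<le> h x" and s: "s < h x" "0 < h x"
  shows "\<exists>a\<in>D. \<exists>q\<in>\<rat>. \<exists>n. (\<forall>y. bump a q n y \<le> h y) \<and> s < bump a q n x"
proof -
  have "max 0 s < h x" using s by simp
  then obtain q where q: "q \<in> \<rat>" "max 0 s < q" "q < h x"
    using Rats_dense_in_real by blast
  have "open {y. q < h y}"
    using h(1) by (intro open_Collect_less) auto
  then obtain r where r: "0 < r" "\<And>y. dist y x < r \<Longrightarrow> q < h y"
    using q(3) unfolding open_dist by auto
  \<comment> \<open>This slope brings the cone of height \<open>q\<close> down to 0 within distance
    \<open>r / 2\<close> of its centre.\<close>
  obtain n :: nat where n: "2 * q / r < real n"
    using reals_Archimedean2 by blast
  have n0: "0 < real n"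
    using n q(2) r(1) by (smt (verit) divide_nonneg_pos)
  \<comment> \<open>The first entry keeps that support inside the ball of radius \<open>r\<close>
    around \<open>x\<close>, where \<open>q < h\<close>; the second makes the loss of height at
    \<open>x\<close> smaller than \<open>q - max 0 s\<close>.\<close>
  define \<delta> where "\<delta> = min (r / 2) ((q - max 0 s) / real n)"
  have "0 < \<delta>" using r n0 q by (auto simp: \<delta>_def)
  then obtain a where a: "a \<in> D" "dist a x < \<delta>"
    using D[of "ball x \<delta>"] by (auto simp: dist_commute)
  have "real n * dist x a < q - max 0 s"
    using a(2) n0 by (auto simp: \<delta>_def field_simps dist_commute)
  then have "s < bump a q n x"
    by (auto simp: bump_def)
  moreover have "bump a q n y \<le> h y" for y
  proof (cases "dist y x < r")
    case True
    have "0 \<le> real n * dist y a" by simp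
    then show ?thesis
      using r(2)[OF True] q(2) h(2)[of y] unfolding bump_def by linarith
  next
    case False
    have "dist y x \<le> dist y a + dist a x" by (rule dist_triangle)
    then have "r / 2 \<le> dist y a"
      using False a(2) by (auto simp: \<delta>_def)
    then have "real n * (r / 2) \<le> real n * dist y a"
      by (intro mult_left_mono) auto
    moreover have "q < real n * (r / 2)"
      using n r by (auto simp: field_simps)
    ultimately show ?thesis
      using h(2)[of y] by (auto simp: bump_def)
  qed
  ultimately show ?thesis
    using a(1) q(1) by blast
qed

lemma generate_topology_openI:
  assumes "\<And>x. x \<in> A \<Longrightarrow> \<exists>S. generate_topology \<S> S \<and> x \<in> S \<and> S \<subseteq> A"
  shows "generate_topology \<S> A"
proof -
  have "generate_topology \<S> (\<Union>{S. generate_topology \<S> S \<and> S \<subseteq> A})"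
    by (rule generate_topology.UN) auto
  moreover have "\<Union>{S. generate_topology \<S> S \<and> S \<subseteq> A} = A"
    using assms by blast
  ultimately show ?thesis by simp
qed

text \<open>Lower bounds on integrals suffice: a two-sided condition on \<open>f\<close> is one for
  \<open>f\<close> and one for \<open>- f\<close>, and a strict lower bound at \<mu> is already
  forced by a finite maximum of bumps below \<open>f + B\<close>. Such maxima with rational
  thresholds form the countable subbasis.\<close>

lemma borel_prob_topology_countably_generated:
  "\<exists>\<S> :: 'a::{metric_space, second_countable_topology} borel_prob set set.
     countable \<S> \<and> open = generate_topology \<S>"
proof -
  obtain D :: "'a set" where D: "countable D" "\<And>U :: 'a set. open U \<Longrightarrow> U \<noteq> {} \<Longrightarrow> \<exists>d\<in>D. d \<in> U"
    using countable_dense_setE by blast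
  define G where "G = (\<lambda>(a, q, n). bump a q n) ` (D \<times> (\<rat> \<times> UNIV))"
  have G: "countable G"
    unfolding G_def using D(1) countable_rat by (intro countable_image countable_SIGMA) auto
  have Gc: "continuous_on UNIV g" "bounded (range g)" if "g \<in> G" for g
    using that continuous_on_bump bounded_bump by (auto simp: G_def)
  define \<S> :: "'a borel_prob set set" where
    "\<S> = (\<lambda>(gs, r). {\<mu>. r < (\<integral>x. list_max gs x \<partial>to_measure \<mu>)}) ` (lists G \<times> \<rat>)"
  have S: "countable \<S>"
    unfolding \<S>_def using G countable_rat by (intro countable_image countable_SIGMA) auto
  have int: "integrable (to_measure \<mu>) f"
    if fc: "continuous_on UNIV f" "bounded (range f)" for f :: "'a \<Rightarrow> real" and \<mu>
  proof -
    interpret prob_space "to_measure \<mu>" by (rule prob_space_to_measure)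
    have "f \<in> borel_measurable (to_measure \<mu>)"
      using fc(1) by (simp add: borel_measurable_continuous_onI cong: measurable_cong_sets)
    moreover obtain B where "\<And>x. \<bar>f x\<bar> \<le> B"
      using fc(2) by (force simp: bounded_iff)
    ultimately show ?thesis
      by (intro integrable_const_bound[where B = B]) auto
  qed
  have lc: "continuous_on UNIV (list_max gs)" "bounded (range (list_max gs))" if "gs \<in> lists G" for gs
    using that Gc by (auto intro!: list_max_continuous list_max_bounded)
  have less: "generate_topology \<S> {\<mu>. t < (\<integral>x. f x \<partial>to_measure \<mu>)}"
    if f: "continuous_on UNIV f" "bounded (range f)" for f :: "'a \<Rightarrow> real" and t
  proof (rule generate_topology_openI)
    fix \<mu> :: "'a borel_prob" assume mu: "\<mu> \<in> {\<mu>. t < (\<integral>x. f x \<partial>to_measure \<mu>)}"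
    interpret \<mu>: prob_space "to_measure \<mu>" by (rule prob_space_to_measure)
    obtain B where B: "\<And>x. \<bar>f x\<bar> \<le> B"
      using f(2) by (force simp: bounded_iff)
    \<comment> \<open>The shift makes the test function nonnegative, as approximation by
      \<open>list_max\<close> requires; total mass 1 turns it into a shift of the integral by
      \<open>B\<close>.\<close>
    define h where "h x = f x + B" for x
    have h: "continuous_on UNIV h" "0 \<le> h x" "h x \<le> 2 * B" for x
      using f(1) B[of x] unfolding h_def by (auto intro!: continuous_intros simp: abs_le_iff)
    have inth: "(\<integral>x. h x \<partial>to_measure \<nu>) = (\<integral>x. f x \<partial>to_measure \<nu>) + B" for \<nu> :: "'a borel_prob"
    proof -
      interpret prob_space "to_measure \<nu>" by (rule prob_space_to_measure)
      show ?thesis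
        unfolding h_def using int[OF f] by (simp add: prob_space)
    qed
    define G' where "G' = {g \<in> G. \<forall>x. g x \<le> h x}"
    have "\<exists>gs. set gs \<subseteq> G' \<and> t + B < (\<integral>x. list_max gs x \<partial>to_measure \<mu>)"
    proof (rule \<mu>.integral_list_max_approx)
      show "countable G'" using G by (simp add: G'_def)
      show "g \<in> borel_measurable (to_measure \<mu>)" if "g \<in> G'" for g
        using that Gc(1)[of g]
        by (simp add: G'_def borel_measurable_continuous_onI cong: measurable_cong_sets)
      show "h \<in> borel_measurable (to_measure \<mu>)"
        using h(1) by (simp add: borel_measurable_continuous_onI cong: measurable_cong_sets)
      show "\<exists>g\<in>G'. s < g x" if s: "s < h x" "0 < h x" for x s
        using bump_approx[OF D(2) h(1,2) s] unfolding G'_def G_def by force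
      show "t + B < (\<integral>x. h x \<partial>to_measure \<mu>)"
        using mu inth by simp
    qed (use h in \<open>auto simp: G'_def\<close>)
    then obtain gs where gs: "set gs \<subseteq> G'" "t + B < (\<integral>x. list_max gs x \<partial>to_measure \<mu>)"
      by blast
    obtain r where r: "r \<in> \<rat>" "t + B < r" "r < (\<integral>x. list_max gs x \<partial>to_measure \<mu>)"
      using Rats_dense_in_real[OF gs(2)] by blast
    have gsl: "gs \<in> lists G"
      using gs(1) by (auto simp: G'_def)
    have "(\<integral>x. list_max gs x \<partial>to_measure \<nu>) \<le> (\<integral>x. h x \<partial>to_measure \<nu>)" for \<nu>
    proof (rule integral_mono)
      show "list_max gs x \<le> h x" for x
        using gs(1) h(2) by (intro list_max_le) (auto simp: G'_def)
      show "integrable (to_measure \<nu>) h"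
        unfolding h_def using int[OF f] prob_space_to_measure[of \<nu>]
        by (auto intro!: Bochner_Integration.integrable_add finite_measure.integrable_const
             prob_space.finite_measure)
    qed (use int lc[OF gsl] in auto)
    then have "r < (\<integral>x. list_max gs x \<partial>to_measure \<nu>) \<Longrightarrow> t < (\<integral>x. f x \<partial>to_measure \<nu>)" for \<nu>
      using inth[of \<nu>] r(2) by (smt (verit))
    then show "\<exists>S. generate_topology \<S> S \<and> \<mu> \<in> S \<and> S \<subseteq> {\<mu>. t < (\<integral>x. f x \<partial>to_measure \<mu>)}"
      using r gsl
      by (intro exI[of _ "{\<mu>. r < (\<integral>x. list_max gs x \<partial>to_measure \<mu>)}"])
         (auto simp: \<S>_def intro!: generate_topology.Basis)
  qed
  have gen: "generate_topology \<S> {\<mu>. (\<integral>x. f x \<partial>to_measure \<mu>) \<in> V}"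
    if f: "continuous_on UNIV f" "bounded (range f)" and V: "open V" for f :: "'a \<Rightarrow> real" and V
  proof (rule generate_topology_openI)
    fix \<mu> :: "'a borel_prob" assume "\<mu> \<in> {\<mu>. (\<integral>x. f x \<partial>to_measure \<mu>) \<in> V}"
    then obtain e where e: "0 < e" "\<And>y. \<bar>y - (\<integral>x. f x \<partial>to_measure \<mu>)\<bar> < e \<Longrightarrow> y \<in> V"
      using V by (auto simp: open_dist dist_real_def)
    let ?I = "\<integral>x. f x \<partial>to_measure \<mu>"
    let ?A = "{\<nu>. ?I - e < (\<integral>x. f x \<partial>to_measure \<nu>)}"
    let ?B = "{\<nu>. - ?I - e < (\<integral>x. - f x \<partial>to_measure \<nu>)}"
    have "generate_topology \<S> (?A \<inter> ?B)"
      using f by (intro generate_topology.Int less) (auto intro!: continuous_intros simp: bounded_iff)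
    moreover have "\<mu> \<in> ?A \<inter> ?B" using e(1) by simp
    moreover have "?A \<inter> ?B \<subseteq> {\<mu>. (\<integral>x. f x \<partial>to_measure \<mu>) \<in> V}"
      by (auto intro!: e(2))
    ultimately show "\<exists>S. generate_topology \<S> S \<and> \<mu> \<in> S \<and> S \<subseteq> {\<mu>. (\<integral>x. f x \<partial>to_measure \<mu>) \<in> V}"
      by blast
  qed
  have 1: "generate_topology \<S> A" if "open A" for A
    using that unfolding open_borel_prob_def
    by (induction rule: generate_topology.induct) (auto intro: generate_topology.intros gen)
  have 2: "open A" if "generate_topology \<S> A" for A
    using that
  proof induction
    case (Basis s)
    then obtain gs and r :: real where gs: "gs \<in> lists G" "s = {\<mu>. (\<integral>x. list_max gs x \<partial>to_measure \<mu>) \<in> {r<..}}"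
      by (auto simp: \<S>_def)
    show ?case
      unfolding open_borel_prob_def gs(2) using lc[OF gs(1)]
      by (intro generate_topology.Basis CollectI exI[of _ "list_max gs"] exI[of _ "{r<..}"])
         simp
  qed auto
  show ?thesis
    using S 1 2 by (intro exI[of _ \<S>]) auto
qed

text \<open>Second countability identifies the Borel sets of
  \<open>'a \<times> 'a borel_prob\<close> with the product sigma-algebra
  (\<open>borel_prod\<close>) and permits Lindelof arguments, without a metric on
  \<open>borel_prob\<close>.\<close>

instance borel_prob :: (polish_space) second_countable_topology
  by standard (rule borel_prob_topology_countably_generated)

section \<open>Measurability on spaces of probability measures\<close>

lemma measurable_borel_probI:
  fixes g :: "'z \<Rightarrow> 'a::polish_space borel_prob"
  assumes "\<And>f :: 'a \<Rightarrow> real. continuous_on UNIV f \<Longrightarrow> bounded (range f) \<Longrightarrow>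
      (\<lambda>\<omega>. \<integral>x. f x \<partial>to_measure (g \<omega>)) \<in> borel_measurable N"
  shows "g \<in> borel_measurable N"
proof (rule borel_measurableI)
  fix S :: "'a borel_prob set" assume "open S"
  then have "generate_topology
     {{\<mu>. (\<integral>x. f x \<partial>to_measure \<mu>) \<in> V} | (f :: 'a \<Rightarrow> real) (V :: real set).
        continuous_on UNIV f \<and> bounded (range f) \<and> open V} S"
    by (simp add: open_borel_prob_def)
  \<comment> \<open>Openness is carried through the induction because the union step needs it:
    Lindelof's theorem replaces an arbitrary union of open sets by a countable one.\<close>
  then have "g -` S \<inter> space N \<in> sets N \<and> open S"
  proof induction
    case (Int A B)
    have "g -` (A \<inter> B) \<inter> space N = (g -` A \<inter> space N) \<inter> (g -` B \<inter> space N)" by auto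
    with Int show ?case by (simp add: sets.Int open_Int)
  next
    case (UN K)
    then obtain K' where K': "K' \<subseteq> K" "countable K'" "\<Union>K' = \<Union>K"
      using Lindelof[of K] by metis
    have "g -` (\<Union>K') \<inter> space N = (\<Union>k\<in>K'. g -` k \<inter> space N)" by auto
    also have "\<dots> \<in> sets N"
      using K' UN by (intro sets.countable_UN') auto
    finally show ?case
      using K' UN by auto
  next
    case (Basis s)
    then obtain f :: "'a \<Rightarrow> real" and V where
      *: "s = {\<mu>. (\<integral>x. f x \<partial>to_measure \<mu>) \<in> V}" "continuous_on UNIV f" "bounded (range f)" "open V"
      by blast
    have "g -` s \<inter> space N = (\<lambda>\<omega>. \<integral>x. f x \<partial>to_measure (g \<omega>)) -` V \<inter> space N"
      by (auto simp: *)
    moreover have "\<dots> \<in> sets N"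
      using * assms by (intro measurable_sets_borel measurable_sets) auto
    ultimately show ?case
      using Basis by (auto simp: open_borel_prob_def intro!: generate_topology.Basis)
  qed auto
  then show "g -` S \<inter> space N \<in> sets N" ..
qed

lemma space_to_measure [simp]: "space (to_measure \<mu>) = UNIV"
  using sets_eq_imp_space_eq[OF sets_to_measure[of \<mu>]] by simp

lemma emeasure_to_measure_UNIV [simp]: "emeasure (to_measure \<mu>) UNIV = 1"
  using prob_space.emeasure_space_1[OF prob_space_to_measure[of \<mu>]] by simp

lemma measurable_to_measure_integral:
  fixes f :: "'a::topological_space \<Rightarrow> real"
  assumes "continuous_on UNIV f" "bounded (range f)"
  shows "(\<lambda>\<mu>. \<integral>x. f x \<partial>to_measure \<mu>) \<in> borel_measurable borel"
proof (rule borel_measurableI)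
  fix V :: "real set" assume "open V"
  then have "open ((\<lambda>\<mu>. \<integral>x. f x \<partial>to_measure \<mu>) -` V)"
    unfolding open_borel_prob_def using assms by (intro generate_topology.Basis) auto
  then show "(\<lambda>\<mu>. \<integral>x. f x \<partial>to_measure \<mu>) -` V \<inter> space borel \<in> sets borel"
    by simp
qed

text \<open>Closed sets are an intersection-stable generator, and the indicator of a closed set is a
  pointwise limit of bounded continuous functions, whose integrals are narrowly continuous by
  definition.\<close>

lemma measurable_to_measure [measurable]:
  "to_measure \<in> borel \<rightarrow>\<^sub>M prob_algebra (borel :: 'a::polish_space measure)"
proof (rule measurable_prob_algebra_generated)
  show "sets borel = sigma_sets UNIV (Collect (closed :: 'a set \<Rightarrow> bool))"
    by (simp add: borel_eq_closed)
  show "Int_stable (Collect (closed :: 'a set \<Rightarrow> bool))"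
    by (auto simp: Int_stable_def)
  show "prob_space (to_measure \<mu>)" for \<mu> :: "'a borel_prob"
    by (rule prob_space_to_measure)
  fix A :: "'a set" assume "A \<in> Collect closed"
  then have A: "closed A" by simp
  show "(\<lambda>\<mu>. emeasure (to_measure \<mu>) A) \<in> borel_measurable borel"
  \<comment> \<open>The distance \<open>infdist\<close> to the empty set is 0 by convention, so
    there the functions \<open>f n\<close> would not tend to the indicator.\<close>
  proof (cases "A = {}")
    case False
    define f where "f n x = (1 / (1 + infdist x A)) ^ n" for n :: nat and x
    have pos: "0 < 1 + infdist x A" for x
      using infdist_nonneg[of x A] by linarith
    have f: "continuous_on UNIV (f n)" "bounded (range (f n))" "\<And>x. 0 \<le> f n x" "\<And>x. f n x \<le> 1" for n
    proof -
      show "continuous_on UNIV (f n)"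
        unfolding f_def using pos by (intro continuous_intros) (auto simp: less_imp_neq[symmetric])
      show *: "0 \<le> f n x" "f n x \<le> 1" for x
        using pos[of x] infdist_nonneg[of x A] by (auto simp: f_def intro!: power_le_one)
      show "bounded (range (f n))"
        using * by (auto simp: bounded_iff intro!: exI[of _ 1])
    qed
    have lim: "(\<lambda>n. f n x) \<longlonglongrightarrow> indicator A x" for x
    proof (cases "x \<in> A")
      case True
      then show ?thesis by (simp add: f_def)
    next
      case F: False
      then have "0 < infdist x A"
        using A False infdist_pos_not_in_closed by blast
      then show ?thesis
        using F unfolding f_def by (auto intro!: LIMSEQ_realpow_zero)
    qed
    have "(\<lambda>\<mu>. measure (to_measure \<mu>) A) \<in> borel_measurable borel"
    proof (rule borel_measurable_LIMSEQ_metric)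
      show "(\<lambda>\<mu>. \<integral>x. f n x \<partial>to_measure \<mu>) \<in> borel_measurable borel" for n
        by (rule measurable_to_measure_integral) (use f in auto)
      fix \<mu> :: "'a borel_prob"
      interpret prob_space "to_measure \<mu>" by (rule prob_space_to_measure)
      have "(\<lambda>n. \<integral>x. f n x \<partial>to_measure \<mu>) \<longlonglongrightarrow> (\<integral>x. indicator A x \<partial>to_measure \<mu>)"
      proof (rule integral_dominated_convergence)
        show "f n \<in> borel_measurable (to_measure \<mu>)" for n
          using f(1) by (simp add: borel_measurable_continuous_onI cong: measurable_cong_sets)
        show "integrable (to_measure \<mu>) (\<lambda>x. 1 :: real)" by simp
        show "AE x in to_measure \<mu>. norm (f n x) \<le> 1" for n
          using f(3,4) by auto
        show "indicator A \<in> borel_measurable (to_measure \<mu>)"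
          using A by (auto intro!: borel_measurable_indicator)
      qed (use lim in auto)
      then show "(\<lambda>n. \<integral>x. f n x \<partial>to_measure \<mu>) \<longlonglongrightarrow> measure (to_measure \<mu>) A"
        by simp
    qed
    moreover have "emeasure (to_measure \<mu>) A = ennreal (measure (to_measure \<mu>) A)" for \<mu> :: "'a borel_prob"
      using finite_measure.emeasure_eq_measure prob_space.finite_measure prob_space_to_measure by blast
    ultimately show ?thesis by simp
  qed simp
qed auto

text \<open>With \<open>measurable_to_measure\<close>, this makes the Borel sets of the narrow
  topology agree with the sigma-algebra generated by evaluations: Borel maps into
  \<open>borel_prob\<close> and Markov kernels become interchangeable.\<close>

lemma measurable_borel_prob_kernelI:
  fixes g :: "'z \<Rightarrow> 'a::polish_space borel_prob"
  assumes "(\<lambda>\<omega>. to_measure (g \<omega>)) \<in> N \<rightarrow>\<^sub>M prob_algebra borel"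
  shows "g \<in> borel_measurable N"
proof (rule measurable_borel_probI)
  fix f :: "'a \<Rightarrow> real"
  assume "continuous_on UNIV f"
  then have [measurable]: "f \<in> borel_measurable borel"
    by (rule borel_measurable_continuous_onI)
  show "(\<lambda>\<omega>. \<integral>x. f x \<partial>to_measure (g \<omega>)) \<in> borel_measurable N"
    by (rule measurable_compose[OF measurable_prob_algebraD[OF assms] integral_measurable_subprob_algebra]) simp
qed

lemma to_measure_Abs: "prob_space M \<Longrightarrow> sets M = sets borel \<Longrightarrow> to_measure (Abs_borel_prob M) = M"
  by (simp add: Abs_borel_prob_inverse)

lemma measurable_Abs_borel_prob [measurable]:
  "Abs_borel_prob \<in> prob_algebra (borel :: 'a::polish_space measure) \<rightarrow>\<^sub>M borel"
proof (rule measurable_borel_prob_kernelI)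
  have "(\<lambda>M. M) \<in> prob_algebra borel \<rightarrow>\<^sub>M prob_algebra (borel :: 'a measure)" by simp
  then show "(\<lambda>M. to_measure (Abs_borel_prob M)) \<in> prob_algebra borel \<rightarrow>\<^sub>M prob_algebra (borel :: 'a measure)"
    by (rule measurable_cong[THEN iffD1, rotated]) (auto simp: space_prob_algebra to_measure_Abs)
qed

lemma borel_prob_eqI: "to_measure \<mu> = to_measure \<nu> \<Longrightarrow> \<mu> = \<nu>"
  by (simp add: to_measure_inject)

lemma measurable_fst_borel:
    "fst \<in> borel_measurable (borel :: ('a::topological_space \<times> 'b::topological_space) measure)"
  and measurable_snd_borel:
    "snd \<in> borel_measurable (borel :: ('a::topological_space \<times> 'b::topological_space) measure)"
  by (auto intro!: borel_measurable_continuous_onI continuous_intros)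

lemma measurable_push2 [measurable (raw)]:
  fixes f :: "'z \<Rightarrow> 'a::polish_space \<Rightarrow> 'b::polish_space"
  assumes g: "g \<in> borel_measurable N" and f: "(\<lambda>(\<omega>, x). f \<omega> x) \<in> N \<Otimes>\<^sub>M borel \<rightarrow>\<^sub>M borel"
  shows "(\<lambda>\<omega>. push (f \<omega>) (g \<omega>)) \<in> borel_measurable N"
  unfolding push_def
  by (rule measurable_compose[OF _ measurable_Abs_borel_prob],
      rule measurable_distr_prob_space2[where M=borel])
     (use f measurable_compose[OF g measurable_to_measure] in auto)

lemma push_push:
  assumes "f \<in> borel_measurable borel" "g \<in> borel_measurable borel"
  shows "push g (push f \<mu>) = push (\<lambda>x. g (f x)) \<mu>"
proof (rule borel_prob_eqI)
  have [measurable]: "f \<in> borel_measurable (to_measure \<mu>)"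
    using assms(1) by (simp cong: measurable_cong_sets)
  have "(\<lambda>x. g (f x)) \<in> borel_measurable borel"
    using assms by measurable
  then show "to_measure (push g (push f \<mu>)) = to_measure (push (\<lambda>x. g (f x)) \<mu>)"
    using assms by (simp add: to_measure_push distr_distr comp_def)
qed

lemma push_cong_AE:
  assumes "AE x in to_measure \<mu>. f x = g x" "f \<in> borel_measurable borel" "g \<in> borel_measurable borel"
  shows "push f \<mu> = push g \<mu>"
  using assms by (intro borel_prob_eqI) (simp add: to_measure_push distr_cong_AE cong: measurable_cong_sets)

lemma push_id [simp]: "push (\<lambda>x. x) \<mu> = \<mu>"
  by (rule borel_prob_eqI) (simp add: to_measure_push distr_id2)

section \<open>Measurable codes by real numbers\<close>

text \<open>Only a measurable left inverse \<open>r\<close> is asked for, which spares any statement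
  about the range of \<open>e\<close>. Values strictly inside the unit interval leave room to add an
  integer cell index that \<open>frac\<close> removes again.\<close>

definition std_borel :: "'a measure \<Rightarrow> bool" where
  "std_borel M \<longleftrightarrow> (\<exists>e r. e \<in> borel_measurable M \<and> r \<in> borel \<rightarrow>\<^sub>M M \<and>
     (\<forall>x\<in>space M. r (e x) = x \<and> 0 < e x \<and> e x < (1 :: real)))"

lemma std_borelI:
  fixes e :: "'a \<Rightarrow> real"
  assumes [measurable]: "e \<in> borel_measurable M" "r \<in> borel \<rightarrow>\<^sub>M M"
    and r: "\<And>x. x \<in> space M \<Longrightarrow> r (e x) = x"
  shows "std_borel M"
  unfolding std_borel_def
proof (intro exI conjI ballI)
  show "(\<lambda>x. arctan (e x) / pi + 1 / 2) \<in> borel_measurable M" by measurable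
  have "(\<lambda>t :: real. sin (pi * (t - 1 / 2)) / cos (pi * (t - 1 / 2))) \<in> borel_measurable borel"
    by measurable
  then show "(\<lambda>t. r (tan (pi * (t - 1 / 2)))) \<in> borel \<rightarrow>\<^sub>M M"
    by (auto simp: tan_def intro!: measurable_compose[OF _ assms(2)])
  fix x assume "x \<in> space M"
  have "pi * (arctan (e x) / pi + 1 / 2 - 1 / 2) = arctan (e x)" by simp
  then show "r (tan (pi * (arctan (e x) / pi + 1 / 2 - 1 / 2))) = x"
    using r[OF \<open>x \<in> space M\<close>] by (simp add: tan_arctan)
  show "0 < arctan (e x) / pi + 1 / 2" "arctan (e x) / pi + 1 / 2 < 1"
    using arctan_bounded[of "e x"] by (auto simp: field_simps)
qed

lemma std_borel_retract:
  assumes N: "std_borel N" and e: "e \<in> M \<rightarrow>\<^sub>M N" and r: "r \<in> N \<rightarrow>\<^sub>M M"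
    and re: "\<And>x. x \<in> space M \<Longrightarrow> r (e x) = x"
  shows "std_borel M"
proof -
  obtain e' r' where *: "e' \<in> borel_measurable N" "r' \<in> borel \<rightarrow>\<^sub>M N" "\<forall>x\<in>space N. r' (e' x :: real) = x"
    using N unfolding std_borel_def by blast
  show ?thesis
  proof (rule std_borelI)
    show "(\<lambda>x. e' (e x)) \<in> borel_measurable M" using * e by measurable
    show "(\<lambda>x. r (r' x)) \<in> borel \<rightarrow>\<^sub>M M" using * r by measurable
    show "r (r' (e' (e x))) = x" if "x \<in> space M" for x
      using * re[OF that] measurable_space[OF e that] by simp
  qed
qed

text \<open>Digits 0 and 1 in base 4 leave a tail of at most 1/3, so the floor is exact; in base 2 a
  tail of ones would carry. Earlier digits contribute a multiple of 4, hence parity reads off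
  \<open>B k\<close>.\<close>

lemma odd_floor_digit:
  fixes B :: "nat \<Rightarrow> bool"
  shows "odd \<lfloor>4 ^ Suc k * (\<Sum>j. of_bool (B j) / 4 ^ Suc j :: real)\<rfloor> \<longleftrightarrow> B k"
proof -
  let ?f = "\<lambda>j. of_bool (B j) / 4 ^ Suc j :: real"
  have geo: "(\<lambda>j. (1 / 4) * (1 / 4) ^ j :: real) sums ((1 / 4) * (1 / (1 - 1 / 4)))"
    by (intro sums_mult geometric_sums) simp
  have le: "of_bool (C j) / 4 ^ Suc j \<le> ((1 / 4) * (1 / 4) ^ j :: real)" for C :: "nat \<Rightarrow> bool" and j :: nat
    by (simp add: power_divide)
  have summ: "summable (\<lambda>j. of_bool (C j) / 4 ^ Suc j :: real)" for C :: "nat \<Rightarrow> bool"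
    by (rule summable_comparison_test'[OF sums_summable[OF geo], of 0]) (use le in \<open>auto\<close>)
  define t where "t = (\<Sum>j. of_bool (B (j + Suc k)) / 4 ^ Suc j :: real)"
  have t0: "0 \<le> t" unfolding t_def by (intro suminf_nonneg summ) auto
  have "t \<le> (1 / 4) * (1 / (1 - 1 / 4))"
    unfolding t_def sums_unique[OF geo] by (intro suminf_le summ sums_summable[OF geo] le)
  then have t1: "t < 1" by simp
  define N :: int where "N = (\<Sum>j<k. of_bool (B j) * 4 ^ (k - j - 1))"
  have "(\<Sum>j. ?f j) = (\<Sum>j. ?f (j + Suc k)) + (\<Sum>j<Suc k. ?f j)"
    using suminf_split_initial_segment[OF summ, of B "Suc k"] by simp
  moreover have "4 ^ Suc k * (\<Sum>j. ?f (j + Suc k)) = t"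
  proof -
    have "summable (\<lambda>j. ?f (j + Suc k))"
      using summ[of B] by (rule summable_ignore_initial_segment)
    then have "4 ^ Suc k * (\<Sum>j. ?f (j + Suc k)) = (\<Sum>j. 4 ^ Suc k * ?f (j + Suc k))"
      by (rule suminf_mult[symmetric])
    also have "\<dots> = t"
      unfolding t_def by (intro arg_cong[where f=suminf] ext) (simp add: power_add)
    finally show ?thesis .
  qed
  moreover have "4 ^ Suc k * (\<Sum>j<Suc k. ?f j) = real_of_int (4 * N + of_bool (B k))"
  proof -
    have "4 ^ Suc k * ?f j = real_of_int (4 * (of_bool (B j) * 4 ^ (k - j - 1)))" if "j < k" for j
    proof -
      have "k = (k - j - 1) + Suc j" using that by simp
      then have "(4 :: real) ^ k = 4 ^ (k - j - 1) * 4 ^ Suc j" by (metis power_add)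
      then show ?thesis by simp
    qed
    then have "(\<Sum>j<k. 4 ^ Suc k * ?f j) = real_of_int (4 * N)"
      unfolding N_def sum_distrib_left of_int_sum by (intro sum.cong) auto
    then show ?thesis by (simp add: distrib_left sum_distrib_left)
  qed
  ultimately have "4 ^ Suc k * (\<Sum>j. ?f j) = real_of_int (4 * N + of_bool (B k)) + t"
    by (simp only: distrib_left)
  then have "\<lfloor>4 ^ Suc k * (\<Sum>j. ?f j)\<rfloor> = 4 * N + of_bool (B k)"
    using t0 t1 by (intro floor_unique) linarith+
  then show ?thesis by simp
qed

section \<open>Codes of real sequences, points and measures\<close>

definition rat_enum :: "nat \<Rightarrow> real" where
  "rat_enum = from_nat_into \<rat>"

lemma range_rat_enum: "range rat_enum = \<rat>"
  unfolding rat_enum_def by (rule range_from_nat_into) (auto simp: countable_rat)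

lemma rat_enum_dense: "a < b \<Longrightarrow> \<exists>i. a < rat_enum i \<and> rat_enum i < b"
  using Rats_dense_in_real[of a b] range_rat_enum by (metis imageE)

text \<open>This decodes a real number from the answers to whether it lies below
  \<open>rat_enum j\<close>; the filler \<open>\<infinity>\<close> discards the indices answered
  with no.\<close>

lemma INF_rat_enum_greater:
  "(INF j. if v < rat_enum j then ereal (rat_enum j) else \<infinity>) = ereal v"
proof (rule antisym)
  show "ereal v \<le> (INF j. if v < rat_enum j then ereal (rat_enum j) else \<infinity>)"
    by (intro INF_greatest) auto
  show "(INF j. if v < rat_enum j then ereal (rat_enum j) else \<infinity>) \<le> ereal v"
  proof (rule ereal_le_epsilon2)
    fix e :: real assume "0 < e"
    then obtain j where "v < rat_enum j" "rat_enum j < v + e"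
      using rat_enum_dense[of v "v + e"] by auto
    then show "(INF j. if v < rat_enum j then ereal (rat_enum j) else \<infinity>) \<le> ereal v + ereal e"
      by (intro INF_lower2[of j]) auto
  qed
qed

text \<open>One digit for each pair \<open>(i, j)\<close> answers whether
  \<open>v i < rat_enum j\<close>; all answers together determine the sequence.\<close>

lemma std_borel_real_sequences: "std_borel (PiM UNIV (\<lambda>_ :: nat. borel :: real measure))"
proof (rule std_borelI)
  let ?B = "\<lambda>k v. v (fst (prod_decode k)) < rat_enum (snd (prod_decode k))"
  let ?e = "\<lambda>v. \<Sum>k. of_bool (?B k v) / 4 ^ Suc k :: real"
  let ?r = "\<lambda>t i. real_of_ereal (INF j. if odd \<lfloor>4 ^ Suc (prod_encode (i, j)) * t :: real\<rfloor>
     then ereal (rat_enum j) else \<infinity>)"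
  have [measurable]: "Measurable.pred (PiM UNIV (\<lambda>_. borel :: real measure)) (\<lambda>v. v i < c)" for i :: nat and c
    by measurable
  have "(\<lambda>v. of_bool (?B k v) :: real) \<in> borel_measurable (PiM UNIV (\<lambda>_. borel :: real measure))" for k
    unfolding of_bool_def by measurable
  then show "?e \<in> borel_measurable (PiM UNIV (\<lambda>_. borel :: real measure))"
    by (intro borel_measurable_suminf borel_measurable_divide) auto
  have [measurable]: "(\<lambda>t. if odd \<lfloor>4 ^ Suc k * t :: real\<rfloor> then ereal c else \<infinity>) \<in> borel_measurable borel" for k c
  proof (intro measurable_If)
    have "(\<lambda>t. \<lfloor>4 ^ Suc k * t :: real\<rfloor>) \<in> borel \<rightarrow>\<^sub>M count_space UNIV" by measurable
    then have "(\<lambda>t. odd \<lfloor>4 ^ Suc k * t :: real\<rfloor>) \<in> borel \<rightarrow>\<^sub>M count_space UNIV"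
      by (rule measurable_compose) simp
    then show "{x \<in> space borel. odd \<lfloor>4 ^ Suc k * x :: real\<rfloor>} \<in> sets borel"
      by (simp add: pred_def)
  qed auto
  show "?r \<in> borel \<rightarrow>\<^sub>M PiM UNIV (\<lambda>_. borel :: real measure)"
  proof (rule measurable_PiM_single')
    show "(\<lambda>t. ?r t i) \<in> borel_measurable borel" for i
      by measurable
  qed auto
  fix v :: "nat \<Rightarrow> real"
  show "?r (?e v) = v"
    by (simp only: odd_floor_digit prod_encode_inverse fst_conv snd_conv INF_rat_enum_greater
        real_of_ereal.simps)
qed

instance prod :: (polish_space, polish_space) polish_space ..

text \<open>A point is coded by its distances to a dense sequence and recovered as the limit of the
  first members of that sequence at distance below \<open>(1 / 2) ^ n\<close>.\<close>

lemma std_borel_polish: "std_borel (borel :: 'a::polish_space measure)"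
proof -
  obtain D :: "'a set" where D: "countable D" "\<And>U :: 'a set. open U \<Longrightarrow> U \<noteq> {} \<Longrightarrow> \<exists>d\<in>D. d \<in> U"
    using countable_dense_setE by blast
  have "D \<noteq> {}" using D(2)[of UNIV] by auto
  define a where "a = from_nat_into D"
  have a: "\<exists>k. dist x (a k) < e" if e: "0 < e" for x and e :: real
  proof -
    obtain d where "d \<in> D" "dist x d < e"
      using D(2)[of "ball x e"] e by auto
    then show ?thesis
      using from_nat_into_surj[OF D(1)] by (auto simp: a_def)
  qed
  define s where "s v n = a (LEAST k. v k < (1 / 2) ^ n)" for v :: "nat \<Rightarrow> real" and n
  \<comment> \<open>Sequences that are not distance codes may give a non-Cauchy \<open>s v\<close>;
    the constant \<open>a 0\<close> makes the decoder total.\<close>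
  define r where "r v = (if Cauchy (s v) then lim (s v) else a 0)" for v
  let ?P = "PiM UNIV (\<lambda>_ :: nat. borel :: real measure)"
  have [measurable]: "(\<lambda>v. s v n) \<in> borel_measurable ?P" for n
    unfolding s_def by measurable
  have e: "(\<lambda>x k. dist x (a k)) \<in> borel \<rightarrow>\<^sub>M ?P"
    by (rule measurable_PiM_single') (auto simp: space_PiM)
  have r: "r \<in> ?P \<rightarrow>\<^sub>M borel"
  proof (rule borel_measurable_LIMSEQ_metric)
    show "(\<lambda>v. if Cauchy (s v) then s v n else a 0) \<in> borel_measurable ?P" for n
      unfolding metric_Cauchy_iff2 by measurable
    show "(\<lambda>n. if Cauchy (s v) then s v n else a 0) \<longlonglongrightarrow> r v" for v
      unfolding r_def using Cauchy_convergent[of "s v"]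
      by (auto simp: convergent_LIMSEQ_iff)
  qed
  have re: "r (\<lambda>k. dist x (a k)) = x" for x
  proof -
    let ?v = "\<lambda>k. dist x (a k)"
    have s: "dist x (s ?v n) < (1 / 2) ^ n" for n
      unfolding s_def using a[of "(1 / 2) ^ n" x] by (rule LeastI_ex) simp
    have "s ?v \<longlonglongrightarrow> x"
    proof (rule metric_LIMSEQ_I)
      fix e :: real assume "0 < e"
      have "(\<lambda>n. (1 / 2) ^ n :: real) \<longlonglongrightarrow> 0" by (rule LIMSEQ_realpow_zero) auto
      then have "\<forall>\<^sub>F n in sequentially. (1 / 2) ^ n < e"
        using \<open>0 < e\<close> by (rule order_tendstoD)
      then obtain N where "\<And>n. n \<ge> N \<Longrightarrow> (1 / 2) ^ n < e" by (auto simp: eventually_sequentially)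
      then show "\<exists>N. \<forall>n\<ge>N. dist (s ?v n) x < e"
        using s by (intro exI[of _ N]) (auto simp: dist_commute intro: less_trans)
    qed
    then show "r ?v = x"
      unfolding r_def using LIMSEQ_imp_Cauchy limI by auto
  qed
  show ?thesis
    by (rule std_borel_retract[OF std_borel_real_sequences e r]) (rule re)
qed

section \<open>Quantile functions\<close>

definition unif :: "real measure" where
  "unif = uniform_measure lborel {0<..<1}"

lemma sets_unif [simp, measurable_cong]: "sets unif = sets borel"
  by (simp add: unif_def)

lemma space_unif [simp]: "space unif = UNIV"
  by (simp add: unif_def)

lemma prob_space_unif: "prob_space unif"
  unfolding unif_def by (rule prob_space_uniform_measure) auto

lemma emeasure_unif: "A \<in> sets borel \<Longrightarrow> emeasure unif A = emeasure lborel (A \<inter> {0<..<1})"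
  by (simp add: unif_def emeasure_uniform_measure Int_commute divide_ennreal_def)

lemma AE_unif: "AE u in unif. 0 < u \<and> u < 1"
  unfolding unif_def by (rule AE_uniform_measureI) auto

lemma measure_unif_Icc_le:
  assumes "a \<le> b"
  shows "measure unif {a..b} \<le> b - a"
proof -
  have "emeasure unif {a..b} \<le> emeasure lborel {a..b}"
    by (subst emeasure_unif) (auto intro!: emeasure_mono)
  then show ?thesis
    using assms by (simp add: measure_def enn2real_leI)
qed

text \<open>The generalised inverse of the distribution function. Outside the open unit interval the
  infimum may be over an empty or unbounded set; the default 0 is used on a null set of
  \<open>unif\<close>.\<close>

definition quantile :: "real measure \<Rightarrow> real \<Rightarrow> real" where
  "quantile m u = (if 0 < u \<and> u < 1 then Inf {x. u \<le> cdf m x} else 0)"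

text \<open>The infimum is attained because \<open>cdf\<close> is right-continuous. Sublevel sets of
  the quantile thus become conditions on one value of \<open>cdf\<close>, which depends measurably
  on the measure.\<close>

lemma quantile_le_iff:
  assumes "real_distribution m" "0 < u" "u < 1"
  shows "quantile m u \<le> x \<longleftrightarrow> u \<le> cdf m x"
proof -
  interpret cdf_distribution m using assms(1) by (simp add: cdf_distribution_def)
  have "quantile m u = I u"
    using assms(2,3) by (simp add: quantile_def)
  then show ?thesis
    using pseudoinverse[OF assms(2,3), of x] by presburger
qed

lemma real_distribution_prob_algebra:
  "m \<in> space (prob_algebra (borel :: real measure)) \<Longrightarrow> real_distribution m"
  unfolding real_distribution_def real_distribution_axioms_def space_prob_algebra by blast

lemma measurable_quantile [measurable (raw)]:
  assumes g: "g \<in> N \<rightarrow>\<^sub>M prob_algebra borel" and [measurable]: "f \<in> borel_measurable N"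
  shows "(\<lambda>\<omega>. quantile (g \<omega>) (f \<omega>)) \<in> borel_measurable N"
proof (rule borel_measurableI_le)
  fix a
  have [measurable]: "(\<lambda>\<omega>. cdf (g \<omega>) a) \<in> borel_measurable N"
    unfolding cdf_def by (rule measurable_compose[OF g]) measurable
  have "{\<omega> \<in> space N. quantile (g \<omega>) (f \<omega>) \<le> a} =
    {\<omega> \<in> space N. if 0 < f \<omega> \<and> f \<omega> < 1 then f \<omega> \<le> cdf (g \<omega>) a else 0 \<le> a}"
    using real_distribution_prob_algebra[OF measurable_space[OF g]] quantile_le_iff
    by (auto simp: quantile_def)
  also have "\<dots> \<in> sets N" by measurable
  finally show "{\<omega> \<in> space N. quantile (g \<omega>) (f \<omega>) \<le> a} \<in> sets N" .
qed

lemma measurable_quantile1: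
  assumes "real_distribution m"
  shows "quantile m \<in> borel_measurable borel"
proof -
  interpret real_distribution m by fact
  show ?thesis
    by (rule measurable_quantile) (auto simp: space_prob_algebra prob_space_axioms)
qed

lemma distr_quantile:
  assumes "real_distribution m"
  shows "distr unif borel (quantile m) = m"
proof -
  interpret cdf_distribution m using assms by (simp add: cdf_distribution_def)
  have [measurable]: "quantile m \<in> borel_measurable borel"
    using assms by (rule measurable_quantile1)
  have "distr unif borel (quantile m) = distr (restrict_space lborel {0<..<1::real}) borel I"
  proof (rule measure_eqI)
    fix A assume "A \<in> sets (distr unif borel (quantile m))"
    then have [measurable]: "A \<in> sets borel" by simp
    have "emeasure (distr unif borel (quantile m)) A = emeasure lborel (quantile m -` A \<inter> {0<..<1})"
      using measurable_sets_borel[of "quantile m" borel A] by (simp add: emeasure_distr emeasure_unif)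
    also have "quantile m -` A \<inter> {0<..<1} = I -` A \<inter> {0<..<1}"
      by (auto simp: quantile_def)
    also have "emeasure lborel \<dots> = emeasure (distr (restrict_space lborel {0<..<1::real}) borel I) A"
      by (simp add: emeasure_distr emeasure_restrict_space space_restrict_space)
    finally show "emeasure (distr unif borel (quantile m)) A =
       emeasure (distr (restrict_space lborel {0<..<1::real}) borel I) A" .
  qed simp
  then show ?thesis by (simp add: distr_I_eq_M)
qed

text \<open>Without atoms \<open>cdf m\<close> is continuous; a value above \<open>u\<close> at the
  quantile would persist a little to the left of it, against the minimality of the quantile.\<close>

lemma cdf_quantile:
  assumes m: "real_distribution m" "\<And>x. measure m {x} = 0" and u: "0 < u" "u < 1"
  shows "cdf m (quantile m u) = u"
proof (rule antisym)
  interpret real_distribution m by fact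
  show "u \<le> cdf m (quantile m u)"
    using quantile_le_iff[OF m(1) u] by blast
  show "cdf m (quantile m u) \<le> u"
  proof (rule ccontr)
    let ?q = "quantile m u"
    assume "\<not> cdf m ?q \<le> u"
    then have "u < cdf m ?q" by simp
    moreover have "(cdf m \<longlongrightarrow> cdf m ?q) (at_left ?q)"
      using m(2) isCont_cdf[of ?q] by (auto simp: isCont_def intro: filterlim_at_split[THEN iffD1, THEN conjunct1])
    ultimately have "\<forall>\<^sub>F x in at_left ?q. u < cdf m x"
      by (intro order_tendstoD)
    moreover have "\<forall>\<^sub>F x in at_left ?q. x < ?q"
      by (auto simp: eventually_at_filter)
    ultimately have "\<forall>\<^sub>F x in at_left ?q. False"
    proof eventually_elim
      case (elim x)
      then show ?case using quantile_le_iff[OF m(1) u, of x] by simp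
    qed
    then show False by simp
  qed
qed

lemma distr_cdf_unif:
  assumes m: "real_distribution m" "\<And>x. measure m {x} = 0"
  shows "distr m borel (cdf m) = unif"
proof -
  interpret cdf_distribution m using m(1) by (simp add: cdf_distribution_def)
  have [measurable]: "quantile m \<in> borel_measurable borel"
    using m(1) by (rule measurable_quantile1)
  have "distr m borel (cdf m) = distr (distr unif borel (quantile m)) borel (cdf m)"
    by (simp add: distr_quantile m(1))
  also have "\<dots> = distr unif borel (cdf m \<circ> quantile m)"
    by (rule distr_distr) auto
  also have "\<dots> = distr unif borel (\<lambda>u. u)"
    using AE_unif by (intro distr_cong_AE) (auto simp: cdf_quantile[OF m] comp_def)
  also have "\<dots> = unif" by (rule distr_id2) simp
  finally show ?thesis .
qed

text \<open>Where \<open>cdf m\<close> is flat the identity can fail. It holds at every point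
  \<open>quantile m u\<close> with \<open>0 < u < 1\<close>, and by \<open>distr_quantile\<close>
  these points carry all of \<open>m\<close>.\<close>

lemma AE_quantile_cdf:
  assumes m: "real_distribution m" "\<And>x. measure m {x} = 0"
  shows "AE t in m. quantile m (cdf m t) = t"
proof -
  interpret cdf_distribution m using m(1) by (simp add: cdf_distribution_def)
  have [measurable]: "quantile m \<in> borel_measurable borel"
    using m(1) by (rule measurable_quantile1)
  have "AE u in unif. quantile m (cdf m (quantile m u)) = quantile m u"
    using AE_unif by eventually_elim (simp add: cdf_quantile[OF m])
  then have "AE t in distr unif borel (quantile m). quantile m (cdf m t) = t"
    by (subst AE_distr_iff) auto
  then show ?thesis by (simp only: distr_quantile[OF m(1)])
qed

lemma real_distribution_distr:
  "prob_space m \<Longrightarrow> f \<in> borel_measurable m \<Longrightarrow> real_distribution (distr m borel f)"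
  by (simp add: real_distribution_def real_distribution_axioms_def prob_space.prob_space_distr)

text \<open>The code of a measure is the distribution function of its image under \<open>e\<close>,
  tabulated at the rationals. Any sequence, whether or not it arises this way, is decoded to the law
  of \<open>r (q v u)\<close> for uniform \<open>u\<close>, so the decoder always yields a
  probability measure.\<close>

lemma std_borel_borel_prob: "std_borel (borel :: 'a::polish_space borel_prob measure)"
proof -
  obtain e :: "'a \<Rightarrow> real" and r where
    [measurable]: "e \<in> borel_measurable borel" "r \<in> borel_measurable borel" and re: "\<And>x. r (e x) = x"
    using std_borel_polish[where 'a='a] unfolding std_borel_def by auto
  let ?P = "PiM UNIV (\<lambda>_ :: nat. borel :: real measure)"
  define F where "F \<mu> i = measure (to_measure \<mu>) {x. e x \<le> rat_enum i}" for \<mu> :: "'a borel_prob" and i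
  \<comment> \<open>A quantile computed from countably many values: the infimum of the rationals at
    which the tabulated distribution function reaches \<open>u\<close>.\<close>
  define q where "q v u = real_of_ereal (INF i. if u \<le> v i then ereal (rat_enum i) else \<infinity>)"
    for v :: "nat \<Rightarrow> real" and u
  have F: "F \<in> borel \<rightarrow>\<^sub>M ?P"
  proof (rule measurable_PiM_single')
    show "(\<lambda>\<mu>. F \<mu> i) \<in> borel_measurable borel" for i
      unfolding F_def by measurable
  qed auto
  have [measurable]: "(\<lambda>(v, u). q v u) \<in> ?P \<Otimes>\<^sub>M borel \<rightarrow>\<^sub>M borel"
    unfolding q_def by measurable
  let ?r = "\<lambda>v. Abs_borel_prob (distr unif borel (\<lambda>u. r (q v u)))"
  have R: "?r \<in> ?P \<rightarrow>\<^sub>M borel"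
    by (rule measurable_compose[OF _ measurable_Abs_borel_prob], rule measurable_distr_prob_space2[where M=borel])
       (auto simp: space_prob_algebra prob_space_unif)
  have "?r (F \<mu>) = \<mu>" for \<mu>
  proof -
    let ?m = "distr (to_measure \<mu>) borel e"
    have m: "real_distribution ?m"
      by (rule real_distribution_distr) (auto simp: prob_space_to_measure)
    have cdf: "cdf ?m (rat_enum i) = F \<mu> i" for i
      by (simp add: cdf_def F_def measure_distr vimage_def)
    have q: "q (F \<mu>) u = quantile ?m u" if u: "0 < u" "u < 1" for u
    proof -
      have "(INF i. if u \<le> F \<mu> i then ereal (rat_enum i) else \<infinity>) = ereal (quantile ?m u)"
      proof (rule antisym)
        show "ereal (quantile ?m u) \<le> (INF i. if u \<le> F \<mu> i then ereal (rat_enum i) else \<infinity>)"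
          by (intro INF_greatest) (auto simp: cdf[symmetric] quantile_le_iff[OF m u])
        show "(INF i. if u \<le> F \<mu> i then ereal (rat_enum i) else \<infinity>) \<le> ereal (quantile ?m u)"
        proof (rule ereal_le_epsilon2)
          fix \<epsilon> :: real assume "0 < \<epsilon>"
          then obtain j where j: "quantile ?m u < rat_enum j" "rat_enum j < quantile ?m u + \<epsilon>"
            using rat_enum_dense[of "quantile ?m u" "quantile ?m u + \<epsilon>"] by auto
          then have "u \<le> F \<mu> j"
            using quantile_le_iff[OF m u, of "rat_enum j"] cdf by simp
          then show "(INF i. if u \<le> F \<mu> i then ereal (rat_enum i) else \<infinity>) \<le> ereal (quantile ?m u) + ereal \<epsilon>"
            using j by (intro INF_lower2[of j]) auto
        qed
      qed
      then show ?thesis by (simp add: q_def)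
    qed
    have [measurable]: "quantile ?m \<in> borel_measurable borel"
      using m by (rule measurable_quantile1)
    have [measurable]: "q (F \<mu>) \<in> borel_measurable borel"
      unfolding q_def by measurable
    have "distr unif borel (\<lambda>u. r (q (F \<mu>) u)) = distr unif borel (\<lambda>u. r (quantile ?m u))"
      using AE_unif by (intro distr_cong_AE) (auto simp: q)
    also have "\<dots> = distr (distr unif borel (quantile ?m)) borel r"
      by (subst distr_distr) (auto simp: comp_def)
    also have "\<dots> = distr (to_measure \<mu>) borel (r \<circ> e)"
      unfolding distr_quantile[OF m] by (rule distr_distr) auto
    also have "\<dots> = to_measure \<mu>"
      by (simp add: comp_def re distr_id2)
    finally show ?thesis by (simp add: to_measure_inverse)
  qed
  then show ?thesis
    by (intro std_borel_retract[OF std_borel_real_sequences F R])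
qed

section \<open>Rank and sampling maps with cells\<close>

text \<open>Points are ordered first by cell, then by code: each cell occupies its own unit interval
  of the line.\<close>

definition lex_code :: "('a \<Rightarrow> nat) \<Rightarrow> ('a \<Rightarrow> real) \<Rightarrow> 'a \<Rightarrow> real" where
  "lex_code i e x = real (i x) + e x"

text \<open>The probability integral transform: the mass of all points whose code does not exceed
  that of \<open>x\<close>.\<close>

definition mrank :: "'a measure \<Rightarrow> ('a \<Rightarrow> real) \<Rightarrow> 'a \<Rightarrow> real" where
  "mrank m f x = cdf (distr m borel f) (f x)"

text \<open>Inverse transform sampling through the code. For \<open>f = lex_code i e\<close>,
  \<open>frac\<close> strips the cell index, so that \<open>r\<close> sees the plain code.\<close>

definition sampler :: "(real \<Rightarrow> 'a) \<Rightarrow> ('a \<Rightarrow> real) \<Rightarrow> 'a measure \<Rightarrow> real \<Rightarrow> 'a" where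
  "sampler r f m u = r (frac (quantile (distr m borel f) u))"

text \<open>Codes strictly inside unit intervals are never integers; so the distribution function of
  \<open>lex_code i e\<close> at an integer \<open>j\<close> is the mass of the cells before
  \<open>j\<close>.\<close>

lemma lex_le_iff:
  assumes "0 < e x" "e x < 1"
  shows "lex_code i e x \<le> real j \<longleftrightarrow> i x < j"
proof -
  have "i x < j \<longleftrightarrow> real (i x) + 1 \<le> real j" by linarith
  moreover have "i x < j \<or> real j \<le> real (i x)" by linarith
  ultimately show ?thesis using assms unfolding lex_code_def by linarith
qed

lemma frac_lex: "0 < e x \<Longrightarrow> e x < 1 \<Longrightarrow> frac (lex_code i e x) = e x"
  unfolding frac_unique_iff lex_code_def by simp

section \<open>Measurability and laws of ranks and samples\<close>

lemma measurable_lex [measurable (raw)]: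
  assumes [measurable]: "i \<in> M \<rightarrow>\<^sub>M count_space UNIV" "e \<in> borel_measurable M"
  shows "lex_code i e \<in> borel_measurable M"
  unfolding lex_code_def[abs_def] by measurable

lemma measurable_frac: "frac \<in> borel_measurable (borel :: real measure)"
  unfolding frac_def[abs_def] by measurable

lemma measurable_rank [measurable (raw)]:
  assumes g: "g \<in> N \<rightarrow>\<^sub>M prob_algebra M" and [measurable]: "f \<in> borel_measurable M" "h \<in> N \<rightarrow>\<^sub>M M"
  shows "(\<lambda>\<omega>. mrank (g \<omega>) f (h \<omega>)) \<in> borel_measurable N"
proof -
  have "mrank (g \<omega>) f (h \<omega>) = measure (g \<omega>) {x \<in> space M. f x \<le> f (h \<omega>)}" if "\<omega> \<in> space N" for \<omega>
  proof -
    have [measurable_cong]: "sets (g \<omega>) = sets M"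
      using measurable_space[OF g that] by (simp add: space_prob_algebra)
    then have "space (g \<omega>) = space M"
      by (rule sets_eq_imp_space_eq)
    then show ?thesis
      unfolding mrank_def cdf_def
      by (subst measure_distr) (auto intro!: arg_cong2[where f=measure])
  qed
  moreover have "(\<lambda>\<omega>. measure (g \<omega>) {x \<in> space M. f x \<le> f (h \<omega>)}) \<in> borel_measurable N"
  proof (rule measure_measurable_prob_algebra2[OF _ g])
    have "(SIGMA \<omega>:space N. {x \<in> space M. f x \<le> f (h \<omega>)}) = {z \<in> space (N \<Otimes>\<^sub>M M). f (snd z) \<le> f (h (fst z))}"
      by (auto simp: space_pair_measure)
    then show "(SIGMA \<omega>:space N. {x \<in> space M. f x \<le> f (h \<omega>)}) \<in> sets (N \<Otimes>\<^sub>M M)"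
      by simp
  qed
  ultimately show ?thesis by (simp cong: measurable_cong)
qed

lemma measurable_sampler [measurable (raw)]:
  assumes g: "g \<in> N \<rightarrow>\<^sub>M prob_algebra M" and [measurable]: "f \<in> borel_measurable M" "h \<in> borel_measurable N"
    "r \<in> borel \<rightarrow>\<^sub>M M"
  shows "(\<lambda>\<omega>. sampler r f (g \<omega>) (h \<omega>)) \<in> N \<rightarrow>\<^sub>M M"
proof -
  have [measurable]: "(\<lambda>\<omega>. distr (g \<omega>) borel f) \<in> N \<rightarrow>\<^sub>M prob_algebra borel"
    using g by measurable
  note measurable_frac[measurable]
  show ?thesis unfolding sampler_def by measurable
qed

lemma measurable_rank1:
  assumes "prob_space m" "f \<in> borel_measurable m"
  shows "mrank m f \<in> borel_measurable m"
proof -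
  have "(\<lambda>x. m) \<in> m \<rightarrow>\<^sub>M prob_algebra m"
    using assms(1) by (intro measurable_const) (auto simp: space_prob_algebra)
  from measurable_rank[OF this assms(2), of "\<lambda>x. x"] show ?thesis by simp
qed

lemma measurable_sampler1:
  assumes "prob_space m" "f \<in> borel_measurable m" "r \<in> borel \<rightarrow>\<^sub>M m"
  shows "sampler r f m \<in> borel \<rightarrow>\<^sub>M m"
proof -
  have "(\<lambda>x. m) \<in> borel \<rightarrow>\<^sub>M prob_algebra m"
    using assms(1) by (intro measurable_const) (auto simp: space_prob_algebra)
  from measurable_sampler[OF this assms(2), of "\<lambda>x. x"] assms(3) show ?thesis by simp
qed

lemma distr_rank:
  assumes m: "prob_space m" and [measurable]: "f \<in> borel_measurable m"
    and atomless: "\<And>t. measure m {x \<in> space m. f x = t} = 0"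
  shows "distr m borel (mrank m f) = unif"
proof -
  let ?m = "distr m borel f"
  have r: "real_distribution ?m" by (rule real_distribution_distr) (use m in auto)
  have "{x \<in> space m. f x = t} = f -` {t} \<inter> space m" for t by auto
  then have a: "measure ?m {t} = 0" for t
    using atomless[of t] by (simp add: measure_distr)
  interpret cdf_distribution ?m using r by (simp add: cdf_distribution_def)
  have "distr m borel (mrank m f) = distr ?m borel (cdf ?m)"
    by (subst distr_distr) (auto simp: comp_def mrank_def[abs_def])
  then show ?thesis using distr_cdf_unif[OF r a] by simp
qed

lemma distr_sampler:
  assumes m: "prob_space m" and [measurable]: "e \<in> borel_measurable m" "r \<in> borel \<rightarrow>\<^sub>M m"
    "i \<in> m \<rightarrow>\<^sub>M count_space UNIV"
    and re: "\<And>x. x \<in> space m \<Longrightarrow> r (e x) = x \<and> 0 < e x \<and> e x < 1"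
  shows "distr unif m (sampler r (lex_code i e) m) = m"
proof -
  let ?m = "distr m borel (lex_code i e)"
  have r: "real_distribution ?m" by (rule real_distribution_distr) (use m in auto)
  note measurable_frac[measurable]
  have [measurable]: "quantile ?m \<in> borel_measurable borel"
    using r by (rule measurable_quantile1)
  have "distr unif m (sampler r (lex_code i e) m) = distr (distr unif borel (quantile ?m)) m (\<lambda>t. r (frac t))"
    by (subst distr_distr) (auto simp: comp_def sampler_def[abs_def])
  also have "\<dots> = distr m m (\<lambda>x. r (frac (lex_code i e x)))"
    unfolding distr_quantile[OF r] by (subst distr_distr) (auto simp: comp_def)
  also have "\<dots> = distr m m (\<lambda>x. x)"
    using re by (intro distr_cong) (auto simp: frac_lex)
  finally show ?thesis by (simp add: distr_id2)
qed

text \<open>The uniform law is the only link between the two measures: nothing relates the code of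
  \<open>m\<close> to that of \<open>k\<close>, so the cells can be chosen freely for the sake of
  the cost.\<close>

lemma distr_sampler_rank:
  assumes m: "prob_space m" and [measurable]: "f \<in> borel_measurable m"
    and atomless: "\<And>t. measure m {x \<in> space m. f x = t} = 0"
    and k: "prob_space k" and [measurable]: "e \<in> borel_measurable k" "r \<in> borel \<rightarrow>\<^sub>M k"
    "i \<in> k \<rightarrow>\<^sub>M count_space UNIV"
    and re: "\<And>x. x \<in> space k \<Longrightarrow> r (e x) = x \<and> 0 < e x \<and> e x < 1"
  shows "distr m k (\<lambda>x. sampler r (lex_code i e) k (mrank m f x)) = k"
proof -
  have [measurable]: "mrank m f \<in> borel_measurable m" "sampler r (lex_code i e) k \<in> borel \<rightarrow>\<^sub>M k"
    using m k by (auto intro!: measurable_rank1 measurable_sampler1)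
  have "distr m k (\<lambda>x. sampler r (lex_code i e) k (mrank m f x)) = distr (distr m borel (mrank m f)) k (sampler r (lex_code i e) k)"
    by (subst distr_distr) (auto simp: comp_def)
  also have "\<dots> = k"
    unfolding distr_rank[OF m assms(2) atomless] using k re by (intro distr_sampler) auto
  finally show ?thesis .
qed

text \<open>
  The rank of \<open>x\<close> lies in the interval of the cell of \<open>x\<close>, the level at which \<open>sampler\<close> hits a
  cell lies in the interval of that cell; hence the two cells can only differ where the rank
  falls between the endpoints of corresponding intervals.
\<close>

lemma measure_cell_mismatch_le:
  assumes m: "prob_space m" and [measurable]: "e' \<in> borel_measurable m" "i \<in> m \<rightarrow>\<^sub>M count_space UNIV"
    and e': "\<And>x. x \<in> space m \<Longrightarrow> 0 < e' x \<and> e' x < 1"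
    and atomless: "\<And>t. measure m {x \<in> space m. lex_code i e' x = t} = 0"
    and k: "prob_space k" and [measurable]: "e \<in> borel_measurable k" "r \<in> borel \<rightarrow>\<^sub>M k"
    "j \<in> k \<rightarrow>\<^sub>M count_space UNIV"
    and re: "\<And>x. x \<in> space k \<Longrightarrow> r (e x) = x \<and> 0 < e x \<and> e x < 1"
    and K: "\<And>x. x \<in> space m \<Longrightarrow> i x < K" "\<And>x. x \<in> space k \<Longrightarrow> j x < K"
  shows "measure m {x \<in> space m. j (sampler r (lex_code j e) k (mrank m (lex_code i e') x)) \<noteq> i x} \<le>
    (\<Sum>l<K. \<bar>measure m {x \<in> space m. i x < l} - measure k {x \<in> space k. j x < l}\<bar>)"
proof -
  interpret m: prob_space m by fact
  interpret k: prob_space k by fact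
  let ?k = "distr k borel (lex_code j e)" and ?m = "distr m borel (lex_code i e')"
  let ?u = "mrank m (lex_code i e')" and ?s = "sampler r (lex_code j e) k"
  define P where "P l = measure m {x \<in> space m. i x < l}" for l
  define Q where "Q l = measure k {x \<in> space k. j x < l}" for l
  have dk: "real_distribution ?k" by (rule real_distribution_distr) (use k in auto)
  have dm: "real_distribution ?m" by (rule real_distribution_distr) (use m in auto)
  have [measurable]: "?u \<in> borel_measurable m" "?s \<in> borel \<rightarrow>\<^sub>M k"
    using m k by (auto intro!: measurable_rank1 measurable_sampler1)
  have [measurable]: "quantile ?k \<in> borel_measurable borel"
    using dk by (rule measurable_quantile1)
  note measurable_frac[measurable]
  have unif: "distr m borel ?u = unif" by (rule distr_rank) (use m atomless in auto)
  have Q: "cdf ?k (real l) = Q l" for l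
    unfolding cdf_def Q_def using re
    by (subst measure_distr) (auto intro!: arg_cong2[where f=measure] simp: lex_le_iff)
  have [measurable]: "lex_code j e \<in> borel_measurable k" by measurable
  \<comment> \<open>Decoding undoes \<open>lex_code j e\<close> only on codes of points. The chain
    transports this fact from \<open>k\<close> to its law on the line, then to \<open>unif\<close>,
    and finally to the ranks under \<open>m\<close>.\<close>
  have "AE x in k. lex_code j e (r (frac (lex_code j e x))) = lex_code j e x"
    using re by (auto simp: frac_lex)
  then have "AE t in ?k. lex_code j e (r (frac t)) = t"
    by (subst AE_distr_iff) auto
  then have "AE u in unif. lex_code j e (r (frac (quantile ?k u))) = quantile ?k u"
    by (subst (asm) distr_quantile[OF dk, symmetric], subst (asm) AE_distr_iff) auto
  then have "AE u in distr m borel ?u. lex_code j e (?s u) = quantile ?k u \<and> 0 < u \<and> u < 1"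
    unfolding unif sampler_def using AE_unif by eventually_elim auto
  then have "AE x in m. lex_code j e (?s (?u x)) = quantile ?k (?u x) \<and> 0 < ?u x \<and> ?u x < 1"
    by (subst (asm) AE_distr_iff) auto
  then have ae: "AE x in m. j (?s (?u x)) \<noteq> i x \<longrightarrow> ?u x \<in> (\<Union>l<K. {min (P l) (Q l)..max (P l) (Q l)})"
    using AE_space
  proof eventually_elim
    case (elim x)
    let ?z = "?s (?u x)"
    have z: "?z \<in> space k"
      using measurable_space[of ?s borel k "?u x"] by simp
    have "quantile ?k (?u x) \<le> real (Suc (j ?z))"
      using elim lex_le_iff[of e ?z j "Suc (j ?z)"] re[OF z] by simp
    then have uQ: "?u x \<le> Q (Suc (j ?z))"
      using elim by (subst (asm) quantile_le_iff[OF dk]) (auto simp: Q[symmetric])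
    have "\<not> quantile ?k (?u x) \<le> real (j ?z)"
      using elim lex_le_iff[of e ?z j "j ?z"] re[OF z] by simp
    then have Qu: "Q (j ?z) \<le> ?u x"
      using elim by (subst (asm) quantile_le_iff[OF dk]) (auto simp: Q[symmetric])
    have u: "?u x = measure m {y \<in> space m. lex_code i e' y \<le> lex_code i e' x}"
      unfolding mrank_def cdf_def by (subst measure_distr) (auto intro!: arg_cong2[where f=measure])
    have ii: "i y \<le> i x" if "lex_code i e' y \<le> lex_code i e' x" "y \<in> space m" for y
      using that e'[of x] e'[of y] elim unfolding lex_code_def by linarith
    have uP: "?u x \<le> P (Suc (i x))"
      unfolding u P_def by (intro m.finite_measure_mono) (auto dest: ii)
    have Pu: "P (i x) \<le> ?u x"
      unfolding u P_def
    proof (intro m.finite_measure_mono subsetI, safe)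
      fix y assume "y \<in> space m" "i y < i x"
      then have "real (i y) + 1 \<le> real (i x)" by linarith
      then show "lex_code i e' y \<le> lex_code i e' x"
        using e'[of x] e'[of y] elim \<open>y \<in> space m\<close> unfolding lex_code_def by linarith
    qed simp
    have monoP: "P a \<le> P b" if "a \<le> b" for a b
      unfolding P_def using that by (intro m.finite_measure_mono) auto
    have monoQ: "Q a \<le> Q b" if "a \<le> b" for a b
      unfolding Q_def using that by (intro k.finite_measure_mono) auto
    show ?case
    proof
      assume "j ?z \<noteq> i x"
      then consider "i x < j ?z" | "j ?z < i x" by linarith
      then show "?u x \<in> (\<Union>l<K. {min (P l) (Q l)..max (P l) (Q l)})"
      proof cases
        \<comment> \<open>At the threshold \<open>Suc (i x)\<close> the cell of \<open>x\<close> is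
          already counted by \<open>P\<close> and that of \<open>?z\<close> not yet by
          \<open>Q\<close>, so the rank lies between the two masses; \<open>j ?z < K\<close> keeps
          the threshold below \<open>K\<close>.\<close>
        case 1
        then have "Q (Suc (i x)) \<le> ?u x"
          using monoQ[of "Suc (i x)" "j ?z"] Qu by simp
        then show ?thesis
          using uP 1 K(2)[OF z] by (intro UN_I[of "Suc (i x)"]) auto
      next
        case 2
        then have "P (Suc (j ?z)) \<le> ?u x"
          using monoP[of "Suc (j ?z)" "i x"] Pu by simp
        then show ?thesis
          using uQ 2 K(1)[of x] elim by (intro UN_I[of "Suc (j ?z)"]) auto
      qed
    qed
  qed
  have [measurable]: "(\<lambda>x. ?s (?u x)) \<in> m \<rightarrow>\<^sub>M k" by measurable
  have "measure m {x \<in> space m. j (?s (?u x)) \<noteq> i x} \<le>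
      measure m {x \<in> space m. ?u x \<in> (\<Union>l<K. {min (P l) (Q l)..max (P l) (Q l)})}"
    using ae by (intro m.finite_measure_mono_AE) (auto elim!: eventually_mono)
  also have "\<dots> = measure unif (\<Union>l<K. {min (P l) (Q l)..max (P l) (Q l)})"
    unfolding unif[symmetric] by (subst measure_distr) (auto intro!: arg_cong2[where f=measure])
  also have "\<dots> \<le> (\<Sum>l<K. measure unif {min (P l) (Q l)..max (P l) (Q l)})"
    by (rule measure_UNION_le) auto
  also have "\<dots> \<le> (\<Sum>l<K. \<bar>P l - Q l\<bar>)"
  proof (rule sum_mono)
    fix l
    show "measure unif {min (P l) (Q l)..max (P l) (Q l)} \<le> \<bar>P l - Q l\<bar>"
      using measure_unif_Icc_le[of "min (P l) (Q l)" "max (P l) (Q l)"] by linarith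
  qed
  finally show ?thesis by (simp add: P_def Q_def)
qed

section \<open>Convergence of integrals from rectangles\<close>

text \<open>Intersections are needed because integrals of maxima of indicators are expanded by
  splitting along sets of the basis; \<open>UNIV\<close>, the empty intersection, is where that
  expansion starts.\<close>

lemma ex_countable_Int_basis:
  "\<exists>B :: 'a::second_countable_topology set set. countable B \<and> topological_basis B \<and> UNIV \<in> B \<and>
     (\<forall>U\<in>B. \<forall>V\<in>B. U \<inter> V \<in> B)"
proof -
  obtain B :: "'a set set" where B: "countable B" "topological_basis B"
    using ex_countable_basis by blast
  let ?C = "Inter ` {F. finite F \<and> F \<subseteq> B}"
  have "countable ?C"
    using B(1) by (intro countable_image countable_Collect_finite_subset)
  moreover have "topological_basis ?C"
    unfolding topological_basis_def
  proof (intro conjI ballI allI impI)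
    fix U assume "U \<in> ?C"
    then show "open U"
      using topological_basis_open[OF B(2)] by (auto intro!: open_Inter)
  next
    fix U :: "'a set" assume "open U"
    then obtain B' where "B' \<subseteq> B" "\<Union>B' = U"
      using B(2) unfolding topological_basis_def by blast
    moreover have "B \<subseteq> ?C"
      by (auto intro!: image_eqI[of _ _ "{b}" for b])
    ultimately show "\<exists>B'\<subseteq>?C. \<Union>B' = U" by blast
  qed
  moreover have "UNIV \<in> ?C"
    by (intro image_eqI[of _ _ "{}"]) auto
  moreover have "U \<inter> V \<in> ?C" if UV: "U \<in> ?C" "V \<in> ?C" for U V
  proof -
    from UV obtain F F' where "finite F" "F \<subseteq> B" "finite F'" "F' \<subseteq> B" "U = \<Inter>F" "V = \<Inter>F'"
      by auto
    then show ?thesis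
      by (intro image_eqI[of _ _ "F \<union> F'"]) auto
  qed
  ultimately show ?thesis by (intro exI[of _ ?C]) auto
qed

lemma integrable_simple_times_indicator:
  fixes f :: "'a \<Rightarrow> real" and \<phi> :: "real \<Rightarrow> real"
  assumes "finite_measure M" and f: "simple_function M f" and [measurable]: "A \<in> sets M"
  shows "integrable M (\<lambda>x. \<phi> (f x) * indicator A x)"
proof -
  interpret finite_measure M by fact
  have "simple_function M (\<lambda>x. \<phi> (f x))"
    using simple_function_compose[OF f, of \<phi>] by (simp add: comp_def)
  then have [measurable]: "(\<lambda>x. \<phi> (f x)) \<in> borel_measurable M"
    by (rule borel_measurable_simple_function)
  have fin: "finite ((\<lambda>x. \<bar>\<phi> (f x)\<bar>) ` space M)"
    using simple_functionD(1)[OF f] by (auto simp: image_image[symmetric, of "\<lambda>t. \<bar>\<phi> t\<bar>" f])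
  show ?thesis
  proof (rule integrable_const_bound)
    show "AE x in M. norm (\<phi> (f x) * indicator A x) \<le> Max ((\<lambda>x. \<bar>\<phi> (f x)\<bar>) ` space M)"
    proof (rule AE_I2)
      fix x assume "x \<in> space M"
      then have "\<bar>\<phi> (f x)\<bar> \<le> Max ((\<lambda>x. \<bar>\<phi> (f x)\<bar>) ` space M)"
        using fin by (intro Max_ge) auto
      then show "norm (\<phi> (f x) * indicator A x) \<le> Max ((\<lambda>x. \<bar>\<phi> (f x)\<bar>) ` space M)"
        by (auto simp: indicator_def)
    qed
  qed measurable
qed

text \<open>Induction over the list with \<open>\<phi>\<close> and \<open>A\<close> free: splitting
  \<open>A\<close> along the set \<open>A'\<close> of the first indicator moves the maximum into
  \<open>\<phi>\<close>. A finite list takes finitely many values, so \<open>\<phi>\<close> may be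
  any function.\<close>

lemma tendsto_integral_list_max_indicators:
  fixes L :: "nat \<Rightarrow> 'a measure" and \<phi> :: "real \<Rightarrow> real"
  assumes L: "\<And>n. finite_measure (L n)" "\<And>n. sets (L n) = sets M"
    and M: "finite_measure M" and \<B>: "\<B> \<subseteq> sets M" "\<And>U V. U \<in> \<B> \<Longrightarrow> V \<in> \<B> \<Longrightarrow> U \<inter> V \<in> \<B>"
    and conv: "\<And>A. A \<in> \<B> \<Longrightarrow> (\<lambda>n. measure (L n) A) \<longlonglongrightarrow> measure M A"
    and gs: "set gs \<subseteq> {\<lambda>x. q * indicator A x | q A. A \<in> \<B>}" and A: "A \<in> \<B>"
  shows "simple_function M (list_max gs) \<and>
    (\<lambda>n. \<integral>x. \<phi> (list_max gs x) * indicator A x \<partial>L n) \<longlonglongrightarrow> (\<integral>x. \<phi> (list_max gs x) * indicator A x \<partial>M)"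
  using gs A
proof (induction gs arbitrary: \<phi> A)
  case Nil
  then have "A \<in> sets M" using \<B> by auto
  moreover have "A \<inter> space (L n) = A \<inter> space M" for n
    using L(2)[of n] by (metis sets_eq_imp_space_eq)
  ultimately show ?case
    using conv[OF Nil(2)] L(2) sets.sets_into_space[of A M]
    by (auto simp: list_max.simps(1)[abs_def] Int_absorb2 intro!: tendsto_mult)
next
  case (Cons g gs)
  from Cons.prems obtain q A' where g: "g = (\<lambda>x. q * indicator A' x)" and A': "A' \<in> \<B>"
    by auto
  have sf: "simple_function M (list_max gs)"
    using Cons by auto
  have "simple_function M (\<lambda>x. max (q * indicator A' x) (list_max gs x))"
    using A' \<B> sf by (intro simple_function_max simple_function_mult simple_function_indicator simple_function_const) auto
  then have sf': "simple_function M (list_max (g # gs))"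
    by (simp add: g list_max.simps(2)[abs_def])
  have AA: "A' \<inter> A \<in> \<B>" "A' \<inter> A \<in> sets M" "A \<in> sets M"
    using A' Cons.prems \<B> by auto
  let ?\<phi>q = "\<lambda>t. \<phi> (max q t)" and ?\<phi>0 = "\<lambda>t. \<phi> (max 0 t)"
  \<comment> \<open>The part of \<open>A\<close> outside \<open>A'\<close> is expressed by
    subtracting the integral over \<open>A' \<inter> A\<close> from the one over \<open>A\<close>,
    since \<B> is closed under intersections only.\<close>
  have eq: "\<phi> (list_max (g # gs) x) * indicator A x =
    ?\<phi>q (list_max gs x) * indicator (A' \<inter> A) x + ?\<phi>0 (list_max gs x) * indicator A x -
    ?\<phi>0 (list_max gs x) * indicator (A' \<inter> A) x" for x
    by (auto simp: g indicator_def)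
  have int: "integrable N (\<lambda>x. \<psi> (list_max gs x) * indicator C x)"
    if N: "finite_measure N" "sets N = sets M" and C: "C \<in> sets M" for N C and \<psi> :: "real \<Rightarrow> real"
  proof (rule integrable_simple_times_indicator[where f = "list_max gs" and \<phi> = \<psi>])
    show "simple_function N (list_max gs)"
      using sf simple_function_cong_algebra[OF N(2) sets_eq_imp_space_eq[OF N(2)]] by blast
  qed (use that in auto)
  have "(\<integral>x. \<phi> (list_max (g # gs) x) * indicator A x \<partial>N) =
      (\<integral>x. ?\<phi>q (list_max gs x) * indicator (A' \<inter> A) x \<partial>N) + (\<integral>x. ?\<phi>0 (list_max gs x) * indicator A x \<partial>N) -
      (\<integral>x. ?\<phi>0 (list_max gs x) * indicator (A' \<inter> A) x \<partial>N)"
    if N: "finite_measure N" "sets N = sets M" for N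
    unfolding eq using int[OF N AA(2)] int[OF N AA(3)]
    by (subst Bochner_Integration.integral_diff)
       (auto intro!: Bochner_Integration.integral_add Bochner_Integration.integrable_add)
  note N = this[OF L] this[OF M refl]
  have "set gs \<subseteq> {\<lambda>x. q * indicator A x | q A. A \<in> \<B>}"
    using Cons.prems by auto
  note IH = Cons.IH[OF this, THEN conjunct2]
  show ?case
    unfolding N using sf' IH[OF AA(1)] IH[OF Cons.prems(2)]
    by (intro conjI tendsto_add tendsto_diff)
qed

text \<open>
  Upper semicontinuity on a basis only: \<open>b - c\<close> is a supremum of multiples of indicators of basic
  open sets.
\<close>

lemma eventually_integral_le:
  fixes L :: "nat \<Rightarrow> 'a::second_countable_topology measure" and c :: "'a \<Rightarrow> real"
  assumes L: "\<And>n. prob_space (L n)" "\<And>n. sets (L n) = sets borel"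
    and M: "prob_space M" "sets M = sets borel"
    and \<B>: "countable \<B>" "topological_basis \<B>" "UNIV \<in> \<B>" "\<And>U V. U \<in> \<B> \<Longrightarrow> V \<in> \<B> \<Longrightarrow> U \<inter> V \<in> \<B>"
    and conv: "\<And>A. A \<in> \<B> \<Longrightarrow> (\<lambda>n. measure (L n) A) \<longlonglongrightarrow> measure M A"
    and c: "continuous_on UNIV c" "\<And>x. 0 \<le> c x" "\<And>x. c x \<le> b" and \<epsilon>: "0 < \<epsilon>"
  shows "\<forall>\<^sub>F n in sequentially. (\<integral>x. c x \<partial>L n) \<le> (\<integral>x. c x \<partial>M) + \<epsilon>"
proof -
  interpret M: prob_space M by fact
  define h where "h x = b - c x" for x
  have c_meas: "c \<in> borel_measurable borel"
    using c(1) by (rule borel_measurable_continuous_onI)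
  have h: "continuous_on UNIV h" "\<And>x. 0 \<le> h x" "\<And>x. h x \<le> b"
    using c by (auto simp: h_def intro!: continuous_intros)
  have int: "integrable N c" "integrable N h" "(\<integral>x. h x \<partial>N) = b - (\<integral>x. c x \<partial>N)"
    if N: "prob_space N" "sets N = sets borel" for N
  proof -
    interpret N: prob_space N by fact
    have "c \<in> borel_measurable N"
      using c_meas N(2) by (simp cong: measurable_cong_sets)
    then show "integrable N c"
      using c by (intro N.integrable_const_bound[of _ b]) auto
    then show "integrable N h" "(\<integral>x. h x \<partial>N) = b - (\<integral>x. c x \<partial>N)"
      by (auto simp: h_def[abs_def] N.prob_space)
  qed
  define G where "G = {g. g \<in> (\<lambda>(q, A) x. q * indicator A x) ` (\<rat> \<times> \<B>) \<and> (\<forall>x. g x \<le> h x)}"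
  have Bs: "\<B> \<subseteq> sets M"
    using topological_basis_open[OF \<B>(2)] M(2) by auto
  have "\<exists>gs. set gs \<subseteq> G \<and> (\<integral>x. h x \<partial>M) - \<epsilon> < (\<integral>x. list_max gs x \<partial>M)"
  proof (rule M.integral_list_max_approx)
    have "countable ((\<lambda>(q, A) (x :: 'a). q * indicator A x :: real) ` (\<rat> \<times> \<B>))"
      using \<B>(1) countable_rat by (intro countable_image countable_SIGMA) auto
    then show "countable G"
      by (rule countable_subset[rotated]) (auto simp: G_def)
    show "g \<in> borel_measurable M" if "g \<in> G" for g
      using that Bs by (auto simp: G_def)
    show "h \<in> borel_measurable M"
      using h(1) M(2) by (simp add: borel_measurable_continuous_onI cong: measurable_cong_sets)
    show "\<exists>g\<in>G. s < g x" if s: "s < h x" "0 < h x" for x s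
    proof -
      obtain q where q: "q \<in> \<rat>" "max 0 s < q" "q < h x"
        using Rats_dense_in_real[of "max 0 s" "h x"] s by auto
      have "open {y. q < h y}"
        using h(1) by (intro open_Collect_less) auto
      then obtain A where A: "A \<in> \<B>" "x \<in> A" "A \<subseteq> {y. q < h y}"
        using topological_basisE[OF \<B>(2), of "{y. q < h y}" x] q by auto
      show ?thesis
        using q A h(2) by (intro bexI[of _ "\<lambda>x. q * indicator A x"])
          (auto simp: G_def indicator_def intro!: less_imp_le)
    qed
    show "g x \<le> h x" if "g \<in> G" for g x using that by (simp add: G_def)
    show "(\<integral>x. h x \<partial>M) - \<epsilon> < (\<integral>x. h x \<partial>M)" using \<epsilon> by simp
  qed (use h in auto)
  then obtain gs where gs: "set gs \<subseteq> G" "(\<integral>x. h x \<partial>M) - \<epsilon> < (\<integral>x. list_max gs x \<partial>M)"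
    by blast
  have "set gs \<subseteq> {\<lambda>x. q * indicator A x | q A. A \<in> \<B>}"
    using gs(1) unfolding G_def by fastforce
  then have *: "simple_function M (list_max gs) \<and>
    (\<lambda>n. \<integral>x. list_max gs x * indicator UNIV x \<partial>L n) \<longlonglongrightarrow> (\<integral>x. list_max gs x * indicator UNIV x \<partial>M)"
    using L M Bs \<B>(3,4) conv
    by (intro tendsto_integral_list_max_indicators[where \<phi> = "\<lambda>t. t" and \<B> = \<B>])
       (auto intro: prob_space.finite_measure)
  then have "\<forall>\<^sub>F n in sequentially. (\<integral>x. h x \<partial>M) - \<epsilon> < (\<integral>x. list_max gs x \<partial>L n)"
    using gs(2) by (intro order_tendstoD) auto
  then show ?thesis
  proof eventually_elim
    case (elim n)
    interpret Ln: prob_space "L n" by (rule L)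
    have hb: "list_max gs x \<le> h x" for x
      using gs(1) h(2) by (intro list_max_le) (auto simp: G_def)
    have "integrable (L n) (list_max gs)"
    proof (rule Bochner_Integration.integrable_bound[OF int(2)[OF L]])
      show "list_max gs \<in> borel_measurable (L n)"
        using *[THEN conjunct1, THEN borel_measurable_simple_function] L(2) M(2)
        by (simp cong: measurable_cong_sets)
      show "AE x in L n. norm (list_max gs x) \<le> norm (h x)"
        using hb list_max_nonneg[of gs] by (auto intro!: AE_I2 order_trans[OF _ abs_ge_self])
    qed
    then have "(\<integral>x. list_max gs x \<partial>L n) \<le> (\<integral>x. h x \<partial>L n)"
      using hb int(2)[OF L] by (intro integral_mono) auto
    then show ?case
      using elim int(3)[OF L, of n] int(3)[OF M] by simp
  qed
qed

lemma eventually_integral_le_prod: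
  fixes L :: "nat \<Rightarrow> ('a::second_countable_topology \<times> 'b::second_countable_topology) measure"
    and c :: "'a \<times> 'b \<Rightarrow> real"
  assumes L: "\<And>n. prob_space (L n)" "\<And>n. sets (L n) = sets borel"
    and M: "prob_space M" "sets M = sets borel"
    and \<A>: "countable \<A>" "topological_basis \<A>" "UNIV \<in> \<A>" "\<And>U V. U \<in> \<A> \<Longrightarrow> V \<in> \<A> \<Longrightarrow> U \<inter> V \<in> \<A>"
    and conv: "\<And>A B. A \<in> \<A> \<Longrightarrow> B \<in> sets borel \<Longrightarrow> (\<lambda>n. measure (L n) (A \<times> B)) \<longlonglongrightarrow> measure M (A \<times> B)"
    and c: "continuous_on UNIV c" "\<And>x. 0 \<le> c x" "\<And>x. c x \<le> b" and \<epsilon>: "0 < \<epsilon>"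
  shows "\<forall>\<^sub>F n in sequentially. (\<integral>x. c x \<partial>L n) \<le> (\<integral>x. c x \<partial>M) + \<epsilon>"
proof -
  obtain \<B> :: "'b set set" where \<B>: "countable \<B>" "topological_basis \<B>" "UNIV \<in> \<B>"
    "\<And>U V. U \<in> \<B> \<Longrightarrow> V \<in> \<B> \<Longrightarrow> U \<inter> V \<in> \<B>"
    using ex_countable_Int_basis by blast
  let ?C = "(\<lambda>(A, B). A \<times> B) ` (\<A> \<times> \<B>)"
  show ?thesis
  proof (rule eventually_integral_le[OF L M, where \<B> = ?C])
    show "countable ?C" using \<A>(1) \<B>(1) by (intro countable_image countable_SIGMA)
    show "topological_basis ?C" using \<A>(2) \<B>(2) by (rule topological_basis_prod)
    show "UNIV \<in> ?C" using \<A>(3) \<B>(3) by (auto intro!: image_eqI[of _ _ "(UNIV, UNIV)"])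
    show "U \<inter> V \<in> ?C" if UV: "U \<in> ?C" "V \<in> ?C" for U V
    proof -
      from UV obtain A B A' B' where "U = A \<times> B" "V = A' \<times> B'" "A \<in> \<A>" "A' \<in> \<A>" "B \<in> \<B>" "B' \<in> \<B>"
        by auto
      then show ?thesis
        using \<A>(4) \<B>(4) by (intro image_eqI[of _ _ "(A \<inter> A', B \<inter> B')"]) (auto simp: Times_Int_Times)
    qed
    show "(\<lambda>n. measure (L n) S) \<longlonglongrightarrow> measure M S" if "S \<in> ?C" for S
      using that conv topological_basis_open[OF \<B>(2)] by auto
  qed (use c \<epsilon> in auto)
qed

section \<open>Transport maps from random couplings\<close>

lemma sets_Collect_neq_nat:
  fixes f g :: "'a \<Rightarrow> nat"
  assumes "f \<in> M \<rightarrow>\<^sub>M count_space UNIV" "g \<in> M \<rightarrow>\<^sub>M count_space UNIV"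
  shows "{x \<in> space M. f x \<noteq> g x} \<in> sets M"
proof -
  have "(\<lambda>x. real (f x)) \<in> borel_measurable M" "(\<lambda>x. real (g x)) \<in> borel_measurable M"
    using assms by auto
  then have "{x \<in> space M. real (f x) \<noteq> real (g x)} \<in> sets M"
    by (rule borel_measurable_neq)
  then show ?thesis by simp
qed

lemma measurable_map_count_space:
  fixes f :: "'i \<Rightarrow> 'a \<Rightarrow> 'b::countable"
  assumes "\<And>i. f i \<in> M \<rightarrow>\<^sub>M count_space UNIV"
  shows "(\<lambda>x. map (\<lambda>i. f i x) is) \<in> M \<rightarrow>\<^sub>M count_space UNIV"
proof (induction "is")
  case (Cons i "is")
  have "(\<lambda>x. f i x # l) \<in> M \<rightarrow>\<^sub>M count_space UNIV" for l
    using measurable_compose[OF assms[of i], of "\<lambda>y. y # l" "count_space UNIV"] by simp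
  then have "(\<lambda>x. f i x # map (\<lambda>i. f i x) is) \<in> M \<rightarrow>\<^sub>M count_space UNIV"
    by (rule measurable_compose_countable[OF _ Cons])
  then show ?case by simp
qed simp

lemma abs_diff_le_of_floor_eq:
  fixes a b :: real
  assumes "0 \<le> a" "0 \<le> b" "nat \<lfloor>real N * a\<rfloor> = nat \<lfloor>real N * b\<rfloor>" "0 < N"
  shows "\<bar>a - b\<bar> \<le> 1 / real N"
proof -
  have "\<lfloor>real N * a\<rfloor> = \<lfloor>real N * b\<rfloor>"
    using assms by (metis eq_nat_nat_iff mult_nonneg_nonneg of_nat_0_le_iff zero_le_floor)
  then have "\<bar>real N * a - real N * b\<bar> \<le> 1" by linarith
  then have "real N * \<bar>a - b\<bar> \<le> 1"
    by (metis abs_mult abs_of_nat right_diff_distrib)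
  then show ?thesis using assms(4) by (simp add: field_simps)
qed

text \<open>\<open>to_measure M \<bind> K\<close> is the mean of the random measure
  \<open>K \<mu>\<close> when \<open>\<mu>\<close> has law \<open>M\<close>; for
  \<open>K = to_measure\<close> it is the barycentre of \<open>M\<close>.\<close>

lemma prob_space_bind_to_measure:
  fixes M :: "'z::topological_space borel_prob" and K :: "'z \<Rightarrow> 'a measure"
  assumes "K \<in> borel \<rightarrow>\<^sub>M prob_algebra N"
  shows "prob_space (to_measure M \<bind> K)" "sets (to_measure M \<bind> K) = sets N"
    "A \<in> sets N \<Longrightarrow> measure (to_measure M \<bind> K) A = (\<integral>\<mu>. measure (K \<mu>) A \<partial>to_measure M)"
    "f \<in> borel_measurable N \<Longrightarrow> (\<integral>\<^sup>+x. f x \<partial>(to_measure M \<bind> K)) = (\<integral>\<^sup>+\<mu>. (\<integral>\<^sup>+x. f x \<partial>K \<mu>) \<partial>to_measure M)"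
proof -
  interpret prob_space "to_measure M" by (rule prob_space_to_measure)
  have K: "K \<in> to_measure M \<rightarrow>\<^sub>M prob_algebra N"
    using assms by (simp cong: measurable_cong_sets)
  note K' = measurable_prob_algebraD[OF K]
  have M: "to_measure M \<in> space (prob_algebra borel)"
    by (simp add: space_prob_algebra prob_space_axioms)
  show "prob_space (to_measure M \<bind> K)"
    using M assms by (rule prob_space_bind')
  show "sets (to_measure M \<bind> K) = sets N"
    by (rule sets_bind[OF sets_kernel[OF K']]) auto
  show "A \<in> sets N \<Longrightarrow> measure (to_measure M \<bind> K) A = (\<integral>\<mu>. measure (K \<mu>) A \<partial>to_measure M)"
    using K' by (intro measure_bind) auto
  show "f \<in> borel_measurable N \<Longrightarrow> (\<integral>\<^sup>+x. f x \<partial>(to_measure M \<bind> K)) = (\<integral>\<^sup>+\<mu>. (\<integral>\<^sup>+x. f x \<partial>K \<mu>) \<partial>to_measure M)"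
    using K' by (intro nn_integral_bind) auto
qed

lemma nn_integral_push:
  assumes f: "f \<in> borel_measurable borel" and [measurable]: "g \<in> borel_measurable borel"
  shows "(\<integral>\<^sup>+x. g x \<partial>to_measure (push f \<mu>)) = (\<integral>\<^sup>+x. g (f x) \<partial>to_measure \<mu>)"
  unfolding to_measure_push[OF f] using f by (subst nn_integral_distr) auto

lemma measure_push:
  assumes f: "f \<in> borel_measurable borel" and A: "A \<in> sets borel"
  shows "measure (to_measure (push f \<mu>)) A = measure (to_measure \<mu>) (f -` A)"
  unfolding to_measure_push[OF f] using f A by (subst measure_distr) auto

lemma measurable_induced_map:
  fixes T :: "'a::polish_space \<times> 'a borel_prob \<Rightarrow> 'b::polish_space"
  assumes "T \<in> borel_measurable borel"
  shows "induced_map T \<in> borel_measurable borel"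
proof -
  have [measurable]: "T \<in> borel_measurable (borel \<Otimes>\<^sub>M borel)"
    using assms by (simp add: borel_prod)
  show ?thesis
    unfolding induced_map_def[abs_def] by (rule measurable_push2) measurable
qed

lemma measurable_section:
  fixes T :: "'a::second_countable_topology \<times> 'c::second_countable_topology \<Rightarrow> 'b::topological_space"
  assumes "T \<in> borel_measurable borel"
  shows "(\<lambda>x. T (x, y)) \<in> borel_measurable borel"
proof -
  have [measurable]: "T \<in> borel_measurable (borel \<Otimes>\<^sub>M borel)"
    using assms by (simp add: borel_prod)
  show ?thesis by measurable
qed

text \<open>Applying \<open>frac\<close> and then \<open>r\<close> recovers the point, so
  \<open>lex_code i e\<close> is injective and each of its level sets has at most one point.\<close>

lemma lex_code_atomless:
  assumes m: "\<And>x. emeasure (to_measure m) {x} = 0"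
    and re: "\<And>x. r (e x) = x \<and> 0 < e x \<and> e x < (1 :: real)"
  shows "measure (to_measure m) {x. lex_code i e x = t} = 0"
proof -
  have inj: "x = y" if "lex_code i e x = lex_code i e y" for x y
    using that re frac_lex by metis
  show ?thesis
  proof (cases "\<exists>x. lex_code i e x = t")
    case True
    then obtain x where "lex_code i e x = t" ..
    then have "{x. lex_code i e x = t} = {x}" using inj by auto
    then show ?thesis using m by (simp add: measure_def)
  qed auto
qed

text \<open>Since \<open>push h k = M1\<close>, the labels \<open>J \<mu>\<close> under
  \<open>M1\<close> and \<open>J (h \<pi>)\<close> under \<open>k\<close> have the same law. With
  these labels as cells all threshold masses agree and the mismatch bound is 0, so the labels match
  almost surely and not just approximately.\<close>

lemma ex_matching_map:
  fixes M1 :: "'a::polish_space borel_prob borel_prob" and k :: "'z::polish_space borel_prob borel_prob"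
  assumes M1: "atomless M1" and h: "h \<in> borel_measurable borel" "push h k = M1"
    and J: "J \<in> borel \<rightarrow>\<^sub>M count_space UNIV" "\<And>\<mu>. J \<mu> < (L :: nat)"
  shows "\<exists>S. S \<in> borel_measurable borel \<and> push S M1 = k \<and> (AE \<mu> in to_measure M1. J (h (S \<mu>)) = J \<mu>)"
proof -
  obtain e :: "'a borel_prob \<Rightarrow> real" and r where
    e[measurable]: "e \<in> borel_measurable borel" "r \<in> borel_measurable borel"
    and re: "\<And>x. r (e x) = x \<and> 0 < e x \<and> e x < 1"
    using std_borel_borel_prob[where 'a='a] unfolding std_borel_def by auto
  obtain e' :: "'z borel_prob \<Rightarrow> real" and r' where
    e'[measurable]: "e' \<in> borel_measurable borel" "r' \<in> borel_measurable borel"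
    and re': "\<And>x. r' (e' x) = x \<and> 0 < e' x \<and> e' x < 1"
    using std_borel_borel_prob[where 'a='z] unfolding std_borel_def by auto
  let ?m = "to_measure M1" and ?k = "to_measure k" and ?j = "\<lambda>\<pi>. J (h \<pi>)"
  note J(1)[measurable] h(1)[measurable]
  interpret m: prob_space ?m by (rule prob_space_to_measure)
  interpret k: prob_space ?k by (rule prob_space_to_measure)
  have atomless: "measure ?m {x \<in> space ?m. lex_code J e x = t} = 0" for t
    using lex_code_atomless[of M1 r e J t] M1 re by (simp add: atomless_def)
  define S where "S \<mu> = sampler r' (lex_code ?j e') ?k (mrank ?m (lex_code J e) \<mu>)" for \<mu>
  have S1: "distr ?m ?k S = ?k"
    unfolding S_def using re' atomless by (intro distr_sampler_rank) (auto intro: prob_space_to_measure)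
  have "mrank ?m (lex_code J e) \<in> borel_measurable ?m"
    by (rule measurable_rank1) (auto intro: prob_space_to_measure)
  moreover have "sampler r' (lex_code ?j e') ?k \<in> borel \<rightarrow>\<^sub>M ?k"
    by (rule measurable_sampler1) (auto intro: prob_space_to_measure)
  ultimately have S: "S \<in> borel_measurable borel"
    unfolding S_def by (simp cong: measurable_cong_sets)
  note S[measurable]
  have "distr ?m borel S = distr ?m ?k S" by (intro distr_cong) auto
  then have pushS: "push S M1 = k"
    using S1 by (intro borel_prob_eqI) (simp add: to_measure_push S)
  have eq: "measure ?m {\<mu>. J \<mu> < l} = measure ?k {\<pi>. ?j \<pi> < l}" for l
  proof -
    have "{\<mu>. J \<mu> < l} \<in> sets borel" by measurable
    then show ?thesis
      unfolding h(2)[symmetric] by (subst measure_push) (auto simp: h(1) vimage_def)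
  qed
  have "measure ?m {x \<in> space ?m. ?j (S x) \<noteq> J x} \<le>
    (\<Sum>l<L. \<bar>measure ?m {x \<in> space ?m. J x < l} - measure ?k {x \<in> space ?k. ?j x < l}\<bar>)"
    unfolding S_def using re re' atomless J(2)
    by (intro measure_cell_mismatch_le) (auto intro: prob_space_to_measure)
  also have "\<dots> = 0" by (simp add: eq)
  finally have "measure ?m {x \<in> space ?m. ?j (S x) \<noteq> J x} = 0"
    by (simp add: measure_le_0_iff)
  moreover have "{x. J (h (S x)) \<noteq> J x} \<in> sets borel"
    using sets_Collect_neq_nat[OF measurable_compose[OF measurable_compose[OF S h(1)] J(1)] J(1)]
    by simp
  ultimately have "AE \<mu> in ?m. ?j (S \<mu>) = J \<mu>"
    by (subst AE_iff_measurable[OF _ refl]) (auto simp: m.emeasure_eq_measure)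
  then show ?thesis using S pushS by blast
qed

lemma measurable_graph_kernel:
  fixes T :: "'a::polish_space \<times> 'a borel_prob \<Rightarrow> 'b::polish_space"
  assumes T: "T \<in> borel_measurable borel"
  shows "(\<lambda>\<mu>. distr (to_measure \<mu>) borel (\<lambda>x. (x, T (x, \<mu>)))) \<in> borel \<rightarrow>\<^sub>M prob_algebra (borel :: ('a \<times> 'b) measure)"
proof (rule measurable_distr_prob_space2[where M=borel])
  have [measurable]: "T \<in> borel_measurable (borel \<Otimes>\<^sub>M borel)"
    using T by (simp add: borel_prod)
  show "(\<lambda>(\<mu>, x). (x, T (x, \<mu>))) \<in> borel \<Otimes>\<^sub>M borel \<rightarrow>\<^sub>M borel"
    unfolding borel_prod[symmetric, where 'a='a and 'b='b] by measurable
qed simp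

lemma measurable_Pair_section:
  fixes T :: "'a::second_countable_topology \<times> 'c::second_countable_topology \<Rightarrow> 'b::second_countable_topology"
  assumes T: "T \<in> borel_measurable borel"
  shows "(\<lambda>x. (x, T (x, y))) \<in> borel_measurable borel"
  unfolding borel_prod[symmetric, where 'a='a and 'b='b] using measurable_section[OF T] by measurable

text \<open>The joint law of \<open>x\<close> and \<open>T (x, \<mu>)\<close> when
  \<open>\<mu>\<close> has law \<open>M\<close> and, given \<open>\<mu>\<close>, \<open>x\<close>
  has law \<open>\<mu>\<close>.\<close>

definition graph_law :: "('a::polish_space \<times> 'a borel_prob \<Rightarrow> 'b::polish_space) \<Rightarrow> 'a borel_prob borel_prob \<Rightarrow> ('a \<times> 'b) measure" where
  "graph_law T M = to_measure M \<bind> (\<lambda>\<mu>. distr (to_measure \<mu>) borel (\<lambda>x. (x, T (x, \<mu>))))"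

text \<open>The graph of \<open>T\<close> arises from \<open>z x \<mu>\<close>, which has law
  \<open>S \<mu>\<close>, by replacing the first coordinate with \<open>x\<close>. Membership in
  \<open>A i\<close> changes only where the cells of the two differ, and the second coordinate is
  kept; hence the bound is uniform in \<open>B\<close>.\<close>

lemma ex_transport_map_cells:
  fixes M1 :: "'a::polish_space borel_prob borel_prob" and k :: "('a \<times> 'b::polish_space) borel_prob borel_prob"
    and A :: "nat \<Rightarrow> 'a set"
  assumes M1: "atomless M1" "AE \<mu> in to_measure M1. atomless \<mu>" and k: "push (push fst) k = M1"
    and A: "\<And>i. A i \<in> sets borel" and \<eta>: "0 < \<eta>"
  shows "\<exists>T. T \<in> borel_measurable borel \<and> push (induced_map T) M1 = push (push snd) k \<and>
    (\<forall>i<n. \<forall>B\<in>sets borel. \<bar>measure (graph_law T M1) (A i \<times> B) - measure (to_measure k \<bind> to_measure) (A i \<times> B)\<bar> \<le> \<eta>)"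
proof -
  obtain e :: "'a \<Rightarrow> real" and r where
    e[measurable]: "e \<in> borel_measurable borel" "r \<in> borel_measurable borel"
    and re: "\<And>x. r (e x) = x \<and> 0 < e x \<and> e x < 1"
    using std_borel_polish[where 'a='a] unfolding std_borel_def by auto
  obtain e' :: "'a \<times> 'b \<Rightarrow> real" and r' where
    e'[measurable]: "e' \<in> borel_measurable borel" "r' \<in> borel_measurable borel"
    and re': "\<And>x. r' (e' x) = x \<and> 0 < e' x \<and> e' x < 1"
    using std_borel_polish[where 'a="'a \<times> 'b"] unfolding std_borel_def by auto
  note fst[measurable] = measurable_fst_borel[where 'a='a and 'b='b]
    and snd[measurable] = measurable_snd_borel[where 'a='a and 'b='b]
  \<comment> \<open>A cell is a membership pattern with respect to the first \<open>n\<close> sets,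
    numbered by \<open>to_nat\<close>; \<open>K\<close> exceeds all these numbers.\<close>
  define idx where "idx x = to_nat (map (\<lambda>i. x \<in> A i) [0..<n])" for x
  have idx[measurable]: "idx \<in> borel \<rightarrow>\<^sub>M count_space UNIV"
    unfolding idx_def using A
    by (intro measurable_compose[OF measurable_map_count_space, of _ _ to_nat]) auto
  define K where "K = Suc (Max (to_nat ` {l :: bool list. set l \<subseteq> UNIV \<and> length l = n}))"
  have K: "idx x < K" for x
    unfolding K_def idx_def less_Suc_eq_le
    by (intro Max_ge finite_imageI finite_lists_length_eq) auto
  have K0: "0 < K" by (simp add: K_def)
  have A_idx: "x \<in> A i \<longleftrightarrow> (from_nat (idx x) :: bool list) ! i" if "i < n" for x i
    using that by (simp add: idx_def)
  \<comment> \<open>The mismatch bound will be a sum of \<open>K\<close> terms of size at most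
    \<open>1 / N\<close>, which has to stay below \<open>\<eta>\<close>.\<close>
  obtain N :: nat where N: "real K / \<eta> < real N"
    using reals_Archimedean2 by blast
  have N0: "0 < N" using N K0 \<eta> by (smt (verit) divide_pos_pos of_nat_0_less_iff)
  have KN: "real K * (1 / real N) \<le> \<eta>"
    using N N0 \<eta> by (simp add: field_simps)
  \<comment> \<open>The label of a measure lists its cumulative cell masses, rounded down to
    multiples of \<open>1 / N\<close>. It takes finitely many values, so
    \<open>ex_matching_map\<close> can match it exactly.\<close>
  define J where "J \<mu> = to_nat (map (\<lambda>l. nat \<lfloor>real N * measure (to_measure \<mu>) {x. idx x < l}\<rfloor>) [0..<K])"
    for \<mu> :: "'a borel_prob"
  have J[measurable]: "J \<in> borel \<rightarrow>\<^sub>M count_space UNIV"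
    unfolding J_def
  proof (rule measurable_compose[OF measurable_map_count_space, of _ _ to_nat])
    fix l
    have [measurable]: "{x. idx x < l} \<in> sets borel" by measurable
    have "(\<lambda>\<mu> :: 'a borel_prob. \<lfloor>real N * measure (to_measure \<mu>) {x. idx x < l}\<rfloor>) \<in> borel \<rightarrow>\<^sub>M count_space UNIV"
      by measurable
    then show "(\<lambda>\<mu> :: 'a borel_prob. nat \<lfloor>real N * measure (to_measure \<mu>) {x. idx x < l}\<rfloor>) \<in> borel \<rightarrow>\<^sub>M count_space UNIV"
      by (rule measurable_compose) simp
  qed simp
  have J_bound: "J \<mu> < Suc (Max (to_nat ` {l. set l \<subseteq> {..N} \<and> length l = K}))" for \<mu>
    unfolding J_def less_Suc_eq_le
  proof (intro Max_ge finite_imageI finite_lists_length_eq imageI)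
    have "nat \<lfloor>real N * measure (to_measure \<mu>) {x. idx x < l}\<rfloor> \<le> N" for l
    proof -
      have "real N * measure (to_measure \<mu>) {x. idx x < l} \<le> real N * 1"
        by (intro mult_left_mono prob_space.prob_le_1 prob_space_to_measure) auto
      then have "\<lfloor>real N * measure (to_measure \<mu>) {x. idx x < l}\<rfloor> \<le> int N" by (simp add: floor_le_iff)
      then show ?thesis by simp
    qed
    then show "map (\<lambda>l. nat \<lfloor>real N * measure (to_measure \<mu>) {x. idx x < l}\<rfloor>) [0..<K] \<in> {l. set l \<subseteq> {..N} \<and> length l = K}"
      by auto
  qed simp
  have J_eq: "\<bar>measure (to_measure \<mu>) {x. idx x < l} - measure (to_measure \<nu>) {x. idx x < l}\<bar> \<le> 1 / real N"
    if "J \<mu> = J \<nu>" "l < K" for \<mu> \<nu> l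
  proof (rule abs_diff_le_of_floor_eq)
    from that(1) have "map (\<lambda>l. nat \<lfloor>real N * measure (to_measure \<mu>) {x. idx x < l}\<rfloor>) [0..<K] =
      map (\<lambda>l. nat \<lfloor>real N * measure (to_measure \<nu>) {x. idx x < l}\<rfloor>) [0..<K]"
      by (simp only: J_def inj_eq[OF inj_to_nat])
    then show "nat \<lfloor>real N * measure (to_measure \<mu>) {x. idx x < l}\<rfloor> = nat \<lfloor>real N * measure (to_measure \<nu>) {x. idx x < l}\<rfloor>"
      using that(2) by (auto simp: map_eq_conv)
  qed (use N0 in auto)
  have pfst: "push fst \<in> borel_measurable (borel :: ('a \<times> 'b) borel_prob measure)"
    and psnd: "push snd \<in> borel_measurable (borel :: ('a \<times> 'b) borel_prob measure)"
    by (auto intro!: measurable_push2 simp: borel_prod[symmetric])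
  obtain S where S[measurable]: "S \<in> borel_measurable borel" and pushS: "push S M1 = k"
    and SJ: "AE \<mu> in to_measure M1. J (push fst (S \<mu>)) = J \<mu>"
    using ex_matching_map[OF M1(1) pfst k J J_bound] by blast
  \<comment> \<open>The point \<open>x\<close> goes to the sample of \<open>S \<mu>\<close> at its
    rank under \<open>\<mu>\<close>; pairs are ordered by the cell of their first coordinate, so
    that the two cell orders correspond.\<close>
  define z where "z x \<mu> = sampler r' (lex_code (\<lambda>z. idx (fst z)) e') (to_measure (S \<mu>)) (mrank (to_measure \<mu>) (lex_code idx e) x)"
    for x \<mu>
  have z: "(\<lambda>p. z (fst p) (snd p)) \<in> borel_measurable (borel \<Otimes>\<^sub>M borel)"
    unfolding z_def by measurable
  define T where "T p = snd (z (fst p) (snd p))" for p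
  have T: "T \<in> borel_measurable borel"
    unfolding T_def using measurable_compose[OF z snd] by (simp add: borel_prod)
  have z1[measurable]: "(\<lambda>x. z x \<mu>) \<in> borel_measurable borel" for \<mu>
    using measurable_compose[OF _ z, of "\<lambda>x. (x, \<mu>)" borel] by simp
  have good: "push (\<lambda>x. z x \<mu>) \<mu> = S \<mu> \<and> measure (to_measure \<mu>) {x. idx (fst (z x \<mu>)) \<noteq> idx x} \<le> \<eta>"
    if \<mu>: "atomless \<mu>" "J (push fst (S \<mu>)) = J \<mu>" for \<mu>
  proof
    let ?m = "to_measure \<mu>" and ?k = "to_measure (S \<mu>)" and ?j = "\<lambda>z. idx (fst z)"
    have atomless: "measure ?m {x \<in> space ?m. lex_code idx e x = t} = 0" for t
      using lex_code_atomless[of \<mu> r e idx t] \<mu>(1) re by (simp add: atomless_def)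
    have "distr ?m ?k (\<lambda>x. z x \<mu>) = ?k"
      unfolding z_def using re' atomless by (intro distr_sampler_rank) (auto intro: prob_space_to_measure)
    moreover have "distr ?m borel (\<lambda>x. z x \<mu>) = distr ?m ?k (\<lambda>x. z x \<mu>)" by (intro distr_cong) auto
    ultimately show "push (\<lambda>x. z x \<mu>) \<mu> = S \<mu>"
      by (intro borel_prob_eqI) (simp add: to_measure_push)
    have eq: "measure ?k {x. idx (fst x) < l} = measure (to_measure (push fst (S \<mu>))) {x. idx x < l}" for l
    proof -
      have "{x. idx x < l} \<in> sets borel" by measurable
      then show ?thesis by (subst measure_push) (auto simp: vimage_def)
    qed
    have "measure ?m {x \<in> space ?m. ?j (z x \<mu>) \<noteq> idx x} \<le>
      (\<Sum>l<K. \<bar>measure ?m {x \<in> space ?m. idx x < l} - measure ?k {x \<in> space ?k. ?j x < l}\<bar>)"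
      unfolding z_def using re re' atomless K
      by (intro measure_cell_mismatch_le) (auto intro: prob_space_to_measure)
    also have "\<dots> \<le> (\<Sum>l<K. 1 / real N)"
      using J_eq[OF \<mu>(2)[symmetric]] by (intro sum_mono) (simp add: eq)
    also have "\<dots> \<le> \<eta>" using KN by simp
    finally show "measure ?m {x. ?j (z x \<mu>) \<noteq> idx x} \<le> \<eta>" by simp
  qed
  have ae: "AE \<mu> in to_measure M1. push (\<lambda>x. z x \<mu>) \<mu> = S \<mu> \<and> measure (to_measure \<mu>) {x. idx (fst (z x \<mu>)) \<noteq> idx x} \<le> \<eta>"
    using M1(2) SJ by eventually_elim (rule good)
  have ind: "induced_map T \<in> borel_measurable borel"
    using T by (rule measurable_induced_map)
  have "push (induced_map T) M1 = push (\<lambda>\<mu>. push snd (S \<mu>)) M1"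
  proof (rule push_cong_AE)
    show "AE \<mu> in to_measure M1. induced_map T \<mu> = push snd (S \<mu>)"
      using ae
    proof eventually_elim
      case (elim \<mu>)
      then have "push snd (S \<mu>) = push snd (push (\<lambda>x. z x \<mu>) \<mu>)" by simp
      also have "\<dots> = induced_map T \<mu>"
        unfolding induced_map_def T_def by (subst push_push) auto
      finally show ?case ..
    qed
    show "(\<lambda>\<mu>. push snd (S \<mu>)) \<in> borel_measurable borel"
      using S psnd by (rule measurable_compose)
  qed (rule ind)
  also have "\<dots> = push (push snd) k"
    unfolding pushS[symmetric] using push_push[OF S psnd, of M1] by simp
  finally have pushT: "push (induced_map T) M1 = push (push snd) k" .
  note ker = measurable_graph_kernel[OF T]
  have "\<bar>measure (graph_law T M1) (A i \<times> B) - measure (to_measure k \<bind> to_measure) (A i \<times> B)\<bar> \<le> \<eta>"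
    if i: "i < n" and B: "B \<in> sets borel" for i B
  proof -
    interpret m: prob_space "to_measure M1" by (rule prob_space_to_measure)
    have AB[measurable]: "A i \<times> B \<in> sets borel"
      using A B by (rule borel_Times)
    note A[measurable] B[measurable]
    let ?f = "\<lambda>\<mu>. measure (distr (to_measure \<mu>) borel (\<lambda>x. (x, T (x, \<mu>)))) (A i \<times> B)"
    let ?g = "\<lambda>\<mu>. measure (to_measure (S \<mu>)) (A i \<times> B)"
    have diff: "\<bar>?f \<mu> - ?g \<mu>\<bar> \<le> \<eta>"
      if "push (\<lambda>x. z x \<mu>) \<mu> = S \<mu> \<and> measure (to_measure \<mu>) {x. idx (fst (z x \<mu>)) \<noteq> idx x} \<le> \<eta>" for \<mu>
    proof -
      interpret mu: prob_space "to_measure \<mu>" by (rule prob_space_to_measure)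
      have g: "?g \<mu> = mu.prob {x. z x \<mu> \<in> A i \<times> B}"
        using that measure_push[OF z1 AB, of \<mu> \<mu>] by (simp add: vimage_def)
      have f: "?f \<mu> = mu.prob {x. x \<in> A i \<and> snd (z x \<mu>) \<in> B}"
        using measurable_Pair_section[OF T, of \<mu>]
        by (subst measure_distr) (auto simp: T_def vimage_def)
      have "fst (z x \<mu>) \<in> A i \<longleftrightarrow> x \<in> A i" if "idx (fst (z x \<mu>)) = idx x" for x
        by (simp only: A_idx[OF i] that)
      then have sub: "{x. z x \<mu> \<in> A i \<times> B} \<subseteq> {x. x \<in> A i \<and> snd (z x \<mu>) \<in> B} \<union> {x. idx (fst (z x \<mu>)) \<noteq> idx x}"
        "{x. x \<in> A i \<and> snd (z x \<mu>) \<in> B} \<subseteq> {x. z x \<mu> \<in> A i \<times> B} \<union> {x. idx (fst (z x \<mu>)) \<noteq> idx x}"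
        unfolding mem_Times_iff by blast+
      have [measurable]: "{x. z x \<mu> \<in> A i \<times> B} \<in> sets borel" "{x. x \<in> A i \<and> snd (z x \<mu>) \<in> B} \<in> sets borel"
        "{x. idx (fst (z x \<mu>)) \<noteq> idx x} \<in> sets borel"
      proof -
        show "{x. z x \<mu> \<in> A i \<times> B} \<in> sets borel"
          using measurable_sets[OF z1 AB, of \<mu>] by (simp add: vimage_def)
        have "(\<lambda>x. snd (z x \<mu>)) -` B \<inter> space borel \<in> sets borel"
          by (rule measurable_sets[OF measurable_compose[OF z1 snd] B])
        then have "A i \<inter> {x. snd (z x \<mu>) \<in> B} \<in> sets borel"
          using A[of i] by (simp add: vimage_def)
        then show "{x. x \<in> A i \<and> snd (z x \<mu>) \<in> B} \<in> sets borel"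
          by (simp add: Int_def)
        show "{x. idx (fst (z x \<mu>)) \<noteq> idx x} \<in> sets borel"
          using sets_Collect_neq_nat[OF measurable_compose[OF measurable_compose[OF z1 fst] idx] idx]
          by simp
      qed
      have "mu.prob {x. z x \<mu> \<in> A i \<times> B} \<le> mu.prob {x. x \<in> A i \<and> snd (z x \<mu>) \<in> B} + mu.prob {x. idx (fst (z x \<mu>)) \<noteq> idx x}"
        by (rule order_trans[OF mu.finite_measure_mono[OF sub(1)] measure_Un_le]) auto
      moreover have "mu.prob {x. x \<in> A i \<and> snd (z x \<mu>) \<in> B} \<le> mu.prob {x. z x \<mu> \<in> A i \<times> B} + mu.prob {x. idx (fst (z x \<mu>)) \<noteq> idx x}"
        by (rule order_trans[OF mu.finite_measure_mono[OF sub(2)] measure_Un_le]) auto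
      ultimately show ?thesis
        using that unfolding f g by linarith
    qed
    have fg: "AE \<mu> in to_measure M1. \<bar>?f \<mu> - ?g \<mu>\<bar> \<le> \<eta>"
      using ae by eventually_elim (rule diff)
    have "(\<lambda>\<mu>. ?f \<mu>) \<in> borel_measurable borel"
      by (rule measurable_compose[OF ker]) measurable
    then have fm: "?f \<in> borel_measurable (to_measure M1)"
      by (simp cong: measurable_cong_sets)
    have gm: "?g \<in> borel_measurable (to_measure M1)"
      by measurable
    have bd: "?f \<mu> \<le> 1" "?g \<mu> \<le> 1" for \<mu>
      using prob_space.prob_le_1[OF prob_space_to_measure]
        prob_space.prob_le_1[of "distr (to_measure \<mu>) borel (\<lambda>x. (x, T (x, \<mu>)))"]
        measurable_space[OF ker, of \<mu>] by (auto simp: space_prob_algebra)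
    have int: "integrable (to_measure M1) ?f" "integrable (to_measure M1) ?g"
      using fm gm bd by (auto intro!: m.integrable_const_bound[where B=1])
    have "measure (graph_law T M1) (A i \<times> B) = (\<integral>\<mu>. ?f \<mu> \<partial>to_measure M1)"
      unfolding graph_law_def using ker AB by (rule prob_space_bind_to_measure(3))
    moreover have "measure (to_measure k \<bind> to_measure) (A i \<times> B) = (\<integral>\<pi>. measure (to_measure \<pi>) (A i \<times> B) \<partial>to_measure k)"
      using measurable_to_measure AB by (rule prob_space_bind_to_measure(3))
    moreover have "\<dots> = (\<integral>\<mu>. ?g \<mu> \<partial>to_measure M1)"
      unfolding pushS[symmetric] to_measure_push[OF S] by (subst integral_distr) auto
    ultimately have "\<bar>measure (graph_law T M1) (A i \<times> B) - measure (to_measure k \<bind> to_measure) (A i \<times> B)\<bar>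
        = \<bar>\<integral>\<mu>. (?f \<mu> - ?g \<mu>) \<partial>to_measure M1\<bar>"
      using int by simp
    also have "\<dots> \<le> (\<integral>\<mu>. \<bar>?f \<mu> - ?g \<mu>\<bar> \<partial>to_measure M1)"
      by (rule integral_abs_bound)
    also have "\<dots> \<le> (\<integral>\<mu>. \<eta> \<partial>to_measure M1)"
      using int fg by (intro integral_mono_AE) auto
    also have "\<dots> = \<eta>" using m.prob_space by simp
    finally show ?thesis .
  qed
  then show ?thesis using T pushT by blast
qed

lemma nn_integral_eq_ennreal_integral:
  fixes c :: "'a \<Rightarrow> real"
  assumes "prob_space M" "c \<in> borel_measurable M" "\<And>x. 0 \<le> c x" "\<And>x. c x \<le> b"
  shows "(\<integral>\<^sup>+x. ennreal (c x) \<partial>M) = ennreal (\<integral>x. c x \<partial>M)"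
proof -
  interpret prob_space M by fact
  show ?thesis
    using assms by (intro nn_integral_eq_integral integrable_const_bound[of _ b]) auto
qed

text \<open>Stage \<open>n\<close> controls the first \<open>n\<close> basic open sets with error
  \<open>1 / (n + 1)\<close>, so the mass of each fixed rectangle converges; the one-sided integral
  bound then holds at some finite stage, and its map is taken.\<close>

lemma ex_transport_map:
  fixes M1 :: "'a::polish_space borel_prob borel_prob" and k :: "('a \<times> 'b::polish_space) borel_prob borel_prob"
    and c :: "'a \<times> 'b \<Rightarrow> real"
  assumes M1: "atomless M1" "AE \<mu> in to_measure M1. atomless \<mu>" and k: "push (push fst) k = M1"
    and c: "continuous_on UNIV c" "\<And>x. 0 \<le> c x" "\<And>x. c x \<le> b" and \<epsilon>: "0 < \<epsilon>"
  shows "\<exists>T. T \<in> borel_measurable borel \<and> push (induced_map T) M1 = push (push snd) k \<and>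
    (\<integral>\<^sup>+\<mu>. (\<integral>\<^sup>+x. ennreal (c (x, T (x, \<mu>))) \<partial>to_measure \<mu>) \<partial>to_measure M1) \<le>
    (\<integral>\<^sup>+\<pi>. (\<integral>\<^sup>+z. ennreal (c z) \<partial>to_measure \<pi>) \<partial>to_measure k) + ennreal \<epsilon>"
proof -
  obtain \<A> :: "'a set set" where \<A>: "countable \<A>" "topological_basis \<A>" "UNIV \<in> \<A>"
    "\<And>U V. U \<in> \<A> \<Longrightarrow> V \<in> \<A> \<Longrightarrow> U \<inter> V \<in> \<A>"
    using ex_countable_Int_basis by blast
  define A where "A = from_nat_into \<A>"
  have rA: "range A = \<A>"
    unfolding A_def using \<A>(1,3) by (intro range_from_nat_into) auto
  have A: "A i \<in> sets borel" for i
    using rA topological_basis_open[OF \<A>(2)] by (metis borel_open rangeI)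
  let ?M = "to_measure k \<bind> to_measure"
  have "\<exists>T. T \<in> borel_measurable borel \<and> push (induced_map T) M1 = push (push snd) k \<and>
    (\<forall>i<n. \<forall>B\<in>sets borel. \<bar>measure (graph_law T M1) (A i \<times> B) - measure ?M (A i \<times> B)\<bar> \<le> inverse (real (Suc n)))" for n
    by (rule ex_transport_map_cells[OF M1 k A]) simp
  then obtain T where T: "\<And>n. T n \<in> borel_measurable borel" "\<And>n. push (induced_map (T n)) M1 = push (push snd) k"
    and close: "\<And>n i B. i < n \<Longrightarrow> B \<in> sets borel \<Longrightarrow>
      \<bar>measure (graph_law (T n) M1) (A i \<times> B) - measure ?M (A i \<times> B)\<bar> \<le> inverse (real (Suc n))"
    by metis
  note ker = measurable_graph_kernel[OF T(1)]
  have L: "prob_space (graph_law (T n) M1)" "sets (graph_law (T n) M1) = sets borel" for n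
    unfolding graph_law_def using prob_space_bind_to_measure[OF ker] by auto
  have M: "prob_space ?M" "sets ?M = sets borel"
    using prob_space_bind_to_measure[OF measurable_to_measure] by auto
  have "\<forall>\<^sub>F n in sequentially. (\<integral>x. c x \<partial>graph_law (T n) M1) \<le> (\<integral>x. c x \<partial>?M) + \<epsilon>"
  proof (rule eventually_integral_le_prod[OF L M \<A> _ c \<epsilon>])
    fix U :: "'a set" and B :: "'b set" assume "U \<in> \<A>" and B: "B \<in> sets borel"
    then obtain i where U: "U = A i" using rA by auto
    show "(\<lambda>n. measure (graph_law (T n) M1) (U \<times> B)) \<longlonglongrightarrow> measure ?M (U \<times> B)"
    proof (rule LIM_zero_cancel, rule Lim_null_comparison[OF _ LIMSEQ_inverse_real_of_nat])
      show "\<forall>\<^sub>F n in sequentially. norm (measure (graph_law (T n) M1) (U \<times> B) - measure ?M (U \<times> B)) \<le> inverse (real (Suc n))"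
        using eventually_gt_at_top[of i]
        by eventually_elim (use close B in \<open>auto simp: U\<close>)
    qed
  qed
  then obtain n where n: "(\<integral>x. c x \<partial>graph_law (T n) M1) \<le> (\<integral>x. c x \<partial>?M) + \<epsilon>"
    by (auto simp: eventually_sequentially)
  have cm: "c \<in> borel_measurable borel"
    using c(1) by (rule borel_measurable_continuous_onI)
  have c_meas: "c \<in> borel_measurable N" if "sets N = sets borel" for N
    using cm that by (simp cong: measurable_cong_sets)
  have ecm: "(\<lambda>z. ennreal (c z)) \<in> borel_measurable borel" using cm by simp
  have "(\<integral>\<^sup>+\<mu>. (\<integral>\<^sup>+x. ennreal (c (x, T n (x, \<mu>))) \<partial>to_measure \<mu>) \<partial>to_measure M1) =
      (\<integral>\<^sup>+\<mu>. (\<integral>\<^sup>+z. ennreal (c z) \<partial>distr (to_measure \<mu>) borel (\<lambda>x. (x, T n (x, \<mu>)))) \<partial>to_measure M1)"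
    using measurable_Pair_section[OF T(1)] ecm
    by (intro nn_integral_cong) (subst nn_integral_distr, auto)
  also have "\<dots> = (\<integral>\<^sup>+z. ennreal (c z) \<partial>graph_law (T n) M1)"
    unfolding graph_law_def using prob_space_bind_to_measure(4)[OF ker ecm] by simp
  also have "\<dots> = ennreal (\<integral>z. c z \<partial>graph_law (T n) M1)"
    using L c c_meas by (intro nn_integral_eq_ennreal_integral) auto
  also have "\<dots> \<le> ennreal ((\<integral>x. c x \<partial>?M) + \<epsilon>)"
    using n by (rule ennreal_leI)
  also have "\<dots> = ennreal (\<integral>x. c x \<partial>?M) + ennreal \<epsilon>"
    using c(2) \<epsilon> by (intro ennreal_plus) auto
  also have "ennreal (\<integral>x. c x \<partial>?M) = (\<integral>\<^sup>+z. ennreal (c z) \<partial>?M)"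
    using M c c_meas by (intro nn_integral_eq_ennreal_integral[symmetric]) auto
  also have "\<dots> = (\<integral>\<^sup>+\<pi>. (\<integral>\<^sup>+z. ennreal (c z) \<partial>to_measure \<pi>) \<partial>to_measure k)"
    using prob_space_bind_to_measure(4)[OF measurable_to_measure ecm] by simp
  finally show ?thesis using T by blast
qed

section \<open>Copulas\<close>

text \<open>Convergence passes to complements by subtraction, and to disjoint unions as convergence
  of series. Limit and series may be exchanged because the fixed finite measure \<open>U\<close>
  dominates all terms.\<close>

lemma tendsto_measure_sigma_sets:
  fixes L :: "nat \<Rightarrow> 'a measure"
  assumes L: "\<And>n. finite_measure (L n)" "\<And>n. sets (L n) = sets N"
    and M: "finite_measure M" "sets M = sets N" and U: "finite_measure U" "sets U = sets N"
    and LU: "\<And>n A. A \<in> sets N \<Longrightarrow> measure (L n) A \<le> measure U A"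
    and G: "sets N = sigma_sets (space N) G" "Int_stable G" "G \<subseteq> Pow (space N)"
    and conv: "\<And>A. A \<in> G \<Longrightarrow> (\<lambda>n. measure (L n) A) \<longlonglongrightarrow> measure M A"
    and conv_space: "(\<lambda>n. measure (L n) (space N)) \<longlonglongrightarrow> measure M (space N)"
    and A: "A \<in> sets N"
  shows "(\<lambda>n. measure (L n) A) \<longlonglongrightarrow> measure M A"
proof -
  interpret L: finite_measure "L n" for n by (rule L)
  interpret M: finite_measure M by (rule M)
  interpret U: finite_measure U by (rule U)
  have sp: "space (L n) = space N" "space M = space N" for n
    using L(2) M(2) by (auto dest: sets_eq_imp_space_eq)
  from A have "A \<in> sigma_sets (space N) G" by (simp add: G)
  from G(2,3) this show ?thesis
  proof (induction rule: sigma_sets_induct_disjoint)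
    case (compl A)
    then have A: "A \<in> sets N" by (simp add: G)
    have "measure (L n) (space N - A) = measure (L n) (space N) - measure (L n) A" for n
      using L.finite_measure_compl[of A n] A L(2) sp by simp
    moreover have "measure M (space N - A) = measure M (space N) - measure M A"
      using M.finite_measure_compl[of A] A M(2) sp by simp
    ultimately show ?case
      using compl conv_space by (auto intro!: tendsto_diff)
  next
    case (union A)
    then have A: "range A \<subseteq> sets N" by (simp add: G)
    have L': "measure (L n) (\<Union>i. A i) = (\<Sum>i. measure (L n) (A i))" for n
      by (rule sums_unique, rule L.finite_measure_UNION) (use A union(1) L(2) in auto)
    have M': "measure M (\<Union>i. A i) = (\<Sum>i. measure M (A i))"
      by (rule sums_unique, rule M.finite_measure_UNION) (use A union(1) M(2) in auto)
    have s: "summable (\<lambda>i. measure U (A i))"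
      by (rule sums_summable, rule U.finite_measure_UNION) (use A union(1) U(2) in auto)
    have "(\<lambda>n. \<Sum>i. measure (L n) (A i)) \<longlonglongrightarrow> (\<Sum>i. measure M (A i))"
    proof (rule tannerys_theorem[THEN conjunct2, THEN conjunct2])
      show "\<forall>\<^sub>F (k, n) in sequentially \<times>\<^sub>F sequentially. norm (measure (L n) (A k)) \<le> measure U (A k)"
        using LU A by (intro always_eventually) auto
    qed (use union s in auto)
    then show ?case by (simp add: L' M')
  qed (use conv in auto)
qed

section \<open>Countable approximation of copulas\<close>

lemma ex_countable_dense_subset:
  fixes S :: "'a::second_countable_topology set"
  shows "\<exists>D. countable D \<and> D \<subseteq> S \<and> S \<subseteq> closure D"
proof -
  obtain B :: "'a set set" where B: "countable B" "topological_basis B"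
    using ex_countable_basis by blast
  define D where "D = (\<lambda>U. SOME x. x \<in> U \<inter> S) ` {U \<in> B. U \<inter> S \<noteq> {}}"
  have pick: "(SOME x. x \<in> U \<inter> S) \<in> U \<inter> S" if "U \<inter> S \<noteq> {}" for U
    using that by (metis all_not_in_conv someI_ex)
  have "countable D" using B(1) by (simp add: D_def)
  moreover have "D \<subseteq> S" unfolding D_def using pick by blast
  moreover have "S \<subseteq> closure D"
  proof
    fix x assume x: "x \<in> S"
    show "x \<in> closure D"
      unfolding closure_iff_nhds_not_empty
    proof safe
      fix A V assume V: "V \<subseteq> A" "open V" "x \<in> V" "D \<inter> A = {}"
      then obtain U where U: "U \<in> B" "x \<in> U" "U \<subseteq> V"
        using topological_basisE[OF B(2)] by metis
      then have "U \<inter> S \<noteq> {}" using x by blast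
      then have "(SOME x. x \<in> U \<inter> S) \<in> D"
        unfolding D_def using U(1) by blast
      moreover have "(SOME x. x \<in> U \<inter> S) \<in> A"
        using pick[OF \<open>U \<inter> S \<noteq> {}\<close>] U(3) V(1) by blast
      ultimately show False using V(4) by blast
    qed
  qed
  ultimately show ?thesis by blast
qed

definition copulas :: "(real \<times> real) measure set" where
  "copulas = {\<gamma>. sets \<gamma> = sets borel \<and> prob_space \<gamma> \<and> distr \<gamma> borel fst = unif \<and> distr \<gamma> borel snd = unif}"

lemma measure_copula:
  assumes "\<gamma> \<in> copulas" and [measurable]: "S \<in> sets borel"
  shows "measure \<gamma> (S \<times> UNIV) = measure unif S" "measure \<gamma> (UNIV \<times> S) = measure unif S"
proof -
  have s[measurable_cong]: "sets \<gamma> = sets borel" and d: "distr \<gamma> borel fst = unif" "distr \<gamma> borel snd = unif"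
    using assms(1) by (auto simp: copulas_def)
  have sp: "space \<gamma> = UNIV" using sets_eq_imp_space_eq[OF s] by simp
  have [measurable]: "fst \<in> borel_measurable \<gamma>" "snd \<in> borel_measurable \<gamma>"
    using s by (auto simp: borel_prod[symmetric] cong: measurable_cong_sets)
  show "measure \<gamma> (S \<times> UNIV) = measure unif S"
    unfolding d(1)[symmetric] by (subst measure_distr) (auto simp: sp intro!: arg_cong2[where f=measure])
  show "measure \<gamma> (UNIV \<times> S) = measure unif S"
    unfolding d(2)[symmetric] by (subst measure_distr) (auto simp: sp intro!: arg_cong2[where f=measure])
qed

text \<open>The common uniform marginals dominate: \<open>measure \<delta> (S \<times> T)\<close> is
  at most \<open>measure unif S\<close> and at most \<open>measure unif T\<close> for every copula
  \<open>\<delta>\<close>. This permits the extension from basic to Borel sets in one coordinate at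
  a time.\<close>

lemma copula_rectangle_convergence:
  assumes g: "\<And>n. g n \<in> copulas" and \<gamma>: "\<gamma> \<in> copulas"
    and \<U>: "UNIV \<in> \<U>" "\<And>U V. U \<in> \<U> \<Longrightarrow> V \<in> \<U> \<Longrightarrow> U \<inter> V \<in> \<U>" "sets borel = sigma_sets UNIV \<U>"
    and conv: "\<And>S T. S \<in> \<U> \<Longrightarrow> T \<in> \<U> \<Longrightarrow> (\<lambda>n. measure (g n) (S \<times> T)) \<longlonglongrightarrow> measure \<gamma> (S \<times> T)"
    and S: "S \<in> sets borel" and T: "T \<in> sets borel"
  shows "(\<lambda>n. measure (g n) (S \<times> T)) \<longlonglongrightarrow> measure \<gamma> (S \<times> T)"
proof -
  have \<U>b: "A \<in> sets borel" if "A \<in> \<U>" for A using \<U>(3) that by auto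
  have \<U>i: "Int_stable \<U>" using \<U>(2) by (auto simp: Int_stable_def)
  have c: "sets \<delta> = sets borel" "prob_space \<delta>" "space \<delta> = UNIV"
     "fst \<in> borel_measurable \<delta>" "snd \<in> borel_measurable \<delta>" if "\<delta> \<in> copulas" for \<delta>
  proof -
    show s: "sets \<delta> = sets borel" "prob_space \<delta>" using that by (auto simp: copulas_def)
    show "space \<delta> = UNIV" using sets_eq_imp_space_eq[OF s(1)] by simp
    show "fst \<in> borel_measurable \<delta>" "snd \<in> borel_measurable \<delta>"
      using s by (auto simp: borel_prod[symmetric] cong: measurable_cong_sets)
  qed
  \<comment> \<open>The mass of \<open>S \<times> T\<close> as a measure in \<open>S\<close> for
    fixed \<open>T\<close>; \<open>G\<close> is the same in \<open>T\<close> for fixed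
    \<open>S\<close>.\<close>
  define F where "F \<delta> T = distr (density \<delta> (indicator (UNIV \<times> T))) borel fst" for \<delta> :: "(real \<times> real) measure" and T :: "real set"
  define G where "G \<delta> S = distr (density \<delta> (indicator (S \<times> UNIV))) borel snd" for \<delta> :: "(real \<times> real) measure" and S :: "real set"
  have em: "emeasure (F \<delta> T) S = emeasure \<delta> (S \<times> T)" "emeasure (G \<delta> S) T = emeasure \<delta> (S \<times> T)"
    if \<delta>: "\<delta> \<in> copulas" and S: "S \<in> sets borel" and T: "T \<in> sets borel" for \<delta> S T
  proof -
    have r: "S \<times> UNIV \<in> sets \<delta>" "UNIV \<times> T \<in> sets \<delta>"
      using c[OF \<delta>] borel_Times[of S UNIV] borel_Times[of UNIV T] S T by auto
    have v: "fst -` S \<inter> space \<delta> = S \<times> UNIV" "snd -` T \<inter> space \<delta> = UNIV \<times> T"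
      using c[OF \<delta>] by auto
    show "emeasure (F \<delta> T) S = emeasure \<delta> (S \<times> T)" "emeasure (G \<delta> S) T = emeasure \<delta> (S \<times> T)"
      using c[OF \<delta>] S T r v unfolding F_def G_def
      by (simp_all add: emeasure_distr emeasure_restricted Times_Int_Times)
  qed
  have sets: "sets (F \<delta> T) = sets borel" "sets (G \<delta> T) = sets borel" for \<delta> T
    by (simp_all add: F_def G_def)
  have me: "measure (F \<delta> T) S = measure \<delta> (S \<times> T)" "measure (G \<delta> S) T = measure \<delta> (S \<times> T)"
    if "\<delta> \<in> copulas" "S \<in> sets borel" "T \<in> sets borel" for \<delta> S T
    using em[OF that] by (auto simp: measure_def)
  have fin: "finite_measure (F \<delta> T)" "finite_measure (G \<delta> T)" if \<delta>: "\<delta> \<in> copulas" and T: "T \<in> sets borel" for \<delta> T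
  proof -
    interpret prob_space \<delta> using c[OF \<delta>] by simp
    show "finite_measure (F \<delta> T)" "finite_measure (G \<delta> T)"
      using em[OF \<delta> _ T] em[OF \<delta> T]
      by (auto intro!: finite_measureI simp: F_def G_def)
  qed
  have le: "measure \<delta> (S \<times> T) \<le> measure unif S" "measure \<delta> (S \<times> T) \<le> measure unif T"
    if \<delta>: "\<delta> \<in> copulas" and S: "S \<in> sets borel" and T: "T \<in> sets borel" for \<delta> S T
  proof -
    interpret prob_space \<delta> using c[OF \<delta>] by simp
    have r: "S \<times> UNIV \<in> sets \<delta>" "UNIV \<times> T \<in> sets \<delta>"
      using c[OF \<delta>] borel_Times[of S UNIV] borel_Times[of UNIV T] S T by auto
    show "measure \<delta> (S \<times> T) \<le> measure unif S" "measure \<delta> (S \<times> T) \<le> measure unif T"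
      unfolding measure_copula(1)[OF \<delta> S, symmetric] measure_copula(2)[OF \<delta> T, symmetric]
      using r by (auto intro!: finite_measure_mono)
  qed
  have fu: "finite_measure unif" using prob_space_unif by (rule prob_space.finite_measure)
  have 1: "(\<lambda>n. measure (g n) (S \<times> T)) \<longlonglongrightarrow> measure \<gamma> (S \<times> T)"
    if S: "S \<in> sets borel" and T: "T \<in> \<U>" for S T
  proof -
    have "(\<lambda>n. measure (F (g n) T) S) \<longlonglongrightarrow> measure (F \<gamma> T) S"
    proof (rule tendsto_measure_sigma_sets[where N = "borel :: real measure" and U = unif and G = \<U>])
      show "(\<lambda>n. measure (F (g n) T) A) \<longlonglongrightarrow> measure (F \<gamma> T) A" if "A \<in> \<U>" for A
        using conv that T by (simp add: me g \<gamma> \<U>b)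
      show "(\<lambda>n. measure (F (g n) T) (space borel)) \<longlonglongrightarrow> measure (F \<gamma> T) (space borel)"
        using conv \<U>(1) T by (simp add: me g \<gamma> \<U>b)
    qed (use g \<gamma> fin fu le \<U> \<U>i \<U>b T S in \<open>auto simp: me sets\<close>)
    then show ?thesis using S T by (simp add: me g \<gamma> \<U>b)
  qed
  have "(\<lambda>n. measure (G (g n) S) T) \<longlonglongrightarrow> measure (G \<gamma> S) T"
  proof (rule tendsto_measure_sigma_sets[where N = "borel :: real measure" and U = unif and G = \<U>])
    show "(\<lambda>n. measure (G (g n) S) A) \<longlonglongrightarrow> measure (G \<gamma> S) A" if "A \<in> \<U>" for A
      using 1 that S by (simp add: me g \<gamma> \<U>b)
    show "(\<lambda>n. measure (G (g n) S) (space borel)) \<longlonglongrightarrow> measure (G \<gamma> S) (space borel)"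
      using 1 \<U>(1) S by (simp add: me g \<gamma> \<U>b)
  qed (use g \<gamma> fin fu le \<U> \<U>i \<U>b T S in \<open>auto simp: me sets\<close>)
  then show ?thesis using S T by (simp add: me g \<gamma>)
qed

text \<open>The masses of all basic rectangles represent a copula as a point of
  \<open>nat \<Rightarrow> real\<close>. That space is second countable and its closures are
  sequential, so countably many copulas approximate every copula along sequences.\<close>

lemma ex_countable_dense_copulas:
  "\<exists>D. countable D \<and> D \<subseteq> copulas \<and> (\<forall>\<gamma>\<in>copulas. \<exists>g. (\<forall>n. g n \<in> D) \<and>
     (\<forall>S\<in>sets borel. \<forall>T\<in>sets borel. (\<lambda>n::nat. measure (g n) (S \<times> T)) \<longlonglongrightarrow> measure \<gamma> (S \<times> T)))"
proof -
  obtain \<U> :: "real set set" where \<U>: "countable \<U>" "topological_basis \<U>" "UNIV \<in> \<U>"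
    "\<And>U V. U \<in> \<U> \<Longrightarrow> V \<in> \<U> \<Longrightarrow> U \<inter> V \<in> \<U>"
    using ex_countable_Int_basis by blast
  have sets: "sets borel = sigma_sets UNIV \<U>"
    by (simp add: borel_eq_countable_basis[OF \<U>(1,2)])
  define A where "A = from_nat_into \<U>"
  have rA: "range A = \<U>"
    unfolding A_def using \<U>(1,3) by (intro range_from_nat_into) auto
  define \<Phi> where "\<Phi> \<gamma> i = measure \<gamma> (A (fst (prod_decode i)) \<times> A (snd (prod_decode i)))" for \<gamma> i
  obtain E where E: "countable E" "E \<subseteq> \<Phi> ` copulas" "\<Phi> ` copulas \<subseteq> closure E"
    using ex_countable_dense_subset[of "\<Phi> ` copulas"] by blast
  define D where "D = inv_into copulas \<Phi> ` E"
  have D: "countable D" "D \<subseteq> copulas"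
    using E by (auto simp: D_def inv_into_into)
  have \<Phi>D: "\<Phi> (inv_into copulas \<Phi> x) = x" if "x \<in> E" for x
    using that E(2) by (auto intro: f_inv_into_f)
  have dense: "\<exists>g. (\<forall>n. g n \<in> D) \<and>
     (\<forall>S\<in>sets borel. \<forall>T\<in>sets borel. (\<lambda>n::nat. measure (g n) (S \<times> T)) \<longlonglongrightarrow> measure \<gamma> (S \<times> T))"
    if \<gamma>: "\<gamma> \<in> copulas" for \<gamma>
  proof -
    have "\<Phi> \<gamma> \<in> closure E" using E(3) \<gamma> by auto
    then obtain x where x: "\<And>n. x n \<in> E" "x \<longlonglongrightarrow> \<Phi> \<gamma>"
      unfolding closure_sequential by blast
    define g where "g n = inv_into copulas \<Phi> (x n)" for n
    have gD: "g n \<in> D" for n using x by (auto simp: g_def D_def)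
    have "(\<lambda>n. x n i) \<longlonglongrightarrow> \<Phi> \<gamma> i" for i
    proof -
      have "continuous_on UNIV (\<lambda>f :: nat \<Rightarrow> real. f i)" by simp
      then show ?thesis
        using continuous_on_tendsto_compose[where f="\<lambda>f. f i" and s=UNIV, OF _ x(2)] by simp
    qed
    then have \<Phi>: "(\<lambda>n. \<Phi> (g n) i) \<longlonglongrightarrow> \<Phi> \<gamma> i" for i
      using \<Phi>D x(1) by (simp add: g_def)
    have conv: "(\<lambda>n. measure (g n) (S \<times> T)) \<longlonglongrightarrow> measure \<gamma> (S \<times> T)" if "S \<in> \<U>" "T \<in> \<U>" for S T
    proof -
      obtain i j where "S = A i" "T = A j" using rA \<open>S \<in> \<U>\<close> \<open>T \<in> \<U>\<close> by auto
      then show ?thesis using \<Phi>[of "prod_encode (i, j)"] by (simp add: \<Phi>_def)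
    qed
    have "g n \<in> copulas" for n using gD D by auto
    then show ?thesis
      using gD copula_rectangle_convergence[OF _ \<gamma> \<U>(3,4) sets conv] by (intro exI[of _ g]) blast
  qed
  show ?thesis using D dense by (intro exI[of _ D]) simp
qed

section \<open>Quantile maps for measures with atoms\<close>

lemma distr_pair_snd:
  assumes "prob_space M" "prob_space N"
  shows "distr (M \<Otimes>\<^sub>M N) N snd = N"
proof (rule measure_eqI)
  interpret M: prob_space M by fact
  interpret N: prob_space N by fact
  fix A assume A: "A \<in> sets (distr (M \<Otimes>\<^sub>M N) N snd)"
  then have "snd -` A \<inter> space (M \<Otimes>\<^sub>M N) = space M \<times> A"
    using sets.sets_into_space[of A N] by (auto simp: space_pair_measure)
  then show "emeasure (distr (M \<Otimes>\<^sub>M N) N snd) A = emeasure N A"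
    using A by (simp add: emeasure_distr N.emeasure_pair_measure_Times M.emeasure_space_1)
qed simp

text \<open>With the same measure and the same code as source and target, sampling at the rank
  inverts the rank; \<open>AE_quantile_cdf\<close> gives this up to a null set.\<close>

lemma AE_sampler_mrank:
  assumes m: "prob_space m" and [measurable]: "e \<in> borel_measurable m" "r \<in> borel \<rightarrow>\<^sub>M m" "i \<in> m \<rightarrow>\<^sub>M count_space UNIV"
    and re: "\<And>x. x \<in> space m \<Longrightarrow> r (e x) = x \<and> 0 < e x \<and> e x < 1"
    and atomless: "\<And>t. measure m {x \<in> space m. lex_code i e x = t} = 0"
  shows "AE x in m. sampler r (lex_code i e) m (mrank m (lex_code i e) x) = x"
proof -
  let ?m = "distr m borel (lex_code i e)"
  have r: "real_distribution ?m" by (rule real_distribution_distr) (use m in auto)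
  have "{x \<in> space m. lex_code i e x = t} = lex_code i e -` {t} \<inter> space m" for t by auto
  then have a: "measure ?m {t} = 0" for t
    using atomless[of t] by (simp add: measure_distr)
  interpret cdf_distribution ?m using r by (simp add: cdf_distribution_def)
  have [measurable]: "quantile ?m \<in> borel_measurable borel"
    using r by (rule measurable_quantile1)
  have "AE t in ?m. quantile ?m (cdf ?m t) = t"
    using r a by (rule AE_quantile_cdf)
  then have "AE x in m. quantile ?m (cdf ?m (lex_code i e x)) = lex_code i e x"
    by (subst (asm) AE_distr_iff) auto
  then show ?thesis
    using AE_space
  proof eventually_elim
    case (elim x)
    then show ?case using re[of x] by (simp add: sampler_def mrank_def frac_lex)
  qed
qed

text \<open>An independent uniform coordinate makes the measure atomless whatever
  \<open>\<mu>\<close> is; it randomises the rank at atoms.\<close>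

definition lift :: "'a::topological_space borel_prob \<Rightarrow> ('a \<times> real) measure" where
  "lift \<mu> = to_measure \<mu> \<Otimes>\<^sub>M unif"

lemma sets_lift: "sets (lift (\<mu> :: 'a::second_countable_topology borel_prob)) = sets borel"
  unfolding lift_def borel_prod[symmetric] by (intro sets_pair_measure_cong) auto

lemma space_lift [simp]: "space (lift \<mu>) = UNIV"
  by (simp add: lift_def space_pair_measure)

lemma prob_space_lift: "prob_space (lift \<mu>)"
  unfolding lift_def by (intro prob_space_pair prob_space_to_measure prob_space_unif)

lemma distr_lift_fst: "distr (lift \<mu>) (to_measure \<mu>) fst = to_measure \<mu>"
  unfolding lift_def using prob_space.distr_pair_fst[OF prob_space_unif] by blast

lemma measurable_lift: "lift \<in> borel \<rightarrow>\<^sub>M prob_algebra (borel :: ('a::polish_space \<times> real) measure)"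
proof -
  have "(\<lambda>\<mu> :: 'a borel_prob. unif) \<in> borel \<rightarrow>\<^sub>M prob_algebra borel"
    by (intro measurable_const) (auto simp: space_prob_algebra prob_space_unif)
  with measurable_to_measure
  have "(\<lambda>\<mu> :: 'a borel_prob. to_measure \<mu> \<Otimes>\<^sub>M unif) \<in> borel \<rightarrow>\<^sub>M prob_algebra (borel \<Otimes>\<^sub>M borel)"
    by (rule measurable_pair_prob)
  then show ?thesis by (simp add: lift_def[abs_def] borel_prod)
qed

text \<open>A level set is at most one point, which lies in a slice
  \<open>UNIV \<times> {v}\<close>; the uniform coordinate gives that slice mass 0.\<close>

lemma lift_atomless:
  fixes \<mu> :: "'a::polish_space borel_prob"
  assumes [measurable]: "e \<in> borel_measurable borel" and re: "\<And>x. r (e x) = x \<and> 0 < e x \<and> e x < (1 :: real)"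
  shows "measure (lift \<mu>) {x. lex_code i e x = t} = 0"
proof -
  interpret U: prob_space unif by (rule prob_space_unif)
  have inj: "x = y" if "lex_code i e x = lex_code i e y" for x y
    using that re frac_lex by metis
  show ?thesis
  proof (cases "\<exists>x. lex_code i e x = t")
    case True
    then obtain x v where "lex_code i e (x, v) = t" by auto
    then have eq: "{x. lex_code i e x = t} = {(x, v)}" using inj by auto
    have "emeasure (lift \<mu>) (UNIV \<times> {v}) = emeasure (to_measure \<mu>) UNIV * emeasure unif {v}"
      unfolding lift_def by (rule U.emeasure_pair_measure_Times) auto
    also have "emeasure unif {v} = 0"
      using emeasure_mono[of "{v} \<inter> {0<..<1}" "{v}" lborel] by (simp add: emeasure_unif)
    finally have "emeasure (lift \<mu>) (UNIV \<times> {v}) = 0" by simp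
    moreover have "UNIV \<times> {v} \<in> sets (lift \<mu>)"
      using borel_Times[of UNIV "{v}"] by (simp add: sets_lift)
    ultimately have "emeasure (lift \<mu>) {(x, v)} = 0"
      using emeasure_mono[of "{(x, v)}" "UNIV \<times> {v}" "lift \<mu>"] by simp
    then show ?thesis by (simp add: eq measure_def)
  next
    case False
    then have "{x. lex_code i e x = t} = {}" by auto
    then show ?thesis by (simp only: measure_empty)
  qed
qed

text \<open>\<open>Q\<close> is a quantile map, jointly Borel in level and measure. \<open>R\<close>
  is a randomised rank (distributional transform) on \<open>lift \<mu>\<close>, from which
  \<open>Q\<close> returns the original point even if \<open>\<mu>\<close> has atoms.\<close>

definition is_quantile_map ::
  "(real \<Rightarrow> 'a::polish_space borel_prob \<Rightarrow> 'a) \<Rightarrow> ('a \<times> real \<Rightarrow> 'a borel_prob \<Rightarrow> real) \<Rightarrow> bool" where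
  "is_quantile_map Q R \<longleftrightarrow> (\<lambda>(s, \<mu>). Q s \<mu>) \<in> borel_measurable (borel \<Otimes>\<^sub>M borel) \<and>
    (\<forall>\<mu>. distr unif borel (\<lambda>s. Q s \<mu>) = to_measure \<mu>) \<and>
    (\<forall>\<mu>. (\<lambda>z. R z \<mu>) \<in> borel_measurable borel) \<and>
    (\<forall>\<mu>. distr (lift \<mu>) borel (\<lambda>z. R z \<mu>) = unif) \<and>
    (\<forall>\<mu>. AE z in lift \<mu>. Q (R z \<mu>) \<mu> = fst z)"

lemma is_quantile_mapD:
  assumes "is_quantile_map Q R"
  shows "(\<lambda>(s, \<mu>). Q s \<mu>) \<in> borel_measurable (borel \<Otimes>\<^sub>M borel)"
    "(\<lambda>s. Q s \<mu>) \<in> borel_measurable borel"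
    "distr unif borel (\<lambda>s. Q s \<mu>) = to_measure \<mu>"
    "(\<lambda>z. R z \<mu>) \<in> borel_measurable borel"
    "distr (lift \<mu>) borel (\<lambda>z. R z \<mu>) = unif"
    "AE z in lift \<mu>. Q (R z \<mu>) \<mu> = fst z"
proof -
  show 1: "(\<lambda>(s, \<mu>). Q s \<mu>) \<in> borel_measurable (borel \<Otimes>\<^sub>M borel)"
    using assms unfolding is_quantile_map_def by (rule conjunct1)
  show "(\<lambda>s. Q s \<mu>) \<in> borel_measurable borel"
    using measurable_compose[OF _ 1, of "\<lambda>s. (s, \<mu>)" borel] by simp
qed (use assms in \<open>simp_all add: is_quantile_map_def\<close>)

text \<open>Rank and sampler of \<open>lift \<mu>\<close>, with a single cell, do this;
  \<open>Q\<close> then forgets the uniform coordinate.\<close>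

lemma ex_quantile_map: "\<exists>(Q :: real \<Rightarrow> 'a::polish_space borel_prob \<Rightarrow> 'a) R. is_quantile_map Q R"
proof -
  obtain e :: "'a \<times> real \<Rightarrow> real" and r where
    e[measurable]: "e \<in> borel_measurable borel" "r \<in> borel_measurable borel"
    and re: "\<And>x. r (e x) = x \<and> 0 < e x \<and> e x < 1"
    using std_borel_polish[where 'a="'a \<times> real"] unfolding std_borel_def by auto
  define f where "f = lex_code (\<lambda>_ :: 'a \<times> real. 0) e"
  have f[measurable]: "f \<in> borel_measurable borel" unfolding f_def by measurable
  define Q where "Q s \<mu> = fst (sampler r f (lift \<mu>) s)" for s and \<mu> :: "'a borel_prob"
  define R where "R z \<mu> = mrank (lift \<mu>) f z" for z and \<mu> :: "'a borel_prob"
  note measurable_lift[measurable] measurable_fst_borel[measurable]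
  have meas: "e \<in> borel_measurable (lift \<mu>)" "r \<in> borel \<rightarrow>\<^sub>M lift \<mu>" "f \<in> borel_measurable (lift \<mu>)" for \<mu> :: "'a borel_prob"
    by (simp_all add: measurable_cong_sets[OF sets_lift refl] measurable_cong_sets[OF refl sets_lift])
  have atomless: "measure (lift \<mu>) {x \<in> space (lift \<mu>). f x = t} = 0" for \<mu> t
    unfolding f_def using lift_atomless[OF e(1), of r \<mu> _ t] re by simp
  have "(\<lambda>p. sampler r f (lift (snd p)) (fst p)) \<in> borel_measurable (borel \<Otimes>\<^sub>M borel)"
    by measurable
  then have "(\<lambda>p. Q (fst p) (snd p)) \<in> borel_measurable (borel \<Otimes>\<^sub>M borel)"
    unfolding Q_def by (rule measurable_compose[OF _ measurable_fst_borel])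
  then have 1: "(\<lambda>(s, \<mu>). Q s \<mu>) \<in> borel_measurable (borel \<Otimes>\<^sub>M borel)"
    by (simp add: case_prod_beta')
  have sm: "sampler r f (lift \<mu>) \<in> borel \<rightarrow>\<^sub>M lift \<mu>" for \<mu>
    using prob_space_lift meas(3,2) by (rule measurable_sampler1)
  have fstm: "fst \<in> lift \<mu> \<rightarrow>\<^sub>M borel" for \<mu> :: "'a borel_prob"
    using measurable_fst_borel measurable_cong_sets[OF sets_lift[of \<mu>] refl] by blast
  have 2: "distr unif borel (\<lambda>s. Q s \<mu>) = to_measure \<mu>" for \<mu>
  proof -
    have "distr unif borel (\<lambda>s. Q s \<mu>) = distr (distr unif (lift \<mu>) (sampler r f (lift \<mu>))) borel fst"
      using sm fstm by (subst distr_distr) (auto simp: Q_def comp_def cong: measurable_cong_sets)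
    also have "distr unif (lift \<mu>) (sampler r f (lift \<mu>)) = lift \<mu>"
      unfolding f_def using re meas(1,2) prob_space_lift by (intro distr_sampler) auto
    also have "distr (lift \<mu>) borel fst = distr (lift \<mu>) (to_measure \<mu>) fst"
      by (intro distr_cong) auto
    finally show ?thesis by (simp add: distr_lift_fst)
  qed
  have 3: "(\<lambda>z. R z \<mu>) \<in> borel_measurable borel" for \<mu>
    unfolding R_def using measurable_rank1[OF prob_space_lift meas(3)]
    measurable_cong_sets[OF sets_lift[of \<mu>] refl] by auto
  have 4: "distr (lift \<mu>) borel (\<lambda>z. R z \<mu>) = unif" for \<mu>
    unfolding R_def using prob_space_lift meas(3) atomless by (rule distr_rank)
  have 5: "AE z in lift \<mu>. Q (R z \<mu>) \<mu> = fst z" for \<mu>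
  proof -
    have "AE z in lift \<mu>. sampler r f (lift \<mu>) (mrank (lift \<mu>) f z) = z"
      unfolding f_def using re meas(1,2) prob_space_lift atomless
      by (intro AE_sampler_mrank) (auto simp: f_def)
    then show ?thesis by eventually_elim (simp add: Q_def R_def)
  qed
  have "is_quantile_map Q R"
    unfolding is_quantile_map_def using 1 2 3 4 5 by (intro conjI allI)
  then show ?thesis by blast
qed

text \<open>Sklar's theorem in Polish spaces: the copula is the joint law of the randomised ranks of
  the two coordinates, and the quantile maps recover the coordinates from the ranks.\<close>

lemma ex_copula:
  fixes \<pi> :: "('a::polish_space \<times> 'b::polish_space) borel_prob"
  assumes \<pi>: "\<pi> \<in> couplings \<mu> \<nu>"
    and QR: "is_quantile_map Q R" and QR': "is_quantile_map Q' R'"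
  shows "\<exists>\<gamma>\<in>copulas. distr \<gamma> borel (\<lambda>p. (Q (fst p) \<mu>, Q' (snd p) \<nu>)) = to_measure \<pi>"
proof -
  note Q = is_quantile_mapD(2,4-6)[OF QR] and Q' = is_quantile_mapD(2,4-6)[OF QR']
  interpret P: prob_space "to_measure \<pi>" by (rule prob_space_to_measure)
  interpret U: prob_space unif by (rule prob_space_unif)
  interpret UU: prob_space "unif \<Otimes>\<^sub>M unif" by (intro prob_space_pair prob_space_unif)
  \<comment> \<open>One independent uniform variable per coordinate: for
    \<open>((x, y), (u, v))\<close> of this law, \<open>(x, u)\<close> has law
    \<open>lift \<mu>\<close> and \<open>(y, v)\<close> has law \<open>lift \<nu>\<close>, while
    \<open>(x, y)\<close> keeps its law \<pi>.\<close>
  let ?\<Omega> = "to_measure \<pi> \<Otimes>\<^sub>M (unif \<Otimes>\<^sub>M unif)"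
  interpret \<Omega>: prob_space ?\<Omega> by (intro prob_space_pair prob_space_to_measure UU.prob_space_axioms)
  note measurable_fst_borel[measurable] measurable_snd_borel[measurable] Q(1,2)[measurable] Q'(1,2)[measurable]
  have pm: "push fst \<pi> = \<mu>" "push snd \<pi> = \<nu>" using \<pi> by (auto simp: couplings_def)
  have d1: "distr ?\<Omega> (borel \<Otimes>\<^sub>M borel) (\<lambda>\<omega>. (fst (fst \<omega>), fst (snd \<omega>))) = lift \<mu>"
  proof -
    have f: "distr (to_measure \<pi>) borel fst = to_measure \<mu>"
      unfolding pm[symmetric] by (rule to_measure_push[symmetric]) measurable
    have u: "distr (unif \<Otimes>\<^sub>M unif) borel fst = unif"
      using U.distr_pair_fst[of unif] by (metis distr_cong sets_unif)
    have "distr (to_measure \<pi>) borel fst \<Otimes>\<^sub>M distr (unif \<Otimes>\<^sub>M unif) borel fst =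
        distr ?\<Omega> (borel \<Otimes>\<^sub>M borel) (\<lambda>(x, y). (fst x, fst y))"
      unfolding f u by (subst f[symmetric], subst u[symmetric], rule pair_measure_distr)
        (auto simp: u U.sigma_finite_measure_axioms)
    then show ?thesis unfolding f u by (simp add: lift_def case_prod_beta')
  qed
  have d2: "distr ?\<Omega> (borel \<Otimes>\<^sub>M borel) (\<lambda>\<omega>. (snd (fst \<omega>), snd (snd \<omega>))) = lift \<nu>"
  proof -
    have f: "distr (to_measure \<pi>) borel snd = to_measure \<nu>"
      unfolding pm[symmetric] by (rule to_measure_push[symmetric]) measurable
    have u: "distr (unif \<Otimes>\<^sub>M unif) borel snd = unif"
      using distr_pair_snd[OF prob_space_unif prob_space_unif] by (metis distr_cong sets_unif)
    have "distr (to_measure \<pi>) borel snd \<Otimes>\<^sub>M distr (unif \<Otimes>\<^sub>M unif) borel snd =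
        distr ?\<Omega> (borel \<Otimes>\<^sub>M borel) (\<lambda>(x, y). (snd x, snd y))"
      unfolding f u by (subst f[symmetric], subst u[symmetric], rule pair_measure_distr)
        (auto simp: u U.sigma_finite_measure_axioms)
    then show ?thesis unfolding f u by (simp add: lift_def case_prod_beta')
  qed
  define s where "s \<omega> = R (fst (fst \<omega>), fst (snd \<omega>)) \<mu>" for \<omega> :: "('a \<times> 'b) \<times> real \<times> real"
  define t where "t \<omega> = R' (snd (fst \<omega>), snd (snd \<omega>)) \<nu>" for \<omega> :: "('a \<times> 'b) \<times> real \<times> real"
  have R: "(\<lambda>z. R z \<mu>) \<in> borel_measurable (borel \<Otimes>\<^sub>M borel)" "(\<lambda>z. R' z \<nu>) \<in> borel_measurable (borel \<Otimes>\<^sub>M borel)"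
    using Q(2) Q'(2) by (auto simp: borel_prod)
  have pr[measurable]: "(\<lambda>\<omega>. (fst (fst \<omega>), fst (snd \<omega>))) \<in> ?\<Omega> \<rightarrow>\<^sub>M borel \<Otimes>\<^sub>M borel"
    "(\<lambda>\<omega>. (snd (fst \<omega>), snd (snd \<omega>))) \<in> ?\<Omega> \<rightarrow>\<^sub>M borel \<Otimes>\<^sub>M borel"
    by measurable
  have st[measurable]: "s \<in> borel_measurable ?\<Omega>" "t \<in> borel_measurable ?\<Omega>"
    unfolding s_def t_def using measurable_compose[OF pr(1) R(1)] measurable_compose[OF pr(2) R(2)] by simp_all
  have ds: "distr ?\<Omega> borel s = unif"
  proof -
    have "distr ?\<Omega> borel s = distr (lift \<mu>) borel (\<lambda>z. R z \<mu>)"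
      unfolding d1[symmetric] using R(1) by (subst distr_distr) (auto simp: comp_def s_def[abs_def])
    then show ?thesis by (simp add: Q(3))
  qed
  have dt: "distr ?\<Omega> borel t = unif"
  proof -
    have "distr ?\<Omega> borel t = distr (lift \<nu>) borel (\<lambda>z. R' z \<nu>)"
      unfolding d2[symmetric] using R(2) by (subst distr_distr) (auto simp: comp_def t_def[abs_def])
    then show ?thesis by (simp add: Q'(3))
  qed
  have As: "AE \<omega> in ?\<Omega>. Q (s \<omega>) \<mu> = fst (fst \<omega>)"
  proof -
    have "{z \<in> space (borel \<Otimes>\<^sub>M borel). Q (R z \<mu>) \<mu> = fst z} \<in> sets (borel \<Otimes>\<^sub>M borel)"
      using R(1) by (intro measurable_equality_set measurable_compose[OF R(1) Q(1)]) auto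
    then show ?thesis
      using Q(4)[of \<mu>] unfolding d1[symmetric] by (subst (asm) AE_distr_iff) (auto simp: s_def)
  qed
  have At: "AE \<omega> in ?\<Omega>. Q' (t \<omega>) \<nu> = snd (fst \<omega>)"
  proof -
    have "{z \<in> space (borel \<Otimes>\<^sub>M borel). Q' (R' z \<nu>) \<nu> = fst z} \<in> sets (borel \<Otimes>\<^sub>M borel)"
      using R(2) by (intro measurable_equality_set measurable_compose[OF R(2) Q'(1)]) auto
    then show ?thesis
      using Q'(4)[of \<nu>] unfolding d2[symmetric] by (subst (asm) AE_distr_iff) (auto simp: t_def)
  qed
  have stm: "(\<lambda>\<omega>. (s \<omega>, t \<omega>)) \<in> ?\<Omega> \<rightarrow>\<^sub>M borel"
    unfolding borel_prod[symmetric, where 'a=real and 'b=real] by measurable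
  define \<gamma> where "\<gamma> = distr ?\<Omega> borel (\<lambda>\<omega>. (s \<omega>, t \<omega>))"
  have "\<gamma> \<in> copulas"
    unfolding copulas_def \<gamma>_def using stm ds dt
    by (auto intro!: \<Omega>.prob_space_distr simp: distr_distr comp_def)
  moreover have "distr \<gamma> borel (\<lambda>p. (Q (fst p) \<mu>, Q' (snd p) \<nu>)) = to_measure \<pi>"
  proof -
    have qq: "(\<lambda>p. (Q (fst p) \<mu>, Q' (snd p) \<nu>)) \<in> borel_measurable borel"
      unfolding borel_prod[symmetric, where 'a='a and 'b='b] by measurable
    have m1: "fst \<in> ?\<Omega> \<rightarrow>\<^sub>M (borel :: ('a \<times> 'b) measure)" by measurable
    have "distr \<gamma> borel (\<lambda>p. (Q (fst p) \<mu>, Q' (snd p) \<nu>)) = distr ?\<Omega> borel (\<lambda>\<omega>. (Q (s \<omega>) \<mu>, Q' (t \<omega>) \<nu>))"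
      unfolding \<gamma>_def using stm qq by (subst distr_distr) (auto simp: comp_def)
    also have "\<dots> = distr ?\<Omega> borel fst"
    proof (rule distr_cong_AE)
      show "AE \<omega> in ?\<Omega>. (Q (s \<omega>) \<mu>, Q' (t \<omega>) \<nu>) = fst \<omega>"
        using As At by eventually_elim (simp add: prod_eq_iff)
      show "(\<lambda>\<omega>. (Q (s \<omega>) \<mu>, Q' (t \<omega>) \<nu>)) \<in> ?\<Omega> \<rightarrow>\<^sub>M borel"
        using measurable_compose[OF stm qq] by simp
    qed (use m1 in auto)
    also have "\<dots> = distr ?\<Omega> (to_measure \<pi>) fst" by (intro distr_cong) auto
    also have "\<dots> = to_measure \<pi>" by (rule UU.distr_pair_fst)
    finally show ?thesis .
  qed
  ultimately show ?thesis by blast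
qed

section \<open>Measurable selection of couplings\<close>

text \<open>The set of couplings varies with the pair, the set of copulas does not. Each member of a
  fixed countable dense set of copulas therefore yields a coupling that is measurable in the
  pair.\<close>

lemma ex_coupling_family:
  fixes c :: "'a::polish_space \<times> 'b::polish_space \<Rightarrow> real"
  assumes c: "continuous_on UNIV c" "\<And>x. 0 \<le> c x" "\<And>x. c x \<le> b"
  shows "\<exists>P :: nat \<Rightarrow> 'a borel_prob \<times> 'b borel_prob \<Rightarrow> ('a \<times> 'b) measure.
    (\<forall>k. P k \<in> borel \<rightarrow>\<^sub>M prob_algebra borel) \<and>
    (\<forall>k p. distr (P k p) borel fst = to_measure (fst p) \<and> distr (P k p) borel snd = to_measure (snd p)) \<and>
    (\<forall>p. (INF k. \<integral>\<^sup>+z. ennreal (c z) \<partial>P k p) \<le> transport_cost (\<lambda>x y. ennreal (c (x, y))) (fst p) (snd p))"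
proof -
  obtain Q :: "real \<Rightarrow> 'a borel_prob \<Rightarrow> 'a" and R where QR: "is_quantile_map Q R"
    using ex_quantile_map by blast
  obtain Q' :: "real \<Rightarrow> 'b borel_prob \<Rightarrow> 'b" and R' where QR': "is_quantile_map Q' R'"
    using ex_quantile_map by blast
  note Q[measurable] = is_quantile_mapD(1)[OF QR] is_quantile_mapD(1)[OF QR']
  note Qm[measurable] = is_quantile_mapD(2)[OF QR] is_quantile_mapD(2)[OF QR']
  note Qd = is_quantile_mapD(3)[OF QR] and Qd' = is_quantile_mapD(3)[OF QR']
  obtain D where D: "countable D" "D \<subseteq> copulas" and dense: "\<forall>\<gamma>\<in>copulas. \<exists>g. (\<forall>n. g n \<in> D) \<and>
     (\<forall>S\<in>sets borel. \<forall>T\<in>sets borel. (\<lambda>n::nat. measure (g n) (S \<times> T)) \<longlonglongrightarrow> measure \<gamma> (S \<times> T))"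
    using ex_countable_dense_copulas by (elim exE conjE)
  have "unif \<Otimes>\<^sub>M unif \<in> copulas"
  proof -
    have "distr (unif \<Otimes>\<^sub>M unif) borel fst = unif" "distr (unif \<Otimes>\<^sub>M unif) borel snd = unif"
      using prob_space.distr_pair_fst[OF prob_space_unif, of unif] distr_pair_snd[OF prob_space_unif prob_space_unif]
      by (metis distr_cong sets_unif)+
    moreover have "sets (unif \<Otimes>\<^sub>M unif) = sets borel"
      unfolding borel_prod[symmetric] by (intro sets_pair_measure_cong) auto
    ultimately show ?thesis
      by (simp add: copulas_def prob_space_pair prob_space_unif)
  qed
  then have "D \<noteq> {}" using dense by blast
  define \<gamma> where "\<gamma> = from_nat_into D"
  have r\<gamma>: "range \<gamma> = D"
    unfolding \<gamma>_def using D(1) \<open>D \<noteq> {}\<close> by (intro range_from_nat_into) auto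
  then have \<gamma>: "\<gamma> k \<in> copulas" for k using D(2) by auto
  have cop: "sets \<delta> = sets borel" "prob_space \<delta>" "distr \<delta> borel fst = unif" "distr \<delta> borel snd = unif" if "\<delta> \<in> copulas" for \<delta>
    using that by (auto simp: copulas_def)
  have cm: "fst \<in> borel_measurable \<delta>" "snd \<in> borel_measurable \<delta>" if "\<delta> \<in> copulas" for \<delta>
    using measurable_cong_sets[OF cop(1)[OF that] refl] measurable_fst_borel measurable_snd_borel by auto
  let ?h = "\<lambda>p q. (Q (fst q) (fst p), Q' (snd q) (snd p))"
  define P where "P k p = distr (\<gamma> k) borel (?h p)" for k p
  have hm: "?h p \<in> borel_measurable borel" for p
    unfolding borel_prod[symmetric] by measurable
  have hm': "?h p \<in> borel_measurable \<delta>" if "\<delta> \<in> copulas" for p \<delta>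
    using hm measurable_cong_sets[OF cop(1)[OF that] refl] by blast
  have P1: "P k \<in> borel \<rightarrow>\<^sub>M prob_algebra borel" for k
    unfolding P_def
  proof (rule measurable_distr_prob_space2[where M=borel])
    show "(\<lambda>p. \<gamma> k) \<in> borel \<rightarrow>\<^sub>M prob_algebra borel"
      using cop[OF \<gamma>] by (intro measurable_const) (auto simp: space_prob_algebra)
    have "(\<lambda>(p, q). ?h p q) \<in> (borel \<Otimes>\<^sub>M borel) \<Otimes>\<^sub>M (borel \<Otimes>\<^sub>M borel) \<rightarrow>\<^sub>M borel \<Otimes>\<^sub>M borel"
      by measurable
    then show "(\<lambda>(p, q). ?h p q) \<in> borel \<Otimes>\<^sub>M borel \<rightarrow>\<^sub>M borel"
      by (simp add: borel_prod)
  qed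
  have P2: "distr (P k p) borel fst = to_measure (fst p)" for k p
  proof -
    have "distr (P k p) borel fst = distr (distr (\<gamma> k) borel fst) borel (\<lambda>s. Q s (fst p))"
      unfolding P_def using hm'[OF \<gamma>] cm[OF \<gamma>] measurable_fst_borel Qm
      by (subst (1 2) distr_distr) (auto simp: comp_def)
    then show ?thesis by (simp add: cop(3)[OF \<gamma>] Qd)
  qed
  have P3: "distr (P k p) borel snd = to_measure (snd p)" for k p
  proof -
    have "distr (P k p) borel snd = distr (distr (\<gamma> k) borel snd) borel (\<lambda>s. Q' s (snd p))"
      unfolding P_def using hm'[OF \<gamma>] cm[OF \<gamma>] measurable_snd_borel Qm
      by (subst (1 2) distr_distr) (auto simp: comp_def)
    then show ?thesis by (simp add: cop(4)[OF \<gamma>] Qd')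
  qed
  have P4: "(INF k. \<integral>\<^sup>+z. ennreal (c z) \<partial>P k p) \<le> transport_cost (\<lambda>x y. ennreal (c (x, y))) (fst p) (snd p)" for p
    unfolding transport_cost_def
  proof (rule INF_greatest)
    fix \<pi> assume \<pi>: "\<pi> \<in> couplings (fst p) (snd p)"
    obtain \<delta> where \<delta>: "\<delta> \<in> copulas" "distr \<delta> borel (?h p) = to_measure \<pi>"
      using ex_copula[OF \<pi> QR QR'] by blast
    obtain g where g: "\<And>n. g n \<in> D" and
      conv: "\<And>S T. S \<in> sets borel \<Longrightarrow> T \<in> sets borel \<Longrightarrow> (\<lambda>n::nat. measure (g n) (S \<times> T)) \<longlonglongrightarrow> measure \<delta> (S \<times> T)"
      using bspec[OF dense \<delta>(1)] by blast
    have gc: "g n \<in> copulas" for n using g D(2) by auto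
    define L where "L n = distr (g n) borel (?h p)" for n
    have L: "prob_space (L n)" "sets (L n) = sets borel" for n
      using prob_space.prob_space_distr[OF cop(2)[OF gc] hm'[OF gc]] by (auto simp: L_def)
    obtain \<A> :: "'a set set" where \<A>: "countable \<A>" "topological_basis \<A>" "UNIV \<in> \<A>"
      "\<And>U V. U \<in> \<A> \<Longrightarrow> V \<in> \<A> \<Longrightarrow> U \<inter> V \<in> \<A>"
      using ex_countable_Int_basis by blast
    \<comment> \<open>The quantile maps are only Borel, so even open rectangles pull back to merely
      Borel rectangles; hence the convergence of copulas is required on all of these.\<close>
    have rect: "measure (distr \<eta> borel (?h p)) (A \<times> B) =
        measure \<eta> (((\<lambda>s. Q s (fst p)) -` A) \<times> ((\<lambda>s. Q' s (snd p)) -` B))"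
      if "\<eta> \<in> copulas" "A \<in> sets borel" "B \<in> sets borel" for \<eta> A B
    proof -
      have "space \<eta> = UNIV" using sets_eq_imp_space_eq[OF cop(1)[OF that(1)]] by simp
      then show ?thesis
        using hm'[OF that(1), of p] borel_Times[OF that(2,3)]
        by (subst measure_distr) (auto intro!: arg_cong2[where f=measure])
    qed
    have c_meas: "c \<in> borel_measurable N" if "sets N = sets borel" for N
      using borel_measurable_continuous_onI[OF c(1)] that by (simp cong: measurable_cong_sets)
    show "(INF k. \<integral>\<^sup>+z. ennreal (c z) \<partial>P k p) \<le> (\<integral>\<^sup>+z. ennreal (c (fst z, snd z)) \<partial>to_measure \<pi>)"
    proof (rule ennreal_le_epsilon)
      fix \<epsilon> :: real assume "0 < \<epsilon>"
      have "\<forall>\<^sub>F n in sequentially. (\<integral>x. c x \<partial>L n) \<le> (\<integral>x. c x \<partial>to_measure \<pi>) + \<epsilon>"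
      proof (rule eventually_integral_le_prod[OF L prob_space_to_measure sets_to_measure \<A> _ c \<open>0 < \<epsilon>\<close>])
        fix A :: "'a set" and B :: "'b set" assume "A \<in> \<A>" and B: "B \<in> sets borel"
        then have A: "A \<in> sets borel" using topological_basis_open[OF \<A>(2)] by auto
        show "(\<lambda>n. measure (L n) (A \<times> B)) \<longlonglongrightarrow> measure (to_measure \<pi>) (A \<times> B)"
          unfolding L_def \<delta>(2)[symmetric] rect[OF gc A B] rect[OF \<delta>(1) A B]
          using A B measurable_sets_borel[OF Qm(1)] measurable_sets_borel[OF Qm(2)] by (intro conv)
      qed
      then obtain n where n: "(\<integral>x. c x \<partial>L n) \<le> (\<integral>x. c x \<partial>to_measure \<pi>) + \<epsilon>"
        by (auto simp: eventually_sequentially)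
      obtain k where k: "g n = \<gamma> k" using g[of n] r\<gamma> by auto
      have "(INF k. \<integral>\<^sup>+z. ennreal (c z) \<partial>P k p) \<le> (\<integral>\<^sup>+z. ennreal (c z) \<partial>P k p)"
        by (rule INF_lower) simp
      also have "P k p = L n" by (simp add: L_def P_def k)
      also have "(\<integral>\<^sup>+z. ennreal (c z) \<partial>L n) = ennreal (\<integral>x. c x \<partial>L n)"
        using L c c_meas by (intro nn_integral_eq_ennreal_integral) auto
      also have "\<dots> \<le> ennreal ((\<integral>x. c x \<partial>to_measure \<pi>) + \<epsilon>)"
        using n by (rule ennreal_leI)
      also have "\<dots> = ennreal (\<integral>x. c x \<partial>to_measure \<pi>) + ennreal \<epsilon>"
        using c(2) \<open>0 < \<epsilon>\<close> by (intro ennreal_plus) auto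
      also have "ennreal (\<integral>x. c x \<partial>to_measure \<pi>) = (\<integral>\<^sup>+z. ennreal (c z) \<partial>to_measure \<pi>)"
        using c c_meas by (intro nn_integral_eq_ennreal_integral[symmetric]) (auto simp: prob_space_to_measure)
      finally show "(INF k. \<integral>\<^sup>+z. ennreal (c z) \<partial>P k p) \<le> (\<integral>\<^sup>+z. ennreal (c (fst z, snd z)) \<partial>to_measure \<pi>) + ennreal \<epsilon>"
        by simp
    qed
  qed
  show ?thesis using P1 P2 P3 P4 by blast
qed

text \<open>\<open>k\<close> is the law under \<open>\<Gamma>\<close> of a coupling chosen from the
  countable family within \<open>\<epsilon>\<close> of its infimum. The chosen coupling has the two
  components of the pair as marginals, so \<open>k\<close> inherits the marginals of
  \<open>\<Gamma>\<close>.\<close>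

lemma ex_random_coupling:
  fixes M1 :: "'a::polish_space borel_prob borel_prob" and M2 :: "'b::polish_space borel_prob borel_prob"
    and c :: "'a \<times> 'b \<Rightarrow> real"
  assumes \<Gamma>: "\<Gamma> \<in> couplings M1 M2"
    and c: "continuous_on UNIV c" "\<And>x. 0 \<le> c x" "\<And>x. c x \<le> b" and \<epsilon>: "0 < \<epsilon>"
  shows "\<exists>k. push (push fst) k = M1 \<and> push (push snd) k = M2 \<and>
    (\<integral>\<^sup>+\<pi>. (\<integral>\<^sup>+z. ennreal (c z) \<partial>to_measure \<pi>) \<partial>to_measure k) \<le>
    (\<integral>\<^sup>+p. transport_cost (\<lambda>x y. ennreal (c (x, y))) (fst p) (snd p) \<partial>to_measure \<Gamma>) + ennreal \<epsilon>"
proof -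
  obtain P :: "nat \<Rightarrow> 'a borel_prob \<times> 'b borel_prob \<Rightarrow> ('a \<times> 'b) measure" where
    P: "\<And>k. P k \<in> borel \<rightarrow>\<^sub>M prob_algebra borel"
      "\<And>k p. distr (P k p) borel fst = to_measure (fst p)"
      "\<And>k p. distr (P k p) borel snd = to_measure (snd p)"
      "\<And>p. (INF k. \<integral>\<^sup>+z. ennreal (c z) \<partial>P k p) \<le> transport_cost (\<lambda>x y. ennreal (c (x, y))) (fst p) (snd p)"
    using ex_coupling_family[OF c] by blast
  have ecm: "(\<lambda>z. ennreal (c z)) \<in> borel_measurable borel"
    using borel_measurable_continuous_onI[OF c(1)] by simp
  define G where "G k p = (\<integral>\<^sup>+z. ennreal (c z) \<partial>P k p)" for k p
  have G[measurable]: "G k \<in> borel_measurable borel" for k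
    unfolding G_def
    by (rule measurable_compose[OF measurable_prob_algebraD[OF P(1)] nn_integral_measurable_subprob_algebra[OF ecm]])
  \<comment> \<open>A countable infimum, hence measurable, and below the transport cost; the
    selection compares with \<open>I\<close> rather than with the cost.\<close>
  define I where "I p = (INF k. G k p)" for p
  have I[measurable]: "I \<in> borel_measurable borel" unfolding I_def by measurable
  have Pp: "prob_space (P k p)" "sets (P k p) = sets borel" for k p
    using measurable_space[OF P(1)[of k], of p] by (auto simp: space_prob_algebra)
  have "G k p \<le> ennreal b" for k p
  proof -
    interpret prob_space "P k p" by (rule Pp)
    have "G k p \<le> (\<integral>\<^sup>+z. ennreal b \<partial>P k p)"
      unfolding G_def using c by (intro nn_integral_mono ennreal_leI)
    then show ?thesis by (simp add: emeasure_space_1)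
  qed
  then have "I p \<le> ennreal b" for p
    unfolding I_def by (intro INF_lower2[of 0]) auto
  then have "I p \<noteq> \<infinity>" for p
    by (metis ennreal_less_top infinity_ennreal_def leD)
  then have I_less: "I p < I p + ennreal \<epsilon>" for p
    using ennreal_add_left_cancel_less[of "I p" 0 "ennreal \<epsilon>"] \<epsilon> by simp
  have ex: "\<exists>k. G k p \<le> I p + ennreal \<epsilon>" for p
  proof -
    have "(INF k. G k p) < I p + ennreal \<epsilon>"
      using I_less[of p] by (simp add: I_def)
    then obtain k where "G k p < I p + ennreal \<epsilon>"
      unfolding INF_less_iff by blast
    then show ?thesis by (intro exI[of _ k] less_imp_le)
  qed
  \<comment> \<open>Taking the least index within \<open>\<epsilon>\<close> of the infimum keeps the
    choice measurable. One exists because the bound \<open>b\<close> on \<open>c\<close> makes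
    \<open>I\<close> finite.\<close>
  define sel where "sel p = (LEAST k. G k p \<le> I p + ennreal \<epsilon>)" for p
  have sel: "G (sel p) p \<le> I p + ennreal \<epsilon>" for p
    unfolding sel_def using ex by (rule LeastI_ex)
  have selm[measurable]: "sel \<in> borel \<rightarrow>\<^sub>M count_space UNIV"
    unfolding sel_def by measurable
  have Ps: "(\<lambda>p. P (sel p) p) \<in> borel \<rightarrow>\<^sub>M prob_algebra borel"
    using P(1) selm by (rule measurable_compose_countable)
  define \<pi> where "\<pi> p = Abs_borel_prob (P (sel p) p)" for p
  have \<pi>m: "\<pi> \<in> borel_measurable borel"
    unfolding \<pi>_def using Ps measurable_Abs_borel_prob by (rule measurable_compose)
  have \<pi>P: "to_measure (\<pi> p) = P (sel p) p" for p
    unfolding \<pi>_def using Pp by (intro to_measure_Abs) auto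
  have f: "push fst (\<pi> p) = fst p" "push snd (\<pi> p) = snd p" for p
    by (auto intro!: borel_prob_eqI simp: to_measure_push measurable_fst_borel measurable_snd_borel \<pi>P P(2,3))
  have pf: "push fst \<in> borel_measurable (borel :: ('a \<times> 'b) borel_prob measure)"
    and ps: "push snd \<in> borel_measurable (borel :: ('a \<times> 'b) borel_prob measure)"
    by (auto intro!: measurable_push2 simp: borel_prod[symmetric])
  let ?k = "push \<pi> \<Gamma>"
  have "push (push fst) ?k = M1" "push (push snd) ?k = M2"
    using \<Gamma> push_push[OF \<pi>m pf, of \<Gamma>] push_push[OF \<pi>m ps, of \<Gamma>]
    by (simp_all add: f couplings_def)
  moreover have "(\<integral>\<^sup>+\<pi>. (\<integral>\<^sup>+z. ennreal (c z) \<partial>to_measure \<pi>) \<partial>to_measure ?k) \<le>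
    (\<integral>\<^sup>+p. transport_cost (\<lambda>x y. ennreal (c (x, y))) (fst p) (snd p) \<partial>to_measure \<Gamma>) + ennreal \<epsilon>"
  proof -
    interpret \<Gamma>: prob_space "to_measure \<Gamma>" by (rule prob_space_to_measure)
    have cm: "(\<lambda>\<pi>. \<integral>\<^sup>+z. ennreal (c z) \<partial>to_measure \<pi>) \<in> borel_measurable borel"
      by (rule measurable_compose[OF measurable_prob_algebraD[OF measurable_to_measure] nn_integral_measurable_subprob_algebra[OF ecm]])
    have "(\<integral>\<^sup>+\<pi>. (\<integral>\<^sup>+z. ennreal (c z) \<partial>to_measure \<pi>) \<partial>to_measure ?k) = (\<integral>\<^sup>+p. G (sel p) p \<partial>to_measure \<Gamma>)"
      unfolding nn_integral_push[OF \<pi>m cm] by (simp add: \<pi>P G_def)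
    also have "\<dots> \<le> (\<integral>\<^sup>+p. I p + ennreal \<epsilon> \<partial>to_measure \<Gamma>)"
      using sel by (intro nn_integral_mono)
    also have "\<dots> = (\<integral>\<^sup>+p. I p \<partial>to_measure \<Gamma>) + ennreal \<epsilon>"
      using \<Gamma>.emeasure_space_1 by (subst nn_integral_add) auto
    also have "(\<integral>\<^sup>+p. I p \<partial>to_measure \<Gamma>) \<le> (\<integral>\<^sup>+p. transport_cost (\<lambda>x y. ennreal (c (x, y))) (fst p) (snd p) \<partial>to_measure \<Gamma>)"
      using P(4) by (intro nn_integral_mono) (simp add: I_def G_def)
    finally show ?thesis by (simp add: add_right_mono)
  qed
  ultimately show ?thesis by blast
qed

section \<open>Strict Monge maps for bounded continuous costs\<close>

lemma ex_strict_monge_map: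
  fixes M1 :: "'a::polish_space borel_prob borel_prob" and M2 :: "'b::polish_space borel_prob borel_prob"
    and c :: "'a \<times> 'b \<Rightarrow> real"
  assumes M1: "atomless M1" "AE \<mu> in to_measure M1. atomless \<mu>" and \<Gamma>: "\<Gamma> \<in> couplings M1 M2"
    and c: "continuous_on UNIV c" "\<And>x. 0 \<le> c x" "\<And>x. c x \<le> b" and \<epsilon>: "0 < \<epsilon>"
  shows "\<exists>T. T \<in> borel_measurable borel \<and> push (induced_map T) M1 = M2 \<and>
    (\<integral>\<^sup>+\<mu>. (\<integral>\<^sup>+x. ennreal (c (x, T (x, \<mu>))) \<partial>to_measure \<mu>) \<partial>to_measure M1) \<le>
    (\<integral>\<^sup>+p. transport_cost (\<lambda>x y. ennreal (c (x, y))) (fst p) (snd p) \<partial>to_measure \<Gamma>) + ennreal \<epsilon>"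
proof -
  have e2: "0 < \<epsilon> / 2" using \<epsilon> by simp
  have e: "x + ennreal (\<epsilon> / 2) + ennreal (\<epsilon> / 2) = x + ennreal \<epsilon>" for x
    using \<epsilon> by (simp add: add.assoc ennreal_plus[symmetric] del: ennreal_plus)
  obtain k where k: "push (push fst) k = M1" "push (push snd) k = M2"
    "(\<integral>\<^sup>+\<pi>. (\<integral>\<^sup>+z. ennreal (c z) \<partial>to_measure \<pi>) \<partial>to_measure k) \<le>
    (\<integral>\<^sup>+p. transport_cost (\<lambda>x y. ennreal (c (x, y))) (fst p) (snd p) \<partial>to_measure \<Gamma>) + ennreal (\<epsilon> / 2)"
    using ex_random_coupling[OF \<Gamma> c e2] by blast
  obtain T where T: "T \<in> borel_measurable borel" "push (induced_map T) M1 = push (push snd) k"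
    "(\<integral>\<^sup>+\<mu>. (\<integral>\<^sup>+x. ennreal (c (x, T (x, \<mu>))) \<partial>to_measure \<mu>) \<partial>to_measure M1) \<le>
    (\<integral>\<^sup>+\<pi>. (\<integral>\<^sup>+z. ennreal (c z) \<partial>to_measure \<pi>) \<partial>to_measure k) + ennreal (\<epsilon> / 2)"
    using ex_transport_map[OF M1 k(1) c e2] by blast
  note T(3)
  also have "(\<integral>\<^sup>+\<pi>. (\<integral>\<^sup>+z. ennreal (c z) \<partial>to_measure \<pi>) \<partial>to_measure k) + ennreal (\<epsilon> / 2) \<le>
    (\<integral>\<^sup>+p. transport_cost (\<lambda>x y. ennreal (c (x, y))) (fst p) (snd p) \<partial>to_measure \<Gamma>) + ennreal \<epsilon>"
    using add_right_mono[OF k(3), of "ennreal (\<epsilon> / 2)"] by (simp only: e)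
  finally show ?thesis using T(1,2) k(2) by auto
qed

text \<open>A map \<open>T\<close> gives couplings on both levels: the graph of
  \<open>induced_map T\<close> under \<open>M1\<close> and, for each \<open>\<mu>\<close>, the graph
  of \<open>T\<close> at \<open>\<mu>\<close>.\<close>

lemma nested_transport_cost_le_strict_monge_cost:
  fixes M1 :: "'a::polish_space borel_prob borel_prob" and M2 :: "'b::polish_space borel_prob borel_prob"
    and c :: "'a \<Rightarrow> 'b \<Rightarrow> ennreal"
  assumes c: "(\<lambda>z. c (fst z) (snd z)) \<in> borel_measurable borel"
  shows "nested_transport_cost c M1 M2 \<le> strict_monge_cost c M1 M2"
  unfolding strict_monge_cost_def
proof (rule INF_greatest)
  fix T assume "T \<in> {T \<in> borel_measurable borel. push (induced_map T) M1 = M2}"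
  then have T: "T \<in> borel_measurable borel" "push (induced_map T) M1 = M2" by auto
  have ind: "induced_map T \<in> borel_measurable borel" using T(1) by (rule measurable_induced_map)
  have g: "(\<lambda>\<mu>. (\<mu>, induced_map T \<mu>)) \<in> borel_measurable borel"
    unfolding borel_prod[symmetric] using ind by measurable
  let ?\<Gamma> = "push (\<lambda>\<mu>. (\<mu>, induced_map T \<mu>)) M1"
  have "?\<Gamma> \<in> couplings M1 M2"
    using push_push[OF g measurable_fst_borel, of M1] push_push[OF g measurable_snd_borel, of M1] T(2)
    by (simp add: couplings_def)
  then have "nested_transport_cost c M1 M2 \<le> (\<integral>\<^sup>+p. transport_cost c (fst p) (snd p) \<partial>to_measure ?\<Gamma>)"
    unfolding nested_transport_cost_def transport_cost_def[of "transport_cost c"] by (rule INF_lower)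
  also have "\<dots> \<le> (\<integral>\<^sup>+\<mu>. (\<integral>\<^sup>+x. c x (T (x, \<mu>)) \<partial>to_measure \<mu>) \<partial>to_measure M1)"
    \<comment> \<open>The transport cost is not known to be measurable here, so the push-forward
      rule is applied to each simple minorant instead.\<close>
    unfolding nn_integral_def[of "to_measure ?\<Gamma>"]
  proof (rule SUP_least)
    fix s assume "s \<in> {s. simple_function (to_measure ?\<Gamma>) s \<and> s \<le> (\<lambda>p. transport_cost c (fst p) (snd p))}"
    then have s: "simple_function (to_measure ?\<Gamma>) s" "\<And>p. s p \<le> transport_cost c (fst p) (snd p)"
      by (auto simp: le_fun_def)
    have sm: "s \<in> borel_measurable borel"
      using borel_measurable_simple_function[OF s(1)] by (simp cong: measurable_cong_sets)
    have "integral\<^sup>S (to_measure ?\<Gamma>) s = (\<integral>\<^sup>+p. s p \<partial>to_measure ?\<Gamma>)"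
      using s(1) by (rule nn_integral_eq_simple_integral[symmetric])
    also have "\<dots> = (\<integral>\<^sup>+\<mu>. s (\<mu>, induced_map T \<mu>) \<partial>to_measure M1)"
      using g sm by (rule nn_integral_push)
    also have "\<dots> \<le> (\<integral>\<^sup>+\<mu>. (\<integral>\<^sup>+x. c x (T (x, \<mu>)) \<partial>to_measure \<mu>) \<partial>to_measure M1)"
    proof (rule nn_integral_mono)
      fix \<mu>
      have h: "(\<lambda>x. (x, T (x, \<mu>))) \<in> borel_measurable borel"
        using T(1) by (rule measurable_Pair_section)
      have "push (\<lambda>x. (x, T (x, \<mu>))) \<mu> \<in> couplings \<mu> (induced_map T \<mu>)"
        using push_push[OF h measurable_fst_borel, of \<mu>] push_push[OF h measurable_snd_borel, of \<mu>]
        by (simp add: couplings_def induced_map_def)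
      then have "transport_cost c \<mu> (induced_map T \<mu>) \<le>
          (\<integral>\<^sup>+z. c (fst z) (snd z) \<partial>to_measure (push (\<lambda>x. (x, T (x, \<mu>))) \<mu>))"
        unfolding transport_cost_def by (rule INF_lower)
      also have "\<dots> = (\<integral>\<^sup>+x. c x (T (x, \<mu>)) \<partial>to_measure \<mu>)"
        unfolding nn_integral_push[OF h c] by simp
      finally show "s (\<mu>, induced_map T \<mu>) \<le> (\<integral>\<^sup>+x. c x (T (x, \<mu>)) \<partial>to_measure \<mu>)"
        using s(2)[of "(\<mu>, induced_map T \<mu>)"] by simp
    qed
    finally show "integral\<^sup>S (to_measure ?\<Gamma>) s \<le> (\<integral>\<^sup>+\<mu>. (\<integral>\<^sup>+x. c x (T (x, \<mu>)) \<partial>to_measure \<mu>) \<partial>to_measure M1)" .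
  qed
  finally show "nested_transport_cost c M1 M2 \<le> (\<integral>\<^sup>+\<mu>. (\<integral>\<^sup>+x. c x (T (x, \<mu>)) \<partial>to_measure \<mu>) \<partial>to_measure M1)" .
qed

lemma nested_transport_cost_eq_strict_monge_cost:
  fixes M1 :: "'a::polish_space borel_prob borel_prob" and M2 :: "'b::polish_space borel_prob borel_prob"
    and c :: "'a \<Rightarrow> 'b \<Rightarrow> real"
  assumes M1: "atomless M1" "AE \<mu> in to_measure M1. atomless \<mu>"
    and c: "continuous_on UNIV (\<lambda>(x, y). c x y)" "bounded (range (\<lambda>(x, y). c x y))" "\<And>x y. 0 \<le> c x y"
  shows "nested_transport_cost (\<lambda>x y. ennreal (c x y)) M1 M2 = strict_monge_cost (\<lambda>x y. ennreal (c x y)) M1 M2"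
proof (rule antisym)
  let ?c = "\<lambda>(x, y). c x y"
  have c': "?c \<in> borel_measurable borel" using c(1) by (rule borel_measurable_continuous_onI)
  then show "nested_transport_cost (\<lambda>x y. ennreal (c x y)) M1 M2 \<le> strict_monge_cost (\<lambda>x y. ennreal (c x y)) M1 M2"
    by (intro nested_transport_cost_le_strict_monge_cost) (simp add: case_prod_beta')
  obtain b where b: "\<And>z. \<bar>?c z\<bar> \<le> b"
    using c(2) unfolding bounded_iff by auto
  have cb: "0 \<le> ?c z" "?c z \<le> b" for z
    using c(3) abs_le_D1[OF b[of z]] by (simp_all add: case_prod_beta')
  show "strict_monge_cost (\<lambda>x y. ennreal (c x y)) M1 M2 \<le> nested_transport_cost (\<lambda>x y. ennreal (c x y)) M1 M2"
    unfolding nested_transport_cost_def transport_cost_def[of "transport_cost _"]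
  proof (rule INF_greatest, rule ennreal_le_epsilon)
    fix \<Gamma> and \<epsilon> :: real assume \<Gamma>: "\<Gamma> \<in> couplings M1 M2" and \<epsilon>: "0 < \<epsilon>"
    obtain T where T: "T \<in> borel_measurable borel" "push (induced_map T) M1 = M2"
      "(\<integral>\<^sup>+\<mu>. (\<integral>\<^sup>+x. ennreal (?c (x, T (x, \<mu>))) \<partial>to_measure \<mu>) \<partial>to_measure M1) \<le>
       (\<integral>\<^sup>+p. transport_cost (\<lambda>x y. ennreal (?c (x, y))) (fst p) (snd p) \<partial>to_measure \<Gamma>) + ennreal \<epsilon>"
      using ex_strict_monge_map[OF M1 \<Gamma> c(1) cb \<epsilon>] by blast
    have "strict_monge_cost (\<lambda>x y. ennreal (c x y)) M1 M2 \<le>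
      (\<integral>\<^sup>+\<mu>. (\<integral>\<^sup>+x. ennreal (c x (T (x, \<mu>))) \<partial>to_measure \<mu>) \<partial>to_measure M1)"
      unfolding strict_monge_cost_def using T by (intro INF_lower) auto
    also have "\<dots> \<le> (\<integral>\<^sup>+p. transport_cost (\<lambda>x y. ennreal (c x y)) (fst p) (snd p) \<partial>to_measure \<Gamma>) + ennreal \<epsilon>"
      using T(3) by simp
    finally show "strict_monge_cost (\<lambda>x y. ennreal (c x y)) M1 M2 \<le>
      (\<integral>\<^sup>+p. transport_cost (\<lambda>x y. ennreal (c x y)) (fst p) (snd p) \<partial>to_measure \<Gamma>) + ennreal \<epsilon>" .
  qed
qed

section \<open>Power costs and Wasserstein spaces\<close>

lemma epowr_root: "0 < p \<Longrightarrow> (t epowr (1 / p)) epowr p = t"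
  by (cases t) (auto simp: epowr_def powr_powr)

lemma edist_epowr: "edist x y epowr p = ennreal (dist x y powr p)"
  by (simp add: epowr_def)

lemma Wp_epowr:
  "0 < p \<Longrightarrow> Wp p \<mu> \<nu> epowr p = transport_cost (\<lambda>x y. ennreal (dist x y powr p)) \<mu> \<nu>"
  by (simp add: Wp_def wasserstein_def epowr_root edist_epowr)

lemma WWp_epowr:
  "0 < p \<Longrightarrow> WWp p M N epowr p = nested_transport_cost (\<lambda>x y. ennreal (dist x y powr p)) M N"
  by (simp add: WWp_def wasserstein_def epowr_root Wp_epowr nested_transport_cost_def)

text \<open>Bounding both legs by the larger one gives the factor \<open>2 powr p\<close> at once,
  for every positive \<open>p\<close>.\<close>

lemma dist_powr_triangle:
  assumes "0 < p"
  shows "dist x z powr p \<le> 2 powr p * (dist x y powr p + dist y z powr p)"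
proof -
  define m where "m = max (dist x y) (dist y z)"
  have "dist x z \<le> 2 * m"
    using dist_triangle[of x z y] unfolding m_def by linarith
  then have "dist x z powr p \<le> (2 * m) powr p"
    using assms by (intro powr_mono2) auto
  also have "\<dots> = 2 powr p * m powr p"
    by (rule powr_mult)
  also have "m powr p \<le> dist x y powr p + dist y z powr p"
    by (auto simp: m_def max_def)
  finally show ?thesis by simp
qed

section \<open>Couplings, moments and truncation\<close>

lemma transport_cost_mono:
  assumes "\<And>x y. c x y \<le> c' x y"
  shows "transport_cost c \<mu> \<nu> \<le> transport_cost c' \<mu> \<nu>"
  unfolding transport_cost_def
proof (rule INF_mono)
  fix \<pi> assume "\<pi> \<in> couplings \<mu> \<nu>"
  then show "\<exists>\<pi>'\<in>couplings \<mu> \<nu>. (\<integral>\<^sup>+z. c (fst z) (snd z) \<partial>to_measure \<pi>') \<le> (\<integral>\<^sup>+z. c' (fst z) (snd z) \<partial>to_measure \<pi>)"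
    by (intro bexI[of _ \<pi>] nn_integral_mono assms)
qed

lemma ex_coupling:
  fixes \<mu> :: "'a::second_countable_topology borel_prob" and \<nu> :: "'b::second_countable_topology borel_prob"
  shows "couplings \<mu> \<nu> \<noteq> {}"
proof -
  let ?M = "to_measure \<mu> \<Otimes>\<^sub>M to_measure \<nu>"
  have s: "sets ?M = sets borel"
    unfolding borel_prod[symmetric] by (intro sets_pair_measure_cong) auto
  have p: "prob_space ?M" by (intro prob_space_pair prob_space_to_measure)
  have t: "to_measure (Abs_borel_prob ?M) = ?M" using p s by (rule to_measure_Abs)
  have "distr ?M borel fst = distr ?M (to_measure \<mu>) fst" "distr ?M borel snd = distr ?M (to_measure \<nu>) snd"
    by (intro distr_cong; simp)+
  then have "Abs_borel_prob ?M \<in> couplings \<mu> \<nu>"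
    using prob_space.distr_pair_fst[of "to_measure \<nu>" "to_measure \<mu>"] distr_pair_snd[of "to_measure \<mu>" "to_measure \<nu>"]
    by (auto simp: couplings_def to_measure_push measurable_fst_borel measurable_snd_borel t prob_space_to_measure intro!: borel_prob_eqI)
  then show ?thesis by blast
qed

lemma measurable_moment:
  "(\<lambda>\<mu> :: 'a::polish_space borel_prob. \<integral>\<^sup>+x. ennreal (dist x x0 powr p) \<partial>to_measure \<mu>) \<in> borel_measurable borel"
  by (rule measurable_compose[OF measurable_prob_algebraD[OF measurable_to_measure] nn_integral_measurable_subprob_algebra])
     measurable

text \<open>The triangle inequality through the coupled point, integrated against
  \<open>\<pi>\<close>. It turns finite cost to a measure of finite moment into a finite
  moment.\<close>

lemma moment_le_transport_cost:
  fixes \<mu> :: "'a::polish_space borel_prob"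
  assumes p: "0 < p" and \<pi>: "\<pi> \<in> couplings \<mu> \<nu>"
  shows "(\<integral>\<^sup>+x. ennreal (dist x x0 powr p) \<partial>to_measure \<mu>) \<le>
    ennreal (2 powr p) * (\<integral>\<^sup>+z. ennreal (dist (fst z) (snd z) powr p) \<partial>to_measure \<pi>) +
    ennreal (2 powr p) * (\<integral>\<^sup>+x. ennreal (dist x x0 powr p) \<partial>to_measure \<nu>)"
proof -
  have f[measurable]: "(\<lambda>x :: 'a. ennreal (dist x x0 powr p)) \<in> borel_measurable borel" by measurable
  note measurable_fst_borel[measurable] measurable_snd_borel[measurable]
  have d: "(\<lambda>z :: 'a \<times> 'a. dist (fst z) (snd z)) \<in> borel_measurable borel"
    by (intro borel_measurable_continuous_onI continuous_intros)
  then have g[measurable]: "(\<lambda>z :: 'a \<times> 'a. ennreal (dist (fst z) (snd z) powr p)) \<in> borel_measurable borel"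
    by measurable
  have "(\<integral>\<^sup>+x. ennreal (dist x x0 powr p) \<partial>to_measure \<mu>) = (\<integral>\<^sup>+z. ennreal (dist (fst z) x0 powr p) \<partial>to_measure \<pi>)"
    using \<pi> nn_integral_push[OF measurable_fst_borel f, of \<pi>] by (simp add: couplings_def)
  also have "\<dots> \<le> (\<integral>\<^sup>+z. ennreal (2 powr p) * ennreal (dist (fst z) (snd z) powr p) + ennreal (2 powr p) * ennreal (dist (snd z) x0 powr p) \<partial>to_measure \<pi>)"
  proof (rule nn_integral_mono)
    fix z :: "'a \<times> 'a"
    have "ennreal (dist (fst z) x0 powr p) \<le> ennreal (2 powr p * dist (fst z) (snd z) powr p + 2 powr p * dist (snd z) x0 powr p)"
      using dist_powr_triangle[OF p, of "fst z" x0 "snd z"] by (intro ennreal_leI) (simp add: distrib_left)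
    then show "ennreal (dist (fst z) x0 powr p) \<le> ennreal (2 powr p) * ennreal (dist (fst z) (snd z) powr p) + ennreal (2 powr p) * ennreal (dist (snd z) x0 powr p)"
      by (simp add: ennreal_plus ennreal_mult)
  qed
  also have "\<dots> = ennreal (2 powr p) * (\<integral>\<^sup>+z. ennreal (dist (fst z) (snd z) powr p) \<partial>to_measure \<pi>) +
      ennreal (2 powr p) * (\<integral>\<^sup>+z. ennreal (dist (snd z) x0 powr p) \<partial>to_measure \<pi>)"
  proof -
    have h: "(\<lambda>z :: 'a \<times> 'a. ennreal (dist (snd z) x0 powr p)) \<in> borel_measurable borel"
      using measurable_compose[OF measurable_snd_borel f] .
    have "(\<lambda>z :: 'a \<times> 'a. ennreal (dist (snd z) x0 powr p)) \<in> borel_measurable (to_measure \<pi>)"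
       "(\<lambda>z :: 'a \<times> 'a. ennreal (dist (fst z) (snd z) powr p)) \<in> borel_measurable (to_measure \<pi>)"
      using h g by (simp_all cong: measurable_cong_sets)
    then show ?thesis
      by (simp add: nn_integral_add nn_integral_cmult)
  qed
  also have "(\<integral>\<^sup>+z. ennreal (dist (snd z) x0 powr p) \<partial>to_measure \<pi>) = (\<integral>\<^sup>+x. ennreal (dist x x0 powr p) \<partial>to_measure \<nu>)"
    using \<pi> nn_integral_push[OF measurable_snd_borel f, of \<pi>] by (simp add: couplings_def)
  finally show ?thesis .
qed

text \<open>
  The transport cost is not known to be measurable here, so its integral is a lower integral; hence
  the detour through the measurable minorant \<open>(f - K * m) / K\<close>.
\<close>

lemma PpPp_finite_moment:
  fixes M :: "'a::polish_space borel_prob borel_prob"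
  assumes p: "1 \<le> p" and M: "M \<in> PpPp p"
  shows "\<exists>x0. (\<integral>\<^sup>+\<mu>. (\<integral>\<^sup>+x. ennreal (dist x x0 powr p) \<partial>to_measure \<mu>) \<partial>to_measure M) < \<infinity>"
proof -
  interpret M: prob_space "to_measure M" by (rule prob_space_to_measure)
  have p0: "0 < p" using p by simp
  obtain \<nu> where \<nu>: "\<nu> \<in> Pp p" "(\<integral>\<^sup>+\<mu>. transport_cost (\<lambda>x y. ennreal (dist x y powr p)) \<mu> \<nu> \<partial>to_measure M) < \<infinity>"
    using M by (auto simp: PpPp_def wasserstein_space_def Wp_epowr[OF p0])
  then obtain x0 where fin0: "(\<integral>\<^sup>+x. ennreal (dist x x0 powr p) \<partial>to_measure \<nu>) < \<infinity>"
    by (auto simp: Pp_def wasserstein_space_def edist_epowr)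
  define K where "K = ennreal (2 powr p)"
  \<comment> \<open>The inverse of \<open>K\<close> in \<open>ennreal\<close>; cancellation goes
    through \<open>K * L = 1\<close>.\<close>
  define L where "L = ennreal (1 / 2 powr p)"
  have KL: "K * L = 1"
    unfolding K_def L_def by (subst ennreal_mult[symmetric]) (auto simp: )
  define m where "m = (\<integral>\<^sup>+x. ennreal (dist x x0 powr p) \<partial>to_measure \<nu>)"
  have Km: "K * m < \<infinity>"
    using fin0 unfolding K_def m_def by (simp add: ennreal_mult_less_top)
  then have Km': "K * m \<noteq> \<top>" by auto
  define f where "f \<mu> = (\<integral>\<^sup>+x. ennreal (dist x x0 powr p) \<partial>to_measure \<mu>)" for \<mu> :: "'a borel_prob"
  have f[measurable]: "f \<in> borel_measurable borel" unfolding f_def by (rule measurable_moment)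
  define g where "g \<mu> = L * (f \<mu> - K * m)" for \<mu>
  have g[measurable]: "g \<in> borel_measurable borel" unfolding g_def by measurable
  have gC: "g \<mu> \<le> transport_cost (\<lambda>x y. ennreal (dist x y powr p)) \<mu> \<nu>" for \<mu>
    unfolding transport_cost_def
  proof (rule INF_greatest)
    fix \<pi> assume "\<pi> \<in> couplings \<mu> \<nu>"
    let ?C = "\<integral>\<^sup>+z. ennreal (dist (fst z) (snd z) powr p) \<partial>to_measure \<pi>"
    have "f \<mu> \<le> K * m + K * ?C"
      using moment_le_transport_cost[OF p0 \<open>\<pi> \<in> couplings \<mu> \<nu>\<close>, of x0] unfolding f_def K_def m_def
      by (simp add: add.commute)
    then have "f \<mu> - K * m \<le> K * ?C"
      using Km' ennreal_minus_le_iff[of "f \<mu>" "K * m" "K * ?C"] by simp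
    then have "g \<mu> \<le> L * (K * ?C)"
      unfolding g_def by (rule mult_left_mono) simp
    also have "\<dots> = ?C" using KL by (simp add: mult.assoc[symmetric] mult.commute)
    finally show "g \<mu> \<le> ?C" .
  qed
  have "f \<mu> \<le> K * g \<mu> + K * m" for \<mu>
  proof -
    have "K * g \<mu> = f \<mu> - K * m"
      using KL by (simp add: g_def mult.assoc[symmetric])
    then show ?thesis
      using Km' ennreal_minus_le_iff[of "f \<mu>" "K * m" "f \<mu> - K * m"] by (simp add: add.commute)
  qed
  then have "(\<integral>\<^sup>+\<mu>. f \<mu> \<partial>to_measure M) \<le> (\<integral>\<^sup>+\<mu>. K * g \<mu> + K * m \<partial>to_measure M)"
    by (intro nn_integral_mono)
  also have "\<dots> = K * (\<integral>\<^sup>+\<mu>. g \<mu> \<partial>to_measure M) + K * m"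
    using M.emeasure_space_1 by (simp add: nn_integral_add nn_integral_cmult)
  also have "\<dots> < \<infinity>"
  proof -
    have "(\<integral>\<^sup>+\<mu>. g \<mu> \<partial>to_measure M) < \<infinity>"
      by (rule le_less_trans[OF nn_integral_mono \<nu>(2)]) (rule gC)
    then show ?thesis
      using Km unfolding K_def by (simp add: ennreal_mult_less_top)
  qed
  finally show ?thesis unfolding f_def by blast
qed

text \<open>\<open>ennreal\<close> sends negative reals to 0, so the integrand is the positive part
  of \<open>a x - real k\<close>; it vanishes for large \<open>k\<close> at each point and is
  dominated by \<open>ennreal (a x)\<close>.\<close>

lemma nn_integral_excess_small:
  fixes a :: "'a \<Rightarrow> real"
  assumes [measurable]: "a \<in> borel_measurable M" and fin: "(\<integral>\<^sup>+x. ennreal (a x) \<partial>M) < \<infinity>" and \<delta>: "0 < \<delta>"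
  shows "\<exists>n::nat. \<forall>k\<ge>n. (\<integral>\<^sup>+x. ennreal (a x - real k) \<partial>M) \<le> \<delta>"
proof -
  have "(\<lambda>n. \<integral>\<^sup>+x. ennreal (a x - real n) \<partial>M) \<longlonglongrightarrow> (\<integral>\<^sup>+x. 0 \<partial>M)"
  proof (rule nn_integral_dominated_convergence)
    show "AE x in M. ennreal (a x - real n) \<le> ennreal (a x)" for n
      by (intro AE_I2 ennreal_leI) simp
    show "AE x in M. (\<lambda>n. ennreal (a x - real n)) \<longlonglongrightarrow> 0"
    proof (intro AE_I2 tendsto_eventually)
      fix x
      obtain N :: nat where N: "a x < real N" using reals_Archimedean2 by blast
      show "\<forall>\<^sub>F n in sequentially. ennreal (a x - real n) = 0"
        using eventually_ge_at_top[of N]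
      proof eventually_elim
        case (elim n)
        then have "a x - real n \<le> 0"
          using N by linarith
        then show ?case by (rule ennreal_neg)
      qed
    qed
  qed (use fin in auto)
  then have "\<forall>\<^sub>F n in sequentially. (\<integral>\<^sup>+x. ennreal (a x - real n) \<partial>M) < \<delta>"
    using \<delta> by (intro order_tendstoD) auto
  then show ?thesis by (auto simp: eventually_sequentially intro: less_imp_le)
qed

text \<open>The cost is cut at height \<open>2 * N\<close>, and what is cut off is at most a
  function of \<open>x\<close> plus a function of \<open>y\<close>. Since
  \<open>induced_map T\<close> maps \<open>M1\<close> exactly onto \<open>M2\<close>, the second
  integrates to a number that depends on \<open>M2\<close> alone, so \<open>N\<close> can be fixed
  before \<open>T\<close>.\<close>

lemma ex_strict_monge_map_dist:
  fixes M1 M2 :: "'a::polish_space borel_prob borel_prob"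
  assumes M1: "atomless M1" "AE \<mu> in to_measure M1. atomless \<mu>"
    and p: "1 \<le> p" and P: "M1 \<in> PpPp p" "M2 \<in> PpPp p" and \<epsilon>: "0 < \<epsilon>"
  shows "\<exists>T :: 'a \<times> 'a borel_prob \<Rightarrow> 'a. T \<in> borel_measurable borel \<and> push (induced_map T) M1 = M2 \<and>
    (\<integral>\<^sup>+\<mu>. (\<integral>\<^sup>+x. ennreal (dist x (T (x, \<mu>)) powr p) \<partial>to_measure \<mu>) \<partial>to_measure M1)
      \<le> WWp p M1 M2 epowr p + ennreal \<epsilon>"
proof -
  have p0: "0 < p" using p by simp
  \<comment> \<open>One quarter each for the choice of \<open>\<Gamma>\<close>, for the map
    \<open>T\<close> and for the two excess terms.\<close>
  define \<delta> where "\<delta> = \<epsilon> / 4"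
  have \<delta>: "0 < \<delta>" "0 < ennreal \<delta>" using \<epsilon> by (auto simp: \<delta>_def)
  obtain x1 where x1: "(\<integral>\<^sup>+\<mu>. (\<integral>\<^sup>+x. ennreal (dist x x1 powr p) \<partial>to_measure \<mu>) \<partial>to_measure M1) < \<infinity>"
    using PpPp_finite_moment[OF p P(1)] by blast
  obtain x2 where x2: "(\<integral>\<^sup>+\<mu>. (\<integral>\<^sup>+x. ennreal (dist x x2 powr p) \<partial>to_measure \<mu>) \<partial>to_measure M2) < \<infinity>"
    using PpPp_finite_moment[OF p P(2)] by blast
  define K :: real where "K = 2 powr p"
  have K: "0 \<le> K" by (simp add: K_def)
  \<comment> \<open>Two applications of \<open>dist_powr_triangle\<close>, through \<open>x1\<close>
    and then \<open>x2\<close>: the finite moments of \<open>M1\<close> and \<open>M2\<close> come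
    with possibly different base points, and the constant distance between these goes into
    \<open>b\<close>.\<close>
  define a where "a x = K * dist x x1 powr p" for x :: 'a
  define b where "b y = K * (K * dist y x2 powr p + K * dist x2 x1 powr p)" for y :: 'a
  have ab: "a \<in> borel_measurable borel" "b \<in> borel_measurable borel"
    unfolding a_def[abs_def] b_def[abs_def] by measurable
  have cab: "dist x y powr p \<le> a x + b y" for x y
  proof -
    have "dist x y powr p \<le> K * (dist x x1 powr p + dist x1 y powr p)"
      unfolding K_def by (rule dist_powr_triangle[OF p0])
    also have "dist x1 y powr p \<le> K * (dist y x2 powr p + dist x2 x1 powr p)"
      unfolding K_def dist_commute[of x1 y] by (rule dist_powr_triangle[OF p0])
    finally show ?thesis using K by (simp add: a_def b_def distrib_left mult_left_mono)
  qed
  have bary: "(\<integral>\<^sup>+x. h x \<partial>(to_measure M \<bind> to_measure)) = (\<integral>\<^sup>+\<mu>. (\<integral>\<^sup>+x. h x \<partial>to_measure \<mu>) \<partial>to_measure M)"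
    if "h \<in> borel_measurable borel" for h :: "'a \<Rightarrow> ennreal" and M
    using prob_space_bind_to_measure(4)[OF measurable_to_measure that] .
  have sb: "sets (to_measure M \<bind> to_measure) = sets (borel :: 'a measure)" "prob_space (to_measure M \<bind> to_measure)"
    for M :: "'a borel_prob borel_prob"
    using prob_space_bind_to_measure[OF measurable_to_measure] by auto
  let ?m1 = "to_measure M1 \<bind> to_measure" and ?m2 = "to_measure M2 \<bind> to_measure"
  have mb: "h \<in> borel_measurable (to_measure M \<bind> to_measure)" if "h \<in> borel_measurable (borel :: 'a measure)"
    for h :: "'a \<Rightarrow> 'c::topological_space" and M
    using that measurable_cong_sets[OF sb(1) refl] by blast
  have dm: "(\<lambda>x :: 'a. ennreal (dist x z powr p)) \<in> borel_measurable borel" for z by measurable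
  have fa: "(\<integral>\<^sup>+x. ennreal (a x) \<partial>?m1) < \<infinity>"
  proof -
    have "(\<integral>\<^sup>+x. ennreal (a x) \<partial>?m1) = (\<integral>\<^sup>+x. ennreal K * ennreal (dist x x1 powr p) \<partial>?m1)"
      using K by (simp add: a_def ennreal_mult)
    also have "\<dots> = ennreal K * (\<integral>\<^sup>+x. ennreal (dist x x1 powr p) \<partial>?m1)"
      by (rule nn_integral_cmult) (rule mb[OF dm])
    also have "\<dots> < \<infinity>"
      using x1 by (simp add: bary[OF dm] ennreal_mult_less_top)
    finally show ?thesis .
  qed
  have fb: "(\<integral>\<^sup>+x. ennreal (b x) \<partial>?m2) < \<infinity>"
  proof -
    interpret m2: prob_space ?m2 by (rule sb)
    have "(\<integral>\<^sup>+x. ennreal (b x) \<partial>?m2) = (\<integral>\<^sup>+x. ennreal (K * K) * ennreal (dist x x2 powr p) + ennreal (K * K * dist x2 x1 powr p) \<partial>?m2)"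
      using K by (simp add: b_def distrib_left ennreal_mult[symmetric] ennreal_plus[symmetric] mult.assoc del: ennreal_plus)
    also have "\<dots> = ennreal (K * K) * (\<integral>\<^sup>+x. ennreal (dist x x2 powr p) \<partial>?m2) + ennreal (K * K * dist x2 x1 powr p)"
      using mb[OF dm] m2.emeasure_space_1 by (simp add: nn_integral_add nn_integral_cmult)
    also have "\<dots> < \<infinity>"
      using x2 by (simp add: bary[OF dm] ennreal_mult_less_top)
    finally show ?thesis .
  qed
  obtain n1 where n1: "\<And>k. k \<ge> n1 \<Longrightarrow> (\<integral>\<^sup>+x. ennreal (a x - real k) \<partial>?m1) \<le> ennreal \<delta>"
    using nn_integral_excess_small[OF mb[OF ab(1)] fa \<delta>(2)] by blast
  obtain n2 where n2: "\<And>k. k \<ge> n2 \<Longrightarrow> (\<integral>\<^sup>+x. ennreal (b x - real k) \<partial>?m2) \<le> ennreal \<delta>"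
    using nn_integral_excess_small[OF mb[OF ab(2)] fb \<delta>(2)] by blast
  define N where "N = max n1 n2"
  define c :: "'a \<times> 'a \<Rightarrow> real" where "c z = min (dist (fst z) (snd z) powr p) (2 * real N)" for z
  have c: "continuous_on UNIV c" "\<And>z. 0 \<le> c z" "\<And>z. c z \<le> 2 * real N"
  proof -
    have "continuous_on UNIV (\<lambda>z :: 'a \<times> 'a. dist (fst z) (snd z) powr p)"
      by (rule continuous_on_powr') (use p0 in \<open>auto intro!: continuous_intros\<close>)
    then show "continuous_on UNIV c"
      unfolding c_def by (intro continuous_on_min continuous_on_const)
  qed (auto simp: c_def)
  \<comment> \<open>Where the cut is active, the cost is at most \<open>a x + b y\<close>, that is,
    the height \<open>2 * N\<close> plus \<open>a x - N\<close> plus \<open>b y - N\<close>.\<close>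
  have split: "ennreal (dist x y powr p) \<le> ennreal (c (x, y)) + ennreal (a x - real N) + ennreal (b y - real N)" for x y
  proof -
    have "ennreal (dist x y powr p) \<le> ennreal (c (x, y) + max 0 (a x - real N) + max 0 (b y - real N))"
      using cab[of x y] by (intro ennreal_leI) (auto simp: c_def min_def max_def)
    also have "\<dots> = ennreal (c (x, y)) + ennreal (max 0 (a x - real N)) + ennreal (max 0 (b y - real N))"
      using c(2) by (simp add: ennreal_plus)
    finally show ?thesis by (simp add: max_def ennreal_neg split: if_splits)
  qed
  let ?W = "WWp p M1 M2 epowr p"
  have "\<exists>\<Gamma>\<in>couplings M1 M2. (\<integral>\<^sup>+q. transport_cost (\<lambda>x y. ennreal (c (x, y))) (fst q) (snd q) \<partial>to_measure \<Gamma>) \<le> ?W + ennreal \<delta>"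
  \<comment> \<open>Any coupling meets an infinite bound, and finiteness is what makes adding
    \<open>\<delta>\<close> a strict increase.\<close>
  proof (cases "?W = \<infinity>")
    case True
    then show ?thesis using ex_coupling[of M1 M2] by auto
  next
    case False
    then have "?W < ?W + ennreal \<delta>"
      using ennreal_add_left_cancel_less[of ?W 0 "ennreal \<delta>"] \<delta> by simp
    then have "(INF \<Gamma>\<in>couplings M1 M2. \<integral>\<^sup>+q. transport_cost (\<lambda>x y. ennreal (dist x y powr p)) (fst q) (snd q) \<partial>to_measure \<Gamma>) < ?W + ennreal \<delta>"
      by (simp add: WWp_epowr[OF p0] nested_transport_cost_def transport_cost_def[of "transport_cost _"])
    then obtain \<Gamma> where \<Gamma>: "\<Gamma> \<in> couplings M1 M2"
      "(\<integral>\<^sup>+q. transport_cost (\<lambda>x y. ennreal (dist x y powr p)) (fst q) (snd q) \<partial>to_measure \<Gamma>) < ?W + ennreal \<delta>"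
      unfolding INF_less_iff by blast
    have "(\<integral>\<^sup>+q. transport_cost (\<lambda>x y. ennreal (c (x, y))) (fst q) (snd q) \<partial>to_measure \<Gamma>) \<le>
      (\<integral>\<^sup>+q. transport_cost (\<lambda>x y. ennreal (dist x y powr p)) (fst q) (snd q) \<partial>to_measure \<Gamma>)"
      by (intro nn_integral_mono transport_cost_mono ennreal_leI) (simp add: c_def)
    then show ?thesis using \<Gamma> by (intro bexI[of _ \<Gamma>]) auto
  qed
  then obtain \<Gamma> where \<Gamma>: "\<Gamma> \<in> couplings M1 M2"
    "(\<integral>\<^sup>+q. transport_cost (\<lambda>x y. ennreal (c (x, y))) (fst q) (snd q) \<partial>to_measure \<Gamma>) \<le> ?W + ennreal \<delta>"
    by blast
  obtain T where T: "T \<in> borel_measurable borel" "push (induced_map T) M1 = M2"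
    "(\<integral>\<^sup>+\<mu>. (\<integral>\<^sup>+x. ennreal (c (x, T (x, \<mu>))) \<partial>to_measure \<mu>) \<partial>to_measure M1) \<le>
     (\<integral>\<^sup>+q. transport_cost (\<lambda>x y. ennreal (c (x, y))) (fst q) (snd q) \<partial>to_measure \<Gamma>) + ennreal \<delta>"
    using ex_strict_monge_map[OF M1 \<Gamma>(1) c \<delta>(1)] by blast
  have ind: "induced_map T \<in> borel_measurable borel" using T(1) by (rule measurable_induced_map)
  have Tp: "T \<in> borel_measurable (borel \<Otimes>\<^sub>M borel)" using T(1) by (simp add: borel_prod)
  let ?h1 = "\<lambda>x \<mu>. ennreal (c (x, T (x, \<mu>)))" and ?h2 = "\<lambda>x. ennreal (a x - real N)" and ?h3 = "\<lambda>y. ennreal (b y - real N)"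
  have h2: "?h2 \<in> borel_measurable borel" and h3: "?h3 \<in> borel_measurable borel"
    using ab by measurable
  have cm: "c \<in> borel_measurable borel" using c(1) by (rule borel_measurable_continuous_onI)
  have m1: "(\<lambda>x. ?h1 x \<mu>) \<in> borel_measurable (to_measure \<mu>)" for \<mu>
    using measurable_compose[OF measurable_Pair_section[OF T(1)] cm]
    by (intro measurable_compose[OF _ measurable_ennreal]) (simp cong: measurable_cong_sets)
  have m2: "?h2 \<in> borel_measurable (to_measure \<mu>)" for \<mu>
    using h2 measurable_cong_sets[OF sets_to_measure[of \<mu>] refl] by blast
  have m3: "(\<lambda>x. ?h3 (T (x, \<mu>))) \<in> borel_measurable (to_measure \<mu>)" for \<mu>
    using measurable_compose[OF measurable_section[OF T(1)] h3]
      measurable_cong_sets[OF sets_to_measure[of \<mu>] refl] by blast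
  have i1: "(\<lambda>\<mu>. \<integral>\<^sup>+x. ?h1 x \<mu> \<partial>to_measure \<mu>) \<in> borel_measurable (to_measure M1)"
  proof -
    have "(\<lambda>\<mu>. \<integral>\<^sup>+z. ennreal (c z) \<partial>distr (to_measure \<mu>) borel (\<lambda>x. (x, T (x, \<mu>)))) \<in> borel_measurable borel"
      using cm by (intro measurable_compose[OF measurable_prob_algebraD[OF measurable_graph_kernel[OF T(1)]] nn_integral_measurable_subprob_algebra]) simp
    moreover have "(\<integral>\<^sup>+z. ennreal (c z) \<partial>distr (to_measure \<mu>) borel (\<lambda>x. (x, T (x, \<mu>)))) = (\<integral>\<^sup>+x. ?h1 x \<mu> \<partial>to_measure \<mu>)" for \<mu>
      using measurable_Pair_section[OF T(1)] cm by (subst nn_integral_distr) auto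
    ultimately show ?thesis by (simp cong: measurable_cong_sets)
  qed
  have i2: "(\<lambda>\<mu>. \<integral>\<^sup>+x. ?h2 x \<partial>to_measure \<mu>) \<in> borel_measurable borel"
    and i3: "(\<lambda>\<mu>. \<integral>\<^sup>+x. ?h3 x \<partial>to_measure \<mu>) \<in> borel_measurable borel"
    using h2 h3 by (auto intro!: measurable_compose[OF measurable_prob_algebraD[OF measurable_to_measure] nn_integral_measurable_subprob_algebra])
  \<comment> \<open>Here exactness enters: the excess at \<open>T (x, \<mu>)\<close> is an integral
    against \<open>induced_map T \<mu>\<close>, whose law under \<open>M1\<close> is
    \<open>M2\<close>.\<close>
  have e3: "(\<integral>\<^sup>+x. ?h3 (T (x, \<mu>)) \<partial>to_measure \<mu>) = (\<integral>\<^sup>+y. ?h3 y \<partial>to_measure (induced_map T \<mu>))" for \<mu>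
    unfolding induced_map_def using nn_integral_push[OF measurable_section[OF T(1)] h3] by simp
  have i3': "(\<lambda>\<mu>. \<integral>\<^sup>+y. ?h3 y \<partial>to_measure (induced_map T \<mu>)) \<in> borel_measurable (to_measure M1)"
    using measurable_compose[OF ind i3] by (simp cong: measurable_cong_sets)
  have "(\<integral>\<^sup>+\<mu>. (\<integral>\<^sup>+x. ennreal (dist x (T (x, \<mu>)) powr p) \<partial>to_measure \<mu>) \<partial>to_measure M1) \<le>
    (\<integral>\<^sup>+\<mu>. (\<integral>\<^sup>+x. ?h1 x \<mu> + ?h2 x + ?h3 (T (x, \<mu>)) \<partial>to_measure \<mu>) \<partial>to_measure M1)"
    by (intro nn_integral_mono split)
  also have "\<dots> = (\<integral>\<^sup>+\<mu>. (\<integral>\<^sup>+x. ?h1 x \<mu> \<partial>to_measure \<mu>) + (\<integral>\<^sup>+x. ?h2 x \<partial>to_measure \<mu>) +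
      (\<integral>\<^sup>+y. ?h3 y \<partial>to_measure (induced_map T \<mu>)) \<partial>to_measure M1)"
    using m1 m2 m3 by (simp add: nn_integral_add e3)
  also have "\<dots> = (\<integral>\<^sup>+\<mu>. (\<integral>\<^sup>+x. ?h1 x \<mu> \<partial>to_measure \<mu>) \<partial>to_measure M1) + (\<integral>\<^sup>+\<mu>. (\<integral>\<^sup>+x. ?h2 x \<partial>to_measure \<mu>) \<partial>to_measure M1) +
      (\<integral>\<^sup>+\<mu>. (\<integral>\<^sup>+y. ?h3 y \<partial>to_measure (induced_map T \<mu>)) \<partial>to_measure M1)"
    using i1 i2 i3' by (simp add: nn_integral_add cong: measurable_cong_sets)
  also have "(\<integral>\<^sup>+\<mu>. (\<integral>\<^sup>+y. ?h3 y \<partial>to_measure (induced_map T \<mu>)) \<partial>to_measure M1) = (\<integral>\<^sup>+\<nu>. (\<integral>\<^sup>+y. ?h3 y \<partial>to_measure \<nu>) \<partial>to_measure M2)"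
    using nn_integral_push[OF ind i3, of M1] T(2) by simp
  also have "\<dots> = (\<integral>\<^sup>+y. ?h3 y \<partial>?m2)"
    using bary[OF h3] by simp
  also have "(\<integral>\<^sup>+\<mu>. (\<integral>\<^sup>+x. ?h2 x \<partial>to_measure \<mu>) \<partial>to_measure M1) = (\<integral>\<^sup>+x. ?h2 x \<partial>?m1)"
    using bary[OF h2] by simp
  also have "(\<integral>\<^sup>+\<mu>. (\<integral>\<^sup>+x. ?h1 x \<mu> \<partial>to_measure \<mu>) \<partial>to_measure M1) + (\<integral>\<^sup>+x. ?h2 x \<partial>?m1) + (\<integral>\<^sup>+y. ?h3 y \<partial>?m2)
      \<le> (?W + ennreal \<delta> + ennreal \<delta>) + ennreal \<delta> + ennreal \<delta>"
    using n1[of N] n2[of N] order_trans[OF T(3) add_right_mono[OF \<Gamma>(2)]]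
    by (intro add_mono) (auto simp: N_def)
  also have "\<dots> = ?W + ennreal \<epsilon>"
    using \<epsilon> by (simp add: \<delta>_def add.assoc ennreal_plus[symmetric] del: ennreal_plus)
  finally show ?thesis using T(1,2) by blast
qed

theorem theorem1p4:
  fixes M\<^sub>1 :: "'a::polish_space borel_prob borel_prob"
  assumes "atomless M\<^sub>1"
    and "AE \<mu> in to_measure M\<^sub>1. atomless \<mu>"
  shows
    "(\<forall>(c :: 'a \<Rightarrow> 'b::polish_space \<Rightarrow> real) (M\<^sub>2 :: 'b borel_prob borel_prob).
        continuous_on UNIV (\<lambda>(x, y). c x y) \<and> bounded (range (\<lambda>(x, y). c x y)) \<and> (\<forall>x y. 0 \<le> c x y) \<longrightarrow>
          nested_transport_cost (\<lambda>x y. ennreal (c x y)) M\<^sub>1 M\<^sub>2 =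
          strict_monge_cost (\<lambda>x y. ennreal (c x y)) M\<^sub>1 M\<^sub>2) \<and>
     (\<forall>(p :: real) (M\<^sub>2 :: 'a borel_prob borel_prob).
        1 \<le> p \<and> M\<^sub>1 \<in> PpPp p \<and> M\<^sub>2 \<in> PpPp p \<longrightarrow>
          (\<forall>\<epsilon>>0. \<exists>T :: 'a \<times> 'a borel_prob \<Rightarrow> 'a.
             T \<in> borel_measurable borel \<and>
             push (induced_map T) M\<^sub>1 = M\<^sub>2 \<and>
             (\<integral>\<^sup>+\<mu>. (\<integral>\<^sup>+x. ennreal (dist x (T (x, \<mu>)) powr p) \<partial>to_measure \<mu>) \<partial>to_measure M\<^sub>1)
               \<le> WWp p M\<^sub>1 M\<^sub>2 epowr p + ennreal \<epsilon>))"
  using nested_transport_cost_eq_strict_monge_cost[OF assms] ex_strict_monge_map_dist[OF assms]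
  by blast

end
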